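(* Let $X=(X_t)_{t\ge0}$, $X_0=0$, be a real-valued càdlàg Lévy process with canonical triplet $(\gamma,0,\Pi_X)$. Assume $X$ is in the domain of attraction of a stable law at $0$ (resp. at $\infty$) with non-stochastic centering and norming functions $a_t\in\mathbb{R}$, $b_t>0$, i.e. $(X_t-a_t)/b_t\to Y$ in distribution as $t\downarrow0$ (resp. $t\to\infty$) for an a.s. finite, non-degenerate, non-normal random variable $Y$, and that moreover $\mathcal{I}_t:=\big((X_{\tau t}-\tau a_t)/b_t\big)_{0\le\tau\le1}\to\mathcal{Y}=(Y_\tau)_{0\le\tau\le1}$ weakly in $\mathbb{D}$ with the $J_1$-topology as $t\downarrow0$ (resp. $t\to\infty$), where $\mathcal{Y}$ is a stable$(\alpha)$ Lévy process, $\alpha\in(0,2)$, with $Y_1\overset{D}{=}Y$, canonical triplet $(0,0,\Pi_Y)$ and $\overline{\Pi}_Y(x)=\Pi_Y(\mathbb{R}\setminus[-x,x])=cx^{-\alpha}$, $x>0$, for some $c>0$. Then, with the same $a_t,b_t$, and convergence in distribution in $\mathbb{D}$ with the $J_1$-topology as $t\downarrow0$ (resp. $t\to\infty$): (i) if $\overline{\Pi}^+_X(0+)=\infty$ and $r\in\mathbb{N}$, then $\big(({}^{(r)}X^R_{\tau t}-\tau a_t)/b_t\big)_{0\le\tau\le1}\to{}^{(r)}\mathcal{Y}^R:=\mathcal{R}^{(r)}_{trim}(\mathcal{Y})$; (ii) if $\overline{\Pi}^+_X(0+)=\overline{\Pi}^-_X(0+)=\infty$ and $r,s\in\mathbb{N}_0$,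 then $\big(({}^{(r,s)}X_{\tau t}-\tau a_t)/b_t\big)_{0\le\tau\le1}\to{}^{(r,s)}\mathcal{Y}:=\mathcal{T}^{(r,s)}_{rim}(\mathcal{Y})$; (iii) if $\overline{\Pi}_X(0+)=\infty$ and $r\in\mathbb{N}$, then $\big(({}^{(r)}\widetilde X_{\tau t}-\tau a_t)/b_t\big)_{0\le\tau\le1}\to{}^{(r)}\widetilde{\mathcal{Y}}:=\mathfrak{T}^{(r)}_{rim}(\mathcal{Y})$.
   Context: $\mathbb{D}=\mathbb{D}([0,1],\mathbb{R})$ is the space of càdlàg functions on $[0,1]$ with the Skorokhod $J_1$-topology. Tails of the Lévy measure: $\overline{\Pi}^+_X(x)=\Pi_X((x,\infty))$, $\overline{\Pi}^-_X(x)=\Pi_X((-\infty,-x))$, $\overline{\Pi}_X=\overline{\Pi}^+_X+\overline{\Pi}^-_X$. For $x\in\mathbb{D}$, $\Delta x(\tau)=x(\tau)-x(\tau-)$ ($\tau>0$), $\Delta x(0)=0$. Operators on $\mathbb{D}$: $\mathcal{S}_{\pm\Delta}(x)(\tau)=\sup_{0\le s\le\tau}\Delta(\pm x)(s)$; $\mathcal{T}^{(0,\pm)}_{rim}(x)=x$, $\mathcal{T}^{(1,\pm)}_{rim}(x)=x\mp\mathcal{S}_{\pm\Delta}(x)$, $\mathcal{T}^{(r,\pm)}_{rim}=\mathcal{T}^{(1,\pm)}_{rim}\circ\mathcal{T}^{(r-1,\pm)}_{rim}$; $\mathcal{T}^{(r,s)}_{rim}=\mathcal{T}^{(r,+)}_{rim}\circ\mathcal{T}^{(s,-)}_{rim}$.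 Record trimming: $R_1(x)=\inf\{s\in[0,1]:\Delta x(s)=\mathcal{S}_{+\Delta}(x)(1)\}$, $\mathcal{R}_{trim}(x)=x-\Delta x(R_1(x))\mathbf{1}_{[R_1(x),1]}$, $\mathcal{R}^{(r)}_{trim}=\mathcal{R}_{trim}\circ\mathcal{R}^{(r-1)}_{trim}$, $\mathcal{R}^{(0)}_{trim}(x)=x$. Signed modulus trimming: $\widetilde L_\tau(x)=\sup\{s\in[0,\tau]:|\Delta x(s)|=\sup_{0\le u\le\tau}|\Delta x(u)|\}$, $\mathfrak{T}_{rim}(x)(\tau)=x(\tau)-\Delta x(\widetilde L_\tau(x))$, $\mathfrak{T}^{(r)}_{rim}=\mathfrak{T}_{rim}\circ\mathfrak{T}^{(r-1)}_{rim}$, $\mathfrak{T}^{(0)}_{rim}(x)=x$. Trimmed processes of $X$ (for fixed $t>0$, as processes in $\tau\in[0,1]$): the lookback trimmed path $({}^{(r)}X^R_{t\tau})_{\tau\in[0,1]}=\mathcal{R}^{(r)}_{trim}\big((X_{t\tau})_{\tau\in[0,1]}\big)$; the asymmetrically trimmed process ${}^{(r,s)}X_{t\tau}=X_{t\tau}-\sum_{i=1}^r\Delta X^{(i)}_{t\tau}+\sum_{j=1}^s\Delta X^{(j),-}_{t\tau}$, where $\Delta X^{(i)}_u$ is the $i$-th largest positive jump of $X$ on $(0,u]$ and $\Delta X^{(j),-}_u$ the $j$-th largest magnitude of a negative jump on $(0,u]$, so that $({}^{(r,s)}X_{t\tau})_{\tau}=\mathcal{T}^{(r,s)}_{rim}\big((X_{t\tau})_\tau\big)$;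 the modulus trimmed process ${}^{(r)}\widetilde X_{t\tau}=X_{t\tau}-\sum_{i=1}^r\widetilde{\Delta X}^{(i)}_{t\tau}$, where $\widetilde{\Delta X}^{(i)}_u$ is the $i$-th largest jump in modulus on $(0,u]$ carrying the sign of the latest such jump, i.e. $({}^{(r)}\widetilde X_{t\tau})_\tau=\mathfrak{T}^{(r)}_{rim}\big((X_{t\tau})_\tau\big)$. *)

theory Defs
  imports "HOL-Probability.Probability"
begin

text \<open>Elements of D are represented as functions real => real; only values on [0,1] matter.\<close>

definition cadlag01 :: "(real \<Rightarrow> real) \<Rightarrow> bool" where
  "cadlag01 x \<longleftrightarrow>
     (\<forall>\<tau>\<in>{0..<1}. (x \<longlongrightarrow> x \<tau>) (at_right \<tau>)) \<and>
     (\<forall>\<tau>\<in>{0<..1}. \<exists>l. (x \<longlongrightarrow> l) (at_left \<tau>))"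

definition time_changes :: "(real \<Rightarrow> real) set" where
  "time_changes = {l. strict_mono_on {0..1} l \<and> continuous_on {0..1} l \<and> l 0 = 0 \<and> l 1 = 1}"

definition dist_J1 :: "(real \<Rightarrow> real) \<Rightarrow> (real \<Rightarrow> real) \<Rightarrow> real" where
  "dist_J1 x y = Inf {max (SUP t\<in>{0..1}. \<bar>l t - t\<bar>) (SUP t\<in>{0..1}. \<bar>x t - y (l t)\<bar>) | l. l \<in> time_changes}"

definition bounded_J1_continuous :: "((real \<Rightarrow> real) \<Rightarrow> real) \<Rightarrow> bool" where
  "bounded_J1_continuous G \<longleftrightarrow>
     (\<exists>B. \<forall>x. cadlag01 x \<longrightarrow> \<bar>G x\<bar> \<le> B) \<and>
     (\<forall>x. cadlag01 x \<longrightarrow> (\<forall>e>0. \<exists>d>0. \<forall>y. cadlag01 y \<longrightarrow> dist_J1 x y < d \<longrightarrow> \<bar>G y - G x\<bar> < e))"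

definition conv_distr_D :: "real filter \<Rightarrow> 'a measure \<Rightarrow> (real \<Rightarrow> 'a \<Rightarrow> (real \<Rightarrow> real))
    \<Rightarrow> 'b measure \<Rightarrow> ('b \<Rightarrow> (real \<Rightarrow> real)) \<Rightarrow> bool" where
  "conv_distr_D F M Z N W \<longleftrightarrow>
     (\<forall>G. bounded_J1_continuous G \<longrightarrow>
        ((\<lambda>t. \<integral>\<omega>. G (Z t \<omega>) \<partial>M) \<longlongrightarrow> (\<integral>\<omega>. G (W \<omega>) \<partial>N)) F)"

definition conv_distr_R :: "real filter \<Rightarrow> 'a measure \<Rightarrow> (real \<Rightarrow> 'a \<Rightarrow> real)
    \<Rightarrow> 'b measure \<Rightarrow> ('b \<Rightarrow> real) \<Rightarrow> bool" where
  "conv_distr_R F M Z N W \<longleftrightarrow>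
     (\<forall>g::real \<Rightarrow> real. bounded (range g) \<longrightarrow> continuous_on UNIV g \<longrightarrow>
        ((\<lambda>t. \<integral>\<omega>. g (Z t \<omega>) \<partial>M) \<longlongrightarrow> (\<integral>\<omega>. g (W \<omega>) \<partial>N)) F)"

definition jump :: "(real \<Rightarrow> real) \<Rightarrow> real \<Rightarrow> real" where
  "jump x \<tau> = (if \<tau> \<le> 0 then 0 else x \<tau> - Lim (at_left \<tau>) x)"

definition S_plus :: "(real \<Rightarrow> real) \<Rightarrow> real \<Rightarrow> real" where
  "S_plus x \<tau> = (SUP s\<in>{0..\<tau>}. jump x s)"

definition S_minus :: "(real \<Rightarrow> real) \<Rightarrow> real \<Rightarrow> real" where
  "S_minus x \<tau> = (SUP s\<in>{0..\<tau>}. jump (\<lambda>u. - x u) s)"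

definition Trim_plus :: "(real \<Rightarrow> real) \<Rightarrow> (real \<Rightarrow> real)" where
  "Trim_plus x = (\<lambda>\<tau>. x \<tau> - S_plus x \<tau>)"

definition Trim_minus :: "(real \<Rightarrow> real) \<Rightarrow> (real \<Rightarrow> real)" where
  "Trim_minus x = (\<lambda>\<tau>. x \<tau> + S_minus x \<tau>)"

definition Trim_rs :: "nat \<Rightarrow> nat \<Rightarrow> (real \<Rightarrow> real) \<Rightarrow> (real \<Rightarrow> real)" where
  "Trim_rs r s = (Trim_plus ^^ r) \<circ> (Trim_minus ^^ s)"

definition R1 :: "(real \<Rightarrow> real) \<Rightarrow> real" where
  "R1 x = Inf {s\<in>{0..1}. jump x s = S_plus x 1}"

definition Rtrim :: "(real \<Rightarrow> real) \<Rightarrow> (real \<Rightarrow> real)" where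
  "Rtrim x = (\<lambda>\<tau>. x \<tau> - jump x (R1 x) * indicator {R1 x..1} \<tau>)"

definition Ltilde :: "(real \<Rightarrow> real) \<Rightarrow> real \<Rightarrow> real" where
  "Ltilde x \<tau> = Sup {s\<in>{0..\<tau>}. \<bar>jump x s\<bar> = (SUP u\<in>{0..\<tau>}. \<bar>jump x u\<bar>)}"

definition Mtrim :: "(real \<Rightarrow> real) \<Rightarrow> (real \<Rightarrow> real)" where
  "Mtrim x = (\<lambda>\<tau>. x \<tau> - jump x (Ltilde x \<tau>))"

definition levy_process :: "'a measure \<Rightarrow> (real \<Rightarrow> 'a \<Rightarrow> real) \<Rightarrow> bool" where
  "levy_process M X \<longleftrightarrow>
     prob_space M \<and>
     (\<forall>t\<ge>0. X t \<in> borel_measurable M) \<and>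
     (\<forall>\<omega>\<in>space M. X 0 \<omega> = 0) \<and>
     (\<forall>\<omega>\<in>space M. (\<forall>t\<ge>0. ((\<lambda>s. X s \<omega>) \<longlongrightarrow> X t \<omega>) (at_right t)) \<and>
                    (\<forall>t>0. \<exists>l. ((\<lambda>s. X s \<omega>) \<longlongrightarrow> l) (at_left t))) \<and>
     (\<forall>(n::nat) (ts::nat \<Rightarrow> real). 0 \<le> ts 0 \<and> (\<forall>i<n. ts i \<le> ts (Suc i)) \<longrightarrow>
        prob_space.indep_vars M (\<lambda>_. borel) (\<lambda>i \<omega>. X (ts (Suc i)) \<omega> - X (ts i) \<omega>) {..<n}) \<and>
     (\<forall>s\<ge>0. \<forall>t\<ge>0. distr M borel (\<lambda>\<omega>. X (t + s) \<omega> - X s \<omega>) = distr M borel (X t))"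

definition levy_triplet :: "'a measure \<Rightarrow> (real \<Rightarrow> 'a \<Rightarrow> real) \<Rightarrow> real \<Rightarrow> real \<Rightarrow> real measure \<Rightarrow> bool" where
  "levy_triplet M X \<gamma> \<sigma>2 Lm \<longleftrightarrow>
     sets Lm = sets borel \<and> emeasure Lm {0} = 0 \<and> \<sigma>2 \<ge> 0 \<and>
     integrable Lm (\<lambda>x. min 1 (x\<^sup>2)) \<and>
     (\<forall>t\<ge>0. \<forall>\<theta>. char (distr M borel (X t)) \<theta> =
        exp (complex_of_real t *
          (\<i> * complex_of_real (\<gamma> * \<theta>) - complex_of_real (\<sigma>2 * \<theta>\<^sup>2 / 2) +
           (CLINT x|Lm. iexp (\<theta> * x) - 1 - \<i> * complex_of_real (\<theta> * x * indicator {-1..1} x)))))"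

definition stable_levy_measure :: "real \<Rightarrow> real measure \<Rightarrow> bool" where
  "stable_levy_measure \<alpha> Lm \<longleftrightarrow>
     (\<exists>cp cm. cp \<ge> 0 \<and> cm \<ge> 0 \<and>
        (\<forall>x>0. emeasure Lm {x<..} = ennreal (cp * x powr (-\<alpha>)) \<and>
               emeasure Lm {..<-x} = ennreal (cm * x powr (-\<alpha>))))"

end

theory Submission
  imports Defs
begin

text \<open>
  Each trimming operator commutes with the centering and norming, since a continuous drift has no jumps.
  So the theorem is the continuous mapping theorem for the functionals \<open>G \<circ> T\<close>, which have to be Borel
  and almost surely \<open>J1\<close>-continuous at the path of \<open>Y\<close>. A time change that aligns two paths aligns their jumps up
  to twice the uniform error. Hence the operators behind (ii) are Lipschitz, while those of (i) and (iii) are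
  continuous at every path whose nonzero jumps have distinct moduli, a property they also preserve.

  That \<open>Y\<close> has this property is proved without the Levy--Ito decomposition. A pair of tied jumps
  produces, on every fine grid, two distinct increments that the Gaussian kernel
  \<open>E (cos (a \<xi> y) * cos (a \<xi> z))\<close> with \<open>\<xi>\<close> standard normal detects. By independence and stationarity of the
  increments, the expectation of the kernel sum over the grid is controlled by characteristic functions; it
  converges to the integral of the kernel against the square of the Levy measure, weighted by \<open>1 - cos (s y)\<close>.
  This vanishes as \<open>a\<close> tends to infinity, because the Levy measure charges no pair \<open>{v, -v}\<close>.
\<close>

section \<open>Cadlag paths and the Skorokhod distance\<close>

text \<open>Convergence in distribution is given only through integrals of bounded continuous
  functionals. So measurability refers to the sigma-algebra of the coordinates, where it is easily
  checked for processes, and reaches continuous functionals through grid approximations; a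
  discontinuous functional is squeezed between Lipschitz ones rather than handled by sets and their
  boundaries.

  Suprema of jumps are Lipschitz, but the time at which one is attained, or the sign of the jump
  attaining it, is not: such a choice can flip where moduli tie. To exclude ties, the kernel has to
  be a mean of products: its double integral is then a mean of squared cosine transforms, which the
  characteristic function at time \<open>1 / n\<close> determines. The weight
  \<open>1 - cos (s * y)\<close> makes the Levy measure finite and stays within cosines, whereas a
  cut-off of small jumps would not; as it vanishes at some nonzero jumps, several \<open>s\<close>
  are used. The grid limit comes before the limit in \<open>a\<close>, and the lower bound forced by
  a tied pair does not depend on \<open>a\<close>.\<close>

lemma cadlag01_tendsto_right:
  "cadlag01 x \<Longrightarrow> 0 \<le> \<tau> \<Longrightarrow> \<tau> < 1 \<Longrightarrow> (x \<longlongrightarrow> x \<tau>) (at_right \<tau>)"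
  by (auto simp: cadlag01_def)

text \<open>\<open>Lim\<close> is a definite description and says nothing until a left limit is
  known to exist. Jumps at positive times are therefore always computed through this rule.\<close>

lemma jump_eqI: "0 < \<tau> \<Longrightarrow> (x \<longlongrightarrow> l) (at_left \<tau>) \<Longrightarrow> jump x \<tau> = x \<tau> - l"
  using tendsto_Lim[of "at_left \<tau>" x l] by (simp add: jump_def)

lemma cadlag01_tendsto_left:
  assumes "cadlag01 x" "0 < \<tau>" "\<tau> \<le> 1"
  shows "(x \<longlongrightarrow> x \<tau> - jump x \<tau>) (at_left \<tau>)"
proof -
  obtain l where l: "(x \<longlongrightarrow> l) (at_left \<tau>)"
    using assms unfolding cadlag01_def by (metis greaterThanAtMost_iff)
  with jump_eqI[OF assms(2) l] show ?thesis by simp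
qed

lemma jump_zero [simp]: "jump x 0 = 0"
  by (simp add: jump_def)

text \<open>Compactness of \<open>[0,1]\<close>, by bisection: near each point the one-sided limits
  make the path almost constant on either side. The pairs allowed are those with
  \<open>(u,v]\<close> free of partition points, because a cadlag path joins its value at
  \<open>u\<close> to what follows but may jump on arrival at \<open>v\<close>.\<close>

lemma cadlag01_partition:
  assumes x: "cadlag01 x" and e: "0 < e"
  obtains P where "finite P" "P \<subseteq> {0..1}" "0 \<in> P" "1 \<in> P"
    "\<And>u v. 0 \<le> u \<Longrightarrow> u \<le> v \<Longrightarrow> v \<le> 1 \<Longrightarrow> P \<inter> {u<..v} = {} \<Longrightarrow> \<bar>x u - x v\<bar> < e"
proof -
  \<comment> \<open>\<open>Bolzano\<close> also asks about small intervals that leave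
    \<open>[0,1]\<close>, hence the separate bounds \<open>0 \<le> u\<close> and
    \<open>v \<le> 1\<close>.\<close>
  define K where "K a b \<longleftrightarrow> (\<exists>Q. finite Q \<and> (\<forall>u v. a \<le> u \<and> 0 \<le> u \<and> u \<le> v \<and> v \<le> b \<and> v \<le> 1 \<and>
    Q \<inter> {u<..v} = {} \<longrightarrow> \<bar>x u - x v\<bar> < e))" for a b :: real
  have "K 0 1"
  proof (rule Bolzano[OF zero_le_one, where P = K])
    fix a b c assume trans: "K a b" "K b c" "a \<le> b" "b \<le> c"
    obtain Q1 where Q1: "finite Q1" "\<And>u v. a \<le> u \<Longrightarrow> 0 \<le> u \<Longrightarrow> u \<le> v \<Longrightarrow> v \<le> b \<Longrightarrow> v \<le> 1 \<Longrightarrow>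
      Q1 \<inter> {u<..v} = {} \<Longrightarrow> \<bar>x u - x v\<bar> < e"
      using trans(1) unfolding K_def by blast
    obtain Q2 where Q2: "finite Q2" "\<And>u v. b \<le> u \<Longrightarrow> 0 \<le> u \<Longrightarrow> u \<le> v \<Longrightarrow> v \<le> c \<Longrightarrow> v \<le> 1 \<Longrightarrow>
      Q2 \<inter> {u<..v} = {} \<Longrightarrow> \<bar>x u - x v\<bar> < e"
      using trans(2) unfolding K_def by blast
    \<comment> \<open>Inserting \<open>b\<close> excludes \<open>u < b < v\<close>, so each
      admissible pair lies on one side of \<open>b\<close>.\<close>
    have "\<bar>x u - x v\<bar> < e" if *: "a \<le> u" "0 \<le> u" "u \<le> v" "v \<le> c" "v \<le> 1"
      "(insert b (Q1 \<union> Q2)) \<inter> {u<..v} = {}" for u v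
    proof (cases "v \<le> b")
      case True
      then show ?thesis using Q1(2)[of u v] * by blast
    next
      case False
      have "\<not> u < b"
        using * False by auto
      then show ?thesis using Q2(2)[of u v] * by (simp add: Int_Un_distrib2)
    qed
    moreover have "finite (insert b (Q1 \<union> Q2))"
      using Q1 Q2 by simp
    ultimately show "K a c"
      unfolding K_def by blast
  next
    fix z :: real assume local: "0 \<le> z" "z \<le> 1"
    have 1: "\<exists>d>0. \<forall>u v. 0 \<le> u \<and> z - d < u \<and> u \<le> v \<and> v < z \<longrightarrow> \<bar>x u - x v\<bar> < e"
    proof (cases "z > 0")
      case True
      have "eventually (\<lambda>u. dist (x u) (x z - jump x z) < e / 2) (at_left z)"
        using cadlag01_tendsto_left[OF x True] local e by (intro tendstoD) auto
      then obtain c where c: "c < z" "\<And>u. c < u \<Longrightarrow> u < z \<Longrightarrow> dist (x u) (x z - jump x z) < e / 2"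
        unfolding eventually_at_left_field by blast
      show ?thesis
      proof (intro exI[of _ "z - c"] conjI allI impI)
        fix u v assume "0 \<le> u \<and> z - (z - c) < u \<and> u \<le> v \<and> v < z"
        with c(2)[of u] c(2)[of v] show "\<bar>x u - x v\<bar> < e"
          by (simp add: dist_real_def abs_if split: if_splits)
      qed (use c in auto)
    qed (auto intro!: exI[of _ 1])
    have 2: "\<exists>d>0. \<forall>u v. z \<le> u \<and> u \<le> v \<and> v < z + d \<and> v \<le> 1 \<longrightarrow> \<bar>x u - x v\<bar> < e"
    proof (cases "z < 1")
      case True
      have "eventually (\<lambda>u. dist (x u) (x z) < e / 2) (at_right z)"
        using cadlag01_tendsto_right[OF x _ True] local e by (intro tendstoD) auto
      then obtain c where c: "c > z" "\<And>u. z < u \<Longrightarrow> u < c \<Longrightarrow> dist (x u) (x z) < e / 2"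
        unfolding eventually_at_right_field by blast
      have c': "dist (x u) (x z) < e / 2" if "z \<le> u" "u < c" for u
        using c(2)[of u] that e by (cases "u = z") auto
      show ?thesis
      proof (intro exI[of _ "c - z"] conjI allI impI)
        fix u v assume "z \<le> u \<and> u \<le> v \<and> v < z + (c - z) \<and> v \<le> 1"
        with c'[of u] c'[of v] show "\<bar>x u - x v\<bar> < e"
          by (simp add: dist_real_def abs_if split: if_splits)
      qed (use c in auto)
    next
      case False
      then have "u = v" if "z \<le> u" "u \<le> v" "v \<le> 1" for u v using that by linarith
      then show ?thesis using e by (intro exI[of _ 1]) fastforce
    qed
    obtain d1 where d1: "d1 > 0" "\<And>u v. 0 \<le> u \<Longrightarrow> z - d1 < u \<Longrightarrow> u \<le> v \<Longrightarrow> v < z \<Longrightarrow> \<bar>x u - x v\<bar> < e"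
      using 1 by blast
    obtain d2 where d2: "d2 > 0" "\<And>u v. z \<le> u \<Longrightarrow> u \<le> v \<Longrightarrow> v < z + d2 \<Longrightarrow> v \<le> 1 \<Longrightarrow> \<bar>x u - x v\<bar> < e"
      using 2 by blast
    show "\<exists>d>0. \<forall>a b. a \<le> z \<and> z \<le> b \<and> b - a < d \<longrightarrow> K a b"
    proof (intro exI[of _ "min d1 d2"] conjI allI impI)
      fix a b assume ab: "a \<le> z \<and> z \<le> b \<and> b - a < min d1 d2"
      have "\<bar>x u - x v\<bar> < e" if *: "a \<le> u" "0 \<le> u" "u \<le> v" "v \<le> b" "v \<le> 1" "{z} \<inter> {u<..v} = {}" for u v
      proof (cases "v < z")
        case True
        then show ?thesis using d1(2)[of u v] ab * by auto
      next
        case False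
        then have "z \<le> u" using * by auto
        then show ?thesis using d2(2)[of u v] ab * by auto
      qed
      then show "K a b" unfolding K_def by (intro exI[of _ "{z}"]) auto
    qed (use d1 d2 in auto)
  qed
  then obtain Q where Q: "finite Q" "\<And>u v. 0 \<le> u \<Longrightarrow> u \<le> v \<Longrightarrow> v \<le> 1 \<Longrightarrow>
      Q \<inter> {u<..v} = {} \<Longrightarrow> \<bar>x u - x v\<bar> < e"
    unfolding K_def by blast
  show ?thesis
  proof (rule that[of "insert 0 (insert 1 (Q \<inter> {0..1}))"])
    fix u v :: real assume *: "0 \<le> u" "u \<le> v" "v \<le> 1" "insert 0 (insert 1 (Q \<inter> {0..1})) \<inter> {u<..v} = {}"
    have "Q \<inter> {u<..v} = {}"
      using * by fastforce
    then show "\<bar>x u - x v\<bar> < e" using Q(2) * by blast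
  qed (use Q in auto)
qed

lemma cadlag01_bounded:
  assumes x: "cadlag01 x"
  obtains B where "0 \<le> B" "\<And>t. 0 \<le> t \<Longrightarrow> t \<le> 1 \<Longrightarrow> \<bar>x t\<bar> \<le> B"
proof -
  obtain P where P: "finite P" "P \<subseteq> {0..1}" "0 \<in> P" "1 \<in> P"
    "\<And>u v. 0 \<le> u \<Longrightarrow> u \<le> v \<Longrightarrow> v \<le> 1 \<Longrightarrow> P \<inter> {u<..v} = {} \<Longrightarrow> \<bar>x u - x v\<bar> < 1"
    using cadlag01_partition[OF x zero_less_one] by metis
  define B where "B = Max ((\<lambda>p. \<bar>x p\<bar>) ` P) + 1"
  have B: "\<bar>x p\<bar> \<le> B - 1" if "p \<in> P" for p
    using that P(1) by (auto simp: B_def intro!: Max_ge)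
  have *: "\<bar>x t\<bar> \<le> B" if t: "0 \<le> t" "t \<le> 1" for t
  proof -
    define p where "p = Max (P \<inter> {..t})"
    have ne: "P \<inter> {..t} \<noteq> {}" "finite (P \<inter> {..t})" using P t by auto
    have p: "p \<in> P" "p \<le> t" using Max_in[OF ne(2,1)] by (auto simp: p_def)
    have "P \<inter> {p<..t} = {}"
      using Max_ge[OF ne(2)] by (force simp: p_def)
    then have "\<bar>x p - x t\<bar> < 1" using P(2) p t by (intro P(5)) auto
    with B[OF p(1)] show ?thesis by linarith
  qed
  moreover have "0 \<le> B" using *[of 0] by simp
  ultimately show ?thesis using that by blast
qed

text \<open>A jump larger than \<open>e\<close> can only sit at a point of an
  \<open>e\<close>-partition: elsewhere \<open>(u,s]\<close> misses the partition for all
  \<open>u\<close> close to \<open>s\<close>, and the estimate passes to the left limit.\<close>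

lemma finite_big_jumps:
  assumes x: "cadlag01 x" and e: "0 < e"
  shows "finite {s\<in>{0..1}. e < \<bar>jump x s\<bar>}"
proof -
  obtain P where P: "finite P" "P \<subseteq> {0..1}" "0 \<in> P" "1 \<in> P"
    "\<And>u v. 0 \<le> u \<Longrightarrow> u \<le> v \<Longrightarrow> v \<le> 1 \<Longrightarrow> P \<inter> {u<..v} = {} \<Longrightarrow> \<bar>x u - x v\<bar> < e"
    using cadlag01_partition[OF x e] by metis
  have "\<bar>jump x s\<bar> \<le> e" if s: "0 \<le> s" "s \<le> 1" "s \<notin> P" for s
  proof -
    have s0: "0 < s" using s P(3) by (cases "s = 0") auto
    have "eventually (\<lambda>u. Max (P \<inter> {..<s}) < u \<and> u < s) (at_left s)"
    proof -
      have "Max (P \<inter> {..<s}) \<in> P \<inter> {..<s}" using P(1,3) s0 by (intro Max_in) auto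
      then show ?thesis by (auto simp: eventually_at_left_field)
    qed
    then have ev: "eventually (\<lambda>u. \<bar>x u - x s\<bar> \<le> e) (at_left s)"
    proof eventually_elim
      case (elim u)
      have M: "p \<le> Max (P \<inter> {..<s})" if "p \<in> P" "p < s" for p
        using that P(1) by (intro Max_ge) auto
      have "P \<inter> {u<..s} = {}"
        using M elim s(3) by (force simp: less_le)
      moreover have "0 \<le> u" using M[OF P(3) s0] elim by linarith
      ultimately show ?case using P(5)[of u s] elim s by auto
    qed
    have "((\<lambda>u. \<bar>x u - x s\<bar>) \<longlongrightarrow> \<bar>(x s - jump x s) - x s\<bar>) (at_left s)"
      using cadlag01_tendsto_left[OF x s0 s(2)] by (intro tendsto_intros)
    then have "\<bar>(x s - jump x s) - x s\<bar> \<le> e"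
      using ev by (rule tendsto_upperbound) auto
    then show ?thesis by simp
  qed
  then have "{s\<in>{0..1}. e < \<bar>jump x s\<bar>} \<subseteq> P" by force
  then show ?thesis using P(1) finite_subset by blast
qed

text \<open>Paths are total functions of which only the values on \<open>[0,1]\<close> count. The
  one-sided limits that occur in \<open>cadlag01\<close> and \<open>jump\<close> do not see the
  rest.\<close>

lemma cadlag01_cong:
  assumes x: "cadlag01 x" and eq: "\<And>t. 0 \<le> t \<Longrightarrow> t \<le> 1 \<Longrightarrow> y t = x t"
  shows "cadlag01 y" "\<And>s. 0 \<le> s \<Longrightarrow> s \<le> 1 \<Longrightarrow> jump y s = jump x s"
proof -
  have L: "(y \<longlongrightarrow> x s - jump x s) (at_left s)" if "0 < s" "s \<le> 1" for s
  proof (rule Lim_transform_eventually[OF cadlag01_tendsto_left[OF x that]])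
    show "eventually (\<lambda>u. x u = y u) (at_left s)"
      using that by (auto simp: eventually_at_left_field eq intro!: exI[of _ 0])
  qed
  have R: "(y \<longlongrightarrow> y s) (at_right s)" if "0 \<le> s" "s < 1" for s
  proof (rule Lim_transform_eventually)
    show "(x \<longlongrightarrow> y s) (at_right s)" using cadlag01_tendsto_right[OF x that] eq that by simp
    show "eventually (\<lambda>u. x u = y u) (at_right s)"
      using that by (auto simp: eventually_at_right_field eq intro!: exI[of _ 1])
  qed
  show "cadlag01 y" using L R unfolding cadlag01_def by fastforce
  show "jump y s = jump x s" if "0 \<le> s" "s \<le> 1" for s
    using jump_eqI[OF _ L, of s] that eq by (cases "s = 0") auto
qed

lemma cadlag01_affine:
  assumes x: "cadlag01 x"
  shows "cadlag01 (\<lambda>t. (x t - t * a) / b)"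
    and "0 \<le> s \<Longrightarrow> s \<le> 1 \<Longrightarrow> jump (\<lambda>t. (x t - t * a) / b) s = jump x s / b"
proof -
  have L: "((\<lambda>t. (x t - t * a) / b) \<longlongrightarrow> (x s - s * a) / b - jump x s / b) (at_left s)" if "0 < s" "s \<le> 1" for s
  proof -
    have "((\<lambda>t. (x t - t * a) / b) \<longlongrightarrow> ((x s - jump x s) - s * a) / b) (at_left s)"
      unfolding divide_inverse
      using cadlag01_tendsto_left[OF x that] by (intro tendsto_intros)
    then show ?thesis by (simp add: algebra_simps diff_divide_distrib add_divide_distrib)
  qed
  have R: "((\<lambda>t. (x t - t * a) / b) \<longlongrightarrow> (x s - s * a) / b) (at_right s)" if "0 \<le> s" "s < 1" for s
    unfolding divide_inverse
    using cadlag01_tendsto_right[OF x that] by (intro tendsto_intros)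
  show "cadlag01 (\<lambda>t. (x t - t * a) / b)" using L R unfolding cadlag01_def by fastforce
  show "jump (\<lambda>t. (x t - t * a) / b) s = jump x s / b" if "0 \<le> s" "s \<le> 1"
    using jump_eqI[OF _ L, of s] that by (cases "s = 0") auto
qed

lemma cadlag01_minus:
  assumes x: "cadlag01 x"
  shows "cadlag01 (\<lambda>t. - x t)" and "0 \<le> s \<Longrightarrow> s \<le> 1 \<Longrightarrow> jump (\<lambda>t. - x t) s = - jump x s"
  using cadlag01_affine(1)[OF x, of 0 "-1"] cadlag01_affine(2)[OF x, of s 0 "-1"] by simp_all

text \<open>The bound \<open>dist_J1 x y \<le> e\<close> with an explicit time change as witness.
  Operators are estimated along one and the same time change, which the infimum in
  \<open>dist_J1\<close> would hide; composing and inverting witnesses gives the triangle inequality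
  and symmetry.\<close>

definition J1_near :: "real \<Rightarrow> (real \<Rightarrow> real) \<Rightarrow> (real \<Rightarrow> real) \<Rightarrow> bool" where
  "J1_near e x y \<longleftrightarrow> (\<exists>l\<in>time_changes. \<forall>t\<in>{0..1}. \<bar>l t - t\<bar> \<le> e \<and> \<bar>x t - y (l t)\<bar> \<le> e)"

section \<open>Time changes and the Skorokhod distance\<close>

lemma time_changes_range:
  assumes "l \<in> time_changes" "0 \<le> t" "t \<le> 1"
  shows "0 \<le> l t" "l t \<le> 1"
proof -
  have m: "mono_on {0..1} l" using assms strict_mono_on_imp_mono_on by (auto simp: time_changes_def)
  show "0 \<le> l t" "l t \<le> 1"
    using assms mono_onD[OF m, of 0 t] mono_onD[OF m, of t 1] by (auto simp: time_changes_def)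
qed

lemma time_changes_less_iff:
  assumes "l \<in> time_changes" "0 \<le> s" "s \<le> 1" "0 \<le> t" "t \<le> 1"
  shows "l s < l t \<longleftrightarrow> s < t" and "l s \<le> l t \<longleftrightarrow> s \<le> t"
  using assms strict_mono_on_less[of "{0..1}" l s t] strict_mono_on_less_eq[of "{0..1}" l s t]
  by (auto simp: time_changes_def)

lemma time_changes_surj:
  assumes "l \<in> time_changes" "0 \<le> s" "s \<le> 1"
  obtains t where "0 \<le> t" "t \<le> 1" "l t = s"
  using assms IVT'[of l 0 s 1] by (auto simp: time_changes_def)

lemma time_changes_surj_upto:
  assumes "l \<in> time_changes" "0 \<le> \<tau>" "\<tau> \<le> 1" "0 \<le> s" "s \<le> l \<tau>"
  obtains t where "0 \<le> t" "t \<le> \<tau>" "l t = s"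
proof -
  have "s \<le> 1" using time_changes_range[of l \<tau>] assms by linarith
  then obtain t where t: "0 \<le> t" "t \<le> 1" "l t = s" using time_changes_surj[OF assms(1,4)] by blast
  then have "t \<le> \<tau>" using time_changes_less_iff(2)[OF assms(1), of t \<tau>] assms by auto
  with t show ?thesis using that by blast
qed

lemma id_time_changes: "(\<lambda>t. t) \<in> time_changes"
  by (auto simp: time_changes_def strict_mono_on_def)

lemma comp_time_changes:
  assumes "l \<in> time_changes" "m \<in> time_changes"
  shows "(\<lambda>t. m (l t)) \<in> time_changes"
proof -
  have "continuous_on {0..1} (\<lambda>t. m (l t))"
    using assms time_changes_range[OF assms(1)]
    by (intro continuous_on_compose2[of "{0..1}" m "{0..1}" l]) (auto simp: time_changes_def)
  then show ?thesis
    using assms time_changes_range[OF assms(1)]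
    by (auto simp: time_changes_def strict_mono_on_def)
qed

lemma inv_time_changes:
  assumes l: "l \<in> time_changes"
  obtains m where "m \<in> time_changes" "\<And>t. 0 \<le> t \<Longrightarrow> t \<le> 1 \<Longrightarrow> l (m t) = t"
proof -
  define m where "m = the_inv_into {0..1} l"
  have inj: "inj_on l {0..1}" using l by (auto simp: time_changes_def intro: strict_mono_on_imp_inj_on)
  have im: "l ` {0..1} = {0..1}"
  proof (intro equalityI subsetI)
    fix s :: real assume "s \<in> {0..1}"
    then obtain t where "0 \<le> t" "t \<le> 1" "l t = s" using time_changes_surj[OF l, of s] by auto
    then show "s \<in> l ` {0..1}" by auto
  qed (use time_changes_range[OF l] in auto)
  have m1: "l (m t) = t" "0 \<le> m t" "m t \<le> 1" if "0 \<le> t" "t \<le> 1" for t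
    using f_the_inv_into_f[OF inj, of t] the_inv_into_into[OF inj, of t "{0..1}"] that im
    by (auto simp: m_def)
  have "continuous_on {0..1} m"
    using continuous_on_inv[of "{0..1}" l m] inj l im
    by (auto simp: m_def the_inv_into_f_f time_changes_def)
  moreover have "strict_mono_on {0..1} m"
  proof (rule strict_mono_onI)
    fix r s :: real assume "r \<in> {0..1}" "s \<in> {0..1}" "r < s"
    then show "m r < m s"
      using time_changes_less_iff(1)[OF l, of "m r" "m s"] m1[of r] m1[of s] by auto
  qed
  moreover have "m 0 = 0" "m 1 = 1"
    using l the_inv_into_f_f[OF inj, of 0] the_inv_into_f_f[OF inj, of 1] by (auto simp: m_def time_changes_def)
  ultimately show ?thesis using m1 by (intro that[of m]) (auto simp: time_changes_def)
qed

lemma J1_near_refl: "0 \<le> e \<Longrightarrow> J1_near e x x"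
  unfolding J1_near_def by (intro bexI[OF _ id_time_changes]) auto

lemma J1_near_uniform:
  "0 \<le> e \<Longrightarrow> (\<And>t. 0 \<le> t \<Longrightarrow> t \<le> 1 \<Longrightarrow> \<bar>x t - y t\<bar> \<le> e) \<Longrightarrow> J1_near e x y"
  unfolding J1_near_def by (intro bexI[OF _ id_time_changes]) auto

lemma J1_near_sym:
  assumes "J1_near e x y" shows "J1_near e y x"
proof -
  obtain l where l: "l \<in> time_changes" "\<And>t. 0 \<le> t \<Longrightarrow> t \<le> 1 \<Longrightarrow> \<bar>l t - t\<bar> \<le> e \<and> \<bar>x t - y (l t)\<bar> \<le> e"
    using assms by (auto simp: J1_near_def)
  obtain m where m: "m \<in> time_changes" "\<And>t. 0 \<le> t \<Longrightarrow> t \<le> 1 \<Longrightarrow> l (m t) = t"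
    using inv_time_changes[OF l(1)] by blast
  have "\<bar>m t - t\<bar> \<le> e \<and> \<bar>y t - x (m t)\<bar> \<le> e" if "0 \<le> t" "t \<le> 1" for t
    using l(2)[of "m t"] m(2)[OF that] time_changes_range[OF m(1) that] by (auto simp: abs_minus_commute)
  with m(1) show ?thesis unfolding J1_near_def by (intro bexI[of _ m]) auto
qed

lemma J1_near_trans:
  assumes "J1_near d x y" "J1_near e y z" shows "J1_near (d + e) x z"
proof -
  obtain l where l: "l \<in> time_changes" "\<And>t. 0 \<le> t \<Longrightarrow> t \<le> 1 \<Longrightarrow> \<bar>l t - t\<bar> \<le> d \<and> \<bar>x t - y (l t)\<bar> \<le> d"
    using assms(1) by (auto simp: J1_near_def)
  obtain m where m: "m \<in> time_changes" "\<And>t. 0 \<le> t \<Longrightarrow> t \<le> 1 \<Longrightarrow> \<bar>m t - t\<bar> \<le> e \<and> \<bar>y t - z (m t)\<bar> \<le> e"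
    using assms(2) by (auto simp: J1_near_def)
  have "\<bar>m (l t) - t\<bar> \<le> d + e \<and> \<bar>x t - z (m (l t))\<bar> \<le> d + e" if "0 \<le> t" "t \<le> 1" for t
    using l(2)[OF that] m(2)[of "l t"] time_changes_range[OF l(1) that] by auto
  with comp_time_changes[OF l(1) m(1)] show ?thesis
    unfolding J1_near_def by (intro bexI[of _ "\<lambda>t. m (l t)"]) auto
qed

lemma bdd_above_time_change: "l \<in> time_changes \<Longrightarrow> bdd_above ((\<lambda>t. \<bar>l t - t\<bar>) ` {0..1})"
proof (rule bdd_aboveI2)
  fix t :: real assume "l \<in> time_changes" "t \<in> {0..1}"
  then show "\<bar>l t - t\<bar> \<le> 1" using time_changes_range[of l t] by auto
qed

lemma dist_J1_set_nonneg:
  assumes "v \<in> {max (SUP t\<in>{0..1}. \<bar>l t - t\<bar>) (SUP t\<in>{0..1}. \<bar>x t - y (l t)\<bar>) | l. l \<in> time_changes}"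
  shows "0 \<le> v"
proof -
  obtain l where l: "l \<in> time_changes"
    "v = max (SUP t\<in>{0..1}. \<bar>l t - t\<bar>) (SUP t\<in>{0..1}. \<bar>x t - y (l t)\<bar>)" using assms by auto
  have "\<bar>l 0 - 0\<bar> \<le> (SUP t\<in>{0..1}. \<bar>l t - t\<bar>)"
    using bdd_above_time_change[OF l(1)] by (intro cSUP_upper) auto
  then show ?thesis using l(2) by linarith
qed

lemma dist_J1_set_bdd_below:
  "bdd_below {max (SUP t\<in>{0..1}. \<bar>l t - t\<bar>) (SUP t\<in>{0..1}. \<bar>x t - y (l t)\<bar>) | l. l \<in> time_changes}"
  by (rule bdd_belowI) (rule dist_J1_set_nonneg)

lemma dist_J1_le_of_J1_near:
  assumes "J1_near e x y" shows "dist_J1 x y \<le> e"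
proof -
  obtain l where l: "l \<in> time_changes" "\<And>t. 0 \<le> t \<Longrightarrow> t \<le> 1 \<Longrightarrow> \<bar>l t - t\<bar> \<le> e \<and> \<bar>x t - y (l t)\<bar> \<le> e"
    using assms by (auto simp: J1_near_def)
  have "dist_J1 x y \<le> max (SUP t\<in>{0..1}. \<bar>l t - t\<bar>) (SUP t\<in>{0..1}. \<bar>x t - y (l t)\<bar>)"
    unfolding dist_J1_def using l(1) by (intro cInf_lower dist_J1_set_bdd_below) auto
  also have "\<dots> \<le> e"
    using l(2) by (intro max.boundedI cSUP_least) auto
  finally show ?thesis .
qed

text \<open>Cadlag paths are bounded, so the inner \<open>SUP\<close> really dominates each term; a
  real \<open>SUP\<close> over an unbounded set would bound nothing.\<close>

lemma J1_near_of_dist_J1_less: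
  assumes x: "cadlag01 x" and y: "cadlag01 y" and d: "dist_J1 x y < e"
  shows "J1_near e x y"
proof -
  let ?S = "{max (SUP t\<in>{0..1}. \<bar>l t - t\<bar>) (SUP t\<in>{0..1}. \<bar>x t - y (l t)\<bar>) | l. l \<in> time_changes}"
  have "?S \<noteq> {}" using id_time_changes by auto
  then have "\<exists>v\<in>?S. v < e"
    using d unfolding dist_J1_def by (subst (asm) cInf_less_iff[OF _ dist_J1_set_bdd_below]) auto
  then obtain l where l: "l \<in> time_changes"
    "max (SUP t\<in>{0..1}. \<bar>l t - t\<bar>) (SUP t\<in>{0..1}. \<bar>x t - y (l t)\<bar>) < e"
    by blast
  obtain Bx where Bx: "\<And>t. 0 \<le> t \<Longrightarrow> t \<le> 1 \<Longrightarrow> \<bar>x t\<bar> \<le> Bx" using cadlag01_bounded[OF x] by blast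
  obtain By where By: "\<And>t. 0 \<le> t \<Longrightarrow> t \<le> 1 \<Longrightarrow> \<bar>y t\<bar> \<le> By" using cadlag01_bounded[OF y] by blast
  have 1: "\<bar>l t - t\<bar> \<le> (SUP t\<in>{0..1}. \<bar>l t - t\<bar>)" if "t \<in> {0..1}" for t
    using that bdd_above_time_change[OF l(1)] by (intro cSUP_upper) auto
  have "bdd_above ((\<lambda>t. \<bar>x t - y (l t)\<bar>) ` {0..1})"
  proof (rule bdd_aboveI2)
    fix t :: real assume "t \<in> {0..1}"
    then show "\<bar>x t - y (l t)\<bar> \<le> Bx + By"
      using time_changes_range[OF l(1), of t] Bx[of t] By[of "l t"] by auto
  qed
  then have 2: "\<bar>x t - y (l t)\<bar> \<le> (SUP t\<in>{0..1}. \<bar>x t - y (l t)\<bar>)" if "t \<in> {0..1}" for t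
    using that by (intro cSUP_upper) auto
  show ?thesis unfolding J1_near_def
  proof (intro bexI[of _ l] ballI conjI)
    fix t :: real assume "t \<in> {0..1}"
    then show "\<bar>l t - t\<bar> \<le> e" "\<bar>x t - y (l t)\<bar> \<le> e"
      using 1[of t] 2[of t] l(2) by linarith+
  qed (rule l(1))
qed

lemma dist_J1_triangle:
  assumes "cadlag01 x" "cadlag01 y" "cadlag01 z"
  shows "dist_J1 x z \<le> dist_J1 x y + dist_J1 y z"
proof (rule field_le_epsilon)
  fix e :: real assume "0 < e"
  then have "J1_near (dist_J1 x y + e / 2) x y" "J1_near (dist_J1 y z + e / 2) y z"
    using assms by (auto intro!: J1_near_of_dist_J1_less)
  from dist_J1_le_of_J1_near[OF J1_near_trans[OF this]]
  show "dist_J1 x z \<le> dist_J1 x y + dist_J1 y z + e" by simp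
qed

lemma dist_J1_nonneg: "0 \<le> dist_J1 x y"
  unfolding dist_J1_def using id_time_changes by (intro cInf_greatest dist_J1_set_nonneg) auto

lemma dist_J1_sym:
  assumes "cadlag01 x" "cadlag01 y"
  shows "dist_J1 x y = dist_J1 y x"
proof -
  have *: "dist_J1 x y \<le> dist_J1 y x" if "cadlag01 x" "cadlag01 y" for x y
  proof (rule field_le_epsilon)
    fix e :: real assume "0 < e"
    then have "J1_near (dist_J1 y x + e) y x"
      using that by (auto intro!: J1_near_of_dist_J1_less)
    from dist_J1_le_of_J1_near[OF J1_near_sym[OF this]] show "dist_J1 x y \<le> dist_J1 y x + e" .
  qed
  from *[OF assms] *[OF assms(2,1)] show ?thesis by simp
qed

lemma dist_J1_refl [simp]: "dist_J1 x x = 0"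
  using dist_J1_le_of_J1_near[OF J1_near_refl[of 0 x]] dist_J1_nonneg[of x x] by simp

text \<open>The left limits are matched as well as the values: \<open>l\<close> is continuous and
  strictly increasing, so it turns an approach to \<open>s\<close> from the left into one to
  \<open>l s\<close> that never reaches it. A jump is a value minus a left limit, and each
  contributes \<open>e\<close>.\<close>

lemma J1_near_jump:
  assumes x: "cadlag01 x" and y: "cadlag01 y" and l: "l \<in> time_changes"
    and e: "\<And>t. 0 \<le> t \<Longrightarrow> t \<le> 1 \<Longrightarrow> \<bar>x t - y (l t)\<bar> \<le> e" and s: "0 \<le> s" "s \<le> 1"
  shows "\<bar>jump x s - jump y (l s)\<bar> \<le> 2 * e"
proof (cases "s = 0")
  case True
  then show ?thesis using l e[of 0] by (auto simp: time_changes_def)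
next
  case False
  then have s0: "0 < s" using s by simp
  have ls: "0 < l s" "l s \<le> 1"
    using time_changes_less_iff(1)[OF l, of 0 s] time_changes_range[OF l s] s s0 l by (auto simp: time_changes_def)
  have ev: "eventually (\<lambda>u. 0 < u \<and> u < s) (at_left s)"
    using s0 by (auto simp: eventually_at_left_field intro!: exI[of _ 0])
  have "continuous_on {0..1} l" using l by (simp add: time_changes_def)
  then have "(l \<longlongrightarrow> l s) (at s within {0..1})" using s by (auto simp: continuous_on_def)
  moreover have "at s within {0..1} \<ge> at_left s"
  proof -
    have "at s within {0..s} = at_left s" using s0 by (rule at_within_Icc_at_left)
    moreover have "at s within {0..s} \<le> at s within {0..1}" using s by (intro at_le) auto
    ultimately show ?thesis by simp
  qed
  ultimately have "(l \<longlongrightarrow> l s) (at_left s)" by (rule tendsto_mono[rotated])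
  moreover have "eventually (\<lambda>u. l u \<in> {..<l s} \<and> l u \<noteq> l s) (at_left s)"
    using ev
  proof eventually_elim
    case (elim u)
    then have "l u < l s" using time_changes_less_iff(1)[OF l, of u s] s by auto
    then show ?case by auto
  qed
  ultimately have "filterlim l (at_left (l s)) (at_left s)"
    by (auto simp: filterlim_at)
  then have "((\<lambda>u. y (l u)) \<longlongrightarrow> y (l s) - jump y (l s)) (at_left s)"
    using cadlag01_tendsto_left[OF y ls] filterlim_compose by blast
  then have "((\<lambda>u. \<bar>x u - y (l u)\<bar>) \<longlongrightarrow> \<bar>(x s - jump x s) - (y (l s) - jump y (l s))\<bar>) (at_left s)"
    using cadlag01_tendsto_left[OF x s0 s(2)] by (intro tendsto_intros)
  moreover have "eventually (\<lambda>u. \<bar>x u - y (l u)\<bar> \<le> e) (at_left s)"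
    using ev by eventually_elim (use e s in auto)
  ultimately have "\<bar>(x s - jump x s) - (y (l s) - jump y (l s))\<bar> \<le> e"
    by (rule tendsto_upperbound) auto
  with e[OF s] show ?thesis by linarith
qed

section \<open>Trimming of cadlag paths\<close>

text \<open>What the arguments on running suprema use of a jump function. It holds alike for the
  jumps of \<open>x\<close>, for those of its negative, and for their moduli.\<close>

definition jump_like :: "(real \<Rightarrow> real) \<Rightarrow> bool" where
  "jump_like j \<longleftrightarrow> j 0 = 0 \<and> (\<forall>e>0. finite {s\<in>{0..1}. e < \<bar>j s\<bar>})"

definition runsup :: "(real \<Rightarrow> real) \<Rightarrow> real \<Rightarrow> real" where
  "runsup j \<tau> = (SUP s\<in>{0..\<tau>}. j s)"

lemma jump_like_jump: "cadlag01 x \<Longrightarrow> jump_like (jump x)"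
  unfolding jump_like_def using finite_big_jumps by (metis jump_zero)

lemma jump_like_abs: "jump_like j \<Longrightarrow> jump_like (\<lambda>s. \<bar>j s\<bar>)"
  by (simp add: jump_like_def)

text \<open>Only finitely many values exceed a positive level, so a positive supremum is a maximum
  even over a set \<open>A\<close> that is not closed, such as \<open>[0,s)\<close> or
  \<open>[0,1]\<close> without one point.\<close>

lemma jump_like_argmax:
  assumes j: "jump_like j" and A: "A \<subseteq> {0..1}"
  shows "(\<forall>u\<in>A. j u \<le> 0) \<or>
    (\<exists>v>0. finite {u\<in>A. j u = v} \<and> {u\<in>A. j u = v} \<noteq> {} \<and> (\<forall>u\<in>A. j u \<le> v))"
proof (cases "\<forall>u\<in>A. j u \<le> 0")
  case False
  then obtain a where a: "a \<in> A" "0 < j a" by force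
  have fin: "finite {u\<in>A. w < j u}" if "0 < w" for w
    by (rule finite_subset[of _ "{s\<in>{0..1}. w < \<bar>j s\<bar>}"]) (use j that A in \<open>auto simp: jump_like_def\<close>)
  \<comment> \<open>Half of \<open>j a\<close> is a positive level that keeps \<open>a\<close>
    itself in \<open>B\<close>.\<close>
  define B where "B = {u\<in>A. j a / 2 < j u}"
  have B: "finite B" "a \<in> B" using fin[of "j a / 2"] a by (auto simp: B_def)
  define v where "v = Max (j ` B)"
  have v: "v \<in> j ` B" unfolding v_def using B by (intro Max_in) auto
  have le: "j u \<le> v" if "u \<in> B" for u unfolding v_def using B that by (intro Max_ge) auto
  have v0: "0 < v" "j a \<le> v" using le[OF B(2)] a by auto
  have "j u \<le> v" if "u \<in> A" for u
    using le[of u] v0 a that by (cases "u \<in> B") (auto simp: B_def)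
  moreover have "finite {u\<in>A. j u = v}"
    by (rule finite_subset[OF _ fin[of "v / 2"]]) (use v0 in auto)
  moreover have "{u\<in>A. j u = v} \<noteq> {}" using v by (auto simp: B_def)
  ultimately show ?thesis using v0 by blast
qed auto

text \<open>The latest maximiser is the one \<open>Ltilde\<close> selects; the earliest, for
  \<open>R1\<close>, is taken directly from the finite set in
  \<open>jump_like_argmax\<close>.\<close>

lemma jump_like_last_argmax:
  assumes j: "jump_like j" and A: "A \<subseteq> {0..1}"
  shows "(\<forall>u\<in>A. j u \<le> 0) \<or>
    (\<exists>p\<in>A. 0 < j p \<and> (\<forall>u\<in>A. j u \<le> j p) \<and> (\<forall>u\<in>A. p < u \<longrightarrow> j u < j p))"
proof (cases "\<forall>u\<in>A. j u \<le> 0")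
  case False
  then obtain v where v: "v > 0" "finite {u\<in>A. j u = v}" "{u\<in>A. j u = v} \<noteq> {}" "\<forall>u\<in>A. j u \<le> v"
    using jump_like_argmax[OF j A] by blast
  define p where "p = Max {u\<in>A. j u = v}"
  have p: "p \<in> A" "j p = v" using Max_in[OF v(2,3)] by (auto simp: p_def)
  have "j u < v" if "u \<in> A" "p < u" for u
    using Max_ge[OF v(2), of u] v(4) that by (force simp: p_def less_le)
  then show ?thesis using p v by (intro disjI2 bexI[of _ p]) auto
qed auto

lemma runsup_eqI:
  assumes "0 \<le> s" "s \<le> \<tau>" "j s = v" "\<And>u. 0 \<le> u \<Longrightarrow> u \<le> \<tau> \<Longrightarrow> j u \<le> v"
  shows "runsup j \<tau> = v"
  unfolding runsup_def by (rule cSup_eq_maximum) (use assms in auto)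

lemma runsup_attained:
  assumes j: "jump_like j" and \<tau>: "0 \<le> \<tau>" "\<tau> \<le> 1"
  obtains s where "0 \<le> s" "s \<le> \<tau>" "j s = runsup j \<tau>" "\<And>u. 0 \<le> u \<Longrightarrow> u \<le> \<tau> \<Longrightarrow> j u \<le> j s"
proof -
  have j0: "j 0 = 0" using j by (simp add: jump_like_def)
  have "\<exists>s\<in>{0..\<tau>}. \<forall>u\<in>{0..\<tau>}. j u \<le> j s"
    using jump_like_last_argmax[OF j, of "{0..\<tau>}"] \<tau> j0 by (auto intro: bexI[of _ 0])
  then obtain s where s: "0 \<le> s" "s \<le> \<tau>" "\<And>u. 0 \<le> u \<Longrightarrow> u \<le> \<tau> \<Longrightarrow> j u \<le> j s" by auto
  with runsup_eqI[OF s(1,2) refl] show ?thesis by (intro that) auto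
qed

lemma runsup_upper: "jump_like j \<Longrightarrow> 0 \<le> s \<Longrightarrow> s \<le> \<tau> \<Longrightarrow> \<tau> \<le> 1 \<Longrightarrow> j s \<le> runsup j \<tau>"
  by (metis order_trans runsup_attained)

lemma runsup_nonneg: "jump_like j \<Longrightarrow> 0 \<le> \<tau> \<Longrightarrow> \<tau> \<le> 1 \<Longrightarrow> 0 \<le> runsup j \<tau>"
  using runsup_upper[of j 0 \<tau>] by (simp add: jump_like_def)

lemma runsup_least: "jump_like j \<Longrightarrow> 0 \<le> \<tau> \<Longrightarrow> \<tau> \<le> 1 \<Longrightarrow>
    (\<And>s. 0 \<le> s \<Longrightarrow> s \<le> \<tau> \<Longrightarrow> j s \<le> c) \<Longrightarrow> runsup j \<tau> \<le> c"
  by (metis runsup_attained)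

lemma runsup_mono: "jump_like j \<Longrightarrow> 0 \<le> s \<Longrightarrow> s \<le> \<tau> \<Longrightarrow> \<tau> \<le> 1 \<Longrightarrow> runsup j s \<le> runsup j \<tau>"
  by (intro runsup_least) (auto intro!: runsup_upper)

lemma jump_like_locally_small:
  assumes j: "jump_like j" and e: "0 < e"
  obtains d where "0 < d" "\<And>s. 0 \<le> s \<Longrightarrow> s \<le> 1 \<Longrightarrow> s \<noteq> \<tau> \<Longrightarrow> \<bar>s - \<tau>\<bar> < d \<Longrightarrow> \<bar>j s\<bar> \<le> e"
proof -
  have "finite {s\<in>{0..1}. e < \<bar>j s\<bar>}" using j e by (auto simp: jump_like_def)
  then obtain d where d: "d > 0" "\<forall>s\<in>{s\<in>{0..1}. e < \<bar>j s\<bar>}. s \<noteq> \<tau> \<longrightarrow> d \<le> dist \<tau> s"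
    using finite_set_avoid by blast
  show ?thesis
  proof (rule that[OF d(1)], rule ccontr)
    fix s assume "0 \<le> s" "s \<le> 1" "s \<noteq> \<tau>" "\<bar>s - \<tau>\<bar> < d" "\<not> \<bar>j s\<bar> \<le> e"
    then show False using d(2) by (fastforce simp: dist_real_def)
  qed
qed

text \<open>The supremum over \<open>[0,s)\<close> is attained at some \<open>p < s\<close>, and
  from \<open>p\<close> on nothing changes until \<open>s\<close>. This yields left limits of the
  running supremum.\<close>

lemma runsup_left_const:
  assumes j: "jump_like j" and s: "0 < s" "s \<le> 1"
  obtains p where "0 \<le> p" "p < s" "\<And>u. p \<le> u \<Longrightarrow> u < s \<Longrightarrow> runsup j u = runsup j p"
proof -
  have j0: "j 0 = 0" using j by (simp add: jump_like_def)
  have "\<exists>p\<in>{0..<s}. \<forall>u\<in>{0..<s}. j u \<le> j p"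
  proof (cases "\<forall>u\<in>{0..<s}. j u \<le> 0")
    case True
    then show ?thesis using s j0 by (intro bexI[of _ 0]) auto
  next
    case False
    have "{0..<s} \<subseteq> {0..1}" using s by auto
    then show ?thesis using jump_like_last_argmax[OF j] False by blast
  qed
  then obtain p where p: "0 \<le> p" "p < s" "\<And>u. 0 \<le> u \<Longrightarrow> u < s \<Longrightarrow> j u \<le> j p" by auto
  have "runsup j u = j p" if "p \<le> u" "u < s" for u
    using p that by (intro runsup_eqI) auto
  with p show ?thesis by (intro that[of p]) auto
qed

text \<open>Jumps shortly after \<tau> are at most \<open>e / 2\<close>, and a running supremum is
  never negative, so they cannot raise it by more than that.\<close>

lemma runsup_tendsto_right:
  assumes j: "jump_like j" and \<tau>: "0 \<le> \<tau>" "\<tau> < 1"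
  shows "(runsup j \<longlongrightarrow> runsup j \<tau>) (at_right \<tau>)"
proof (rule tendstoI)
  fix e :: real assume e: "0 < e"
  obtain d where d: "0 < d" "\<And>s. 0 \<le> s \<Longrightarrow> s \<le> 1 \<Longrightarrow> s \<noteq> \<tau> \<Longrightarrow> \<bar>s - \<tau>\<bar> < d \<Longrightarrow> \<bar>j s\<bar> \<le> e / 2"
    using jump_like_locally_small[OF j, of "e / 2" \<tau>] e by auto
  have "dist (runsup j u) (runsup j \<tau>) < e" if u: "\<tau> < u" "u < min 1 (\<tau> + d)" for u
  proof -
    have "runsup j u \<le> runsup j \<tau> + e / 2"
    proof (rule runsup_least[OF j])
      fix s assume s: "0 \<le> s" "s \<le> u"
      show "j s \<le> runsup j \<tau> + e / 2"
      proof (cases "s \<le> \<tau>")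
        case True
        then show ?thesis using runsup_upper[OF j s(1), of \<tau>] e \<tau> by auto
      next
        case False
        then show ?thesis using d(2)[of s] s u runsup_nonneg[OF j, of \<tau>] \<tau> by auto
      qed
    qed (use u \<tau> in auto)
    moreover have "runsup j \<tau> \<le> runsup j u" using u \<tau> by (intro runsup_mono[OF j]) auto
    ultimately show ?thesis using e by (auto simp: dist_real_def)
  qed
  then show "\<forall>\<^sub>F u in at_right \<tau>. dist (runsup j u) (runsup j \<tau>) < e"
    using d(1) \<tau> by (auto simp: eventually_at_right_field intro!: exI[of _ "min 1 (\<tau> + d)"])
qed

text \<open>\<open>l\<close> maps \<open>[0,\<tau>]\<close> onto \<open>[0, l \<tau>]\<close>, so
  both suprema range over matched jumps; each inequality uses one direction of the matching.\<close>

lemma runsup_time_change: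
  assumes j: "jump_like j" and k: "jump_like k" and l: "l \<in> time_changes"
    and e: "\<And>s. 0 \<le> s \<Longrightarrow> s \<le> 1 \<Longrightarrow> \<bar>j s - k (l s)\<bar> \<le> e" and \<tau>: "0 \<le> \<tau>" "\<tau> \<le> 1"
  shows "\<bar>runsup j \<tau> - runsup k (l \<tau>)\<bar> \<le> e"
proof -
  have l\<tau>: "0 \<le> l \<tau>" "l \<tau> \<le> 1" using time_changes_range[OF l \<tau>] by auto
  have "runsup j \<tau> \<le> runsup k (l \<tau>) + e"
  proof (rule runsup_least[OF j \<tau>])
    fix s assume s: "0 \<le> s" "s \<le> \<tau>"
    then have "k (l s) \<le> runsup k (l \<tau>)"
      using time_changes_range[OF l, of s] time_changes_less_iff(2)[OF l, of s \<tau>] \<tau> l\<tau>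
      by (intro runsup_upper[OF k]) auto
    then show "j s \<le> runsup k (l \<tau>) + e" using e[of s] s \<tau> by auto
  qed
  moreover have "runsup k (l \<tau>) \<le> runsup j \<tau> + e"
  proof (rule runsup_least[OF k l\<tau>])
    fix s assume "0 \<le> s" "s \<le> l \<tau>"
    then obtain t where t: "0 \<le> t" "t \<le> \<tau>" "l t = s"
      using time_changes_surj_upto[OF l \<tau>] by blast
    have "j t \<le> runsup j \<tau>" using t \<tau> by (intro runsup_upper[OF j]) auto
    then show "k s \<le> runsup j \<tau> + e" using e[of t] t \<tau> by auto
  qed
  ultimately show ?thesis by auto
qed

section \<open>Running suprema of jumps and one-sided trimming\<close>

lemma S_plus_eq_runsup: "S_plus x = runsup (jump x)"
  by (simp add: fun_eq_iff S_plus_def runsup_def)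

lemma S_minus_eq_S_plus: "S_minus x = S_plus (\<lambda>u. - x u)"
  by (simp add: fun_eq_iff S_plus_def S_minus_def)

lemma S_plus_affine:
  assumes x: "cadlag01 x" and b: "0 < b" and y: "\<And>t. 0 \<le> t \<Longrightarrow> t \<le> 1 \<Longrightarrow> y t = (x t - t * a) / b"
    and \<tau>: "0 \<le> \<tau>" "\<tau> \<le> 1"
  shows "S_plus y \<tau> = S_plus x \<tau> / b"
proof -
  have jy: "jump y s = jump x s / b" if "0 \<le> s" "s \<le> 1" for s
    using cadlag01_cong(2)[OF cadlag01_affine(1)[OF x] y that] cadlag01_affine(2)[OF x that] by simp
  obtain s where s: "0 \<le> s" "s \<le> \<tau>" "jump x s = runsup (jump x) \<tau>"
    "\<And>u. 0 \<le> u \<Longrightarrow> u \<le> \<tau> \<Longrightarrow> jump x u \<le> jump x s"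
    using runsup_attained[OF jump_like_jump[OF x] \<tau>] by blast
  show ?thesis
    unfolding S_plus_eq_runsup
    by (rule runsup_eqI[OF s(1,2)]) (use jy s \<tau> b in \<open>auto simp: divide_right_mono\<close>)
qed

lemma S_plus_time_change:
  assumes x: "cadlag01 x" and y: "cadlag01 y" and l: "l \<in> time_changes"
    and e: "\<And>t. 0 \<le> t \<Longrightarrow> t \<le> 1 \<Longrightarrow> \<bar>x t - y (l t)\<bar> \<le> e" and \<tau>: "0 \<le> \<tau>" "\<tau> \<le> 1"
  shows "\<bar>S_plus x \<tau> - S_plus y (l \<tau>)\<bar> \<le> 2 * e"
  unfolding S_plus_eq_runsup
  using J1_near_jump[OF x y l e] \<tau> by (intro runsup_time_change jump_like_jump x y l) auto

lemma S_minus_time_change: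
  assumes x: "cadlag01 x" and y: "cadlag01 y" and l: "l \<in> time_changes"
    and e: "\<And>t. 0 \<le> t \<Longrightarrow> t \<le> 1 \<Longrightarrow> \<bar>x t - y (l t)\<bar> \<le> e" and \<tau>: "0 \<le> \<tau>" "\<tau> \<le> 1"
  shows "\<bar>S_minus x \<tau> - S_minus y (l \<tau>)\<bar> \<le> 2 * e"
proof -
  have "\<bar>- x t - - y (l t)\<bar> \<le> e" if "0 \<le> t" "t \<le> 1" for t using e[OF that] by auto
  then show ?thesis unfolding S_minus_eq_S_plus
    by (intro S_plus_time_change[OF cadlag01_minus(1)[OF x] cadlag01_minus(1)[OF y] l _ \<tau>]) auto
qed

lemma cadlag01_S_plus:
  assumes x: "cadlag01 x"
  shows "cadlag01 (\<lambda>\<tau>. x \<tau> - S_plus x \<tau>)"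
proof -
  note j = jump_like_jump[OF x]
  have "\<exists>l. ((\<lambda>\<tau>. x \<tau> - S_plus x \<tau>) \<longlongrightarrow> l) (at_left s)" if s: "0 < s" "s \<le> 1" for s
  proof -
    obtain p where p: "0 \<le> p" "p < s" "\<And>u. p \<le> u \<Longrightarrow> u < s \<Longrightarrow> runsup (jump x) u = runsup (jump x) p"
      using runsup_left_const[OF j s] by blast
    have "eventually (\<lambda>u. S_plus x p = S_plus x u) (at_left s)"
      unfolding S_plus_eq_runsup eventually_at_left_field
    proof (intro exI[of _ p] conjI allI impI p(2))
      fix u assume "p < u" "u < s"
      with p(3)[of u] show "runsup (jump x) p = runsup (jump x) u" by simp
    qed
    then have "(S_plus x \<longlongrightarrow> S_plus x p) (at_left s)"
      using Lim_transform_eventually[OF tendsto_const] by blast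
    then show ?thesis using tendsto_diff[OF cadlag01_tendsto_left[OF x s]] by blast
  qed
  moreover have "((\<lambda>\<tau>. x \<tau> - S_plus x \<tau>) \<longlongrightarrow> x s - S_plus x s) (at_right s)" if s: "0 \<le> s" "s < 1" for s
    unfolding S_plus_eq_runsup
    by (intro tendsto_diff runsup_tendsto_right[OF j s] cadlag01_tendsto_right[OF x s])
  ultimately show ?thesis by (auto simp: cadlag01_def)
qed

lemma cadlag01_Trim_plus: "cadlag01 x \<Longrightarrow> cadlag01 (Trim_plus x)"
  using cadlag01_S_plus by (simp add: Trim_plus_def)

lemma Trim_plus_affine:
  assumes x: "cadlag01 x" and b: "0 < b" and y: "\<And>t. 0 \<le> t \<Longrightarrow> t \<le> 1 \<Longrightarrow> y t = (x t - t * a) / b"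
    and \<tau>: "0 \<le> \<tau>" "\<tau> \<le> 1"
  shows "Trim_plus y \<tau> = (Trim_plus x \<tau> - \<tau> * a) / b"
  using S_plus_affine[OF x b y \<tau>] y[OF \<tau>] by (simp add: Trim_plus_def diff_divide_distrib)

text \<open>The same time change serves: \<open>e\<close> for the paths and \<open>2 * e\<close> for
  the running suprema. No jump has to be selected, so the estimate holds at every path.\<close>

lemma J1_near_Trim_plus:
  assumes x: "cadlag01 x" and y: "cadlag01 y" and near: "J1_near e x y"
  shows "J1_near (3 * e) (Trim_plus x) (Trim_plus y)"
proof -
  obtain l where l: "l \<in> time_changes" "\<And>t. 0 \<le> t \<Longrightarrow> t \<le> 1 \<Longrightarrow> \<bar>l t - t\<bar> \<le> e \<and> \<bar>x t - y (l t)\<bar> \<le> e"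
    using near by (auto simp: J1_near_def)
  have "\<bar>l t - t\<bar> \<le> 3 * e \<and> \<bar>Trim_plus x t - Trim_plus y (l t)\<bar> \<le> 3 * e" if t: "0 \<le> t" "t \<le> 1" for t
    using S_plus_time_change[OF x y l(1), of e t] l(2) t by (force simp: Trim_plus_def)
  with l(1) show ?thesis unfolding J1_near_def by (intro bexI[of _ l]) auto
qed

lemma Trim_minus_eq: "Trim_minus x = (\<lambda>\<tau>. - Trim_plus (\<lambda>u. - x u) \<tau>)"
  by (simp add: fun_eq_iff Trim_minus_def Trim_plus_def S_minus_eq_S_plus)

lemma J1_near_minus: "J1_near e x y \<Longrightarrow> J1_near e (\<lambda>t. - x t) (\<lambda>t. - y t)"
  unfolding J1_near_def by (simp add: abs_minus_commute)

lemma cadlag01_Trim_minus: "cadlag01 x \<Longrightarrow> cadlag01 (Trim_minus x)"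
  unfolding Trim_minus_eq by (intro cadlag01_minus cadlag01_Trim_plus)

lemma Trim_minus_affine:
  assumes x: "cadlag01 x" and b: "0 < b" and y: "\<And>t. 0 \<le> t \<Longrightarrow> t \<le> 1 \<Longrightarrow> y t = (x t - t * a) / b"
    and \<tau>: "0 \<le> \<tau>" "\<tau> \<le> 1"
  shows "Trim_minus y \<tau> = (Trim_minus x \<tau> - \<tau> * a) / b"
proof -
  have "Trim_plus (\<lambda>u. - y u) \<tau> = (Trim_plus (\<lambda>u. - x u) \<tau> - \<tau> * (- a)) / b"
    using y by (intro Trim_plus_affine[OF cadlag01_minus(1)[OF x] b _ \<tau>]) (simp add: diff_divide_distrib)
  then show ?thesis by (simp add: Trim_minus_eq diff_divide_distrib add_divide_distrib)
qed

lemma J1_near_Trim_minus: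
  assumes x: "cadlag01 x" and y: "cadlag01 y" and near: "J1_near e x y"
  shows "J1_near (3 * e) (Trim_minus x) (Trim_minus y)"
  unfolding Trim_minus_eq
  by (intro J1_near_minus J1_near_Trim_plus cadlag01_minus x y near)

text \<open>Moduli serve both discontinuous operators: two equal upward jumps leave the record time
  ambiguous, and two opposite jumps leave the sign of the largest one ambiguous. Zero jumps always
  tie and are exempt.\<close>

definition tie_free :: "(real \<Rightarrow> real) \<Rightarrow> bool" where
  "tie_free x \<longleftrightarrow> (\<forall>s\<in>{0..1}. \<forall>u\<in>{0..1}. s \<noteq> u \<longrightarrow> \<bar>jump x s\<bar> = \<bar>jump x u\<bar> \<longrightarrow> jump x s = 0)"

lemma tie_freeI:
  assumes *: "\<And>s u. 0 < s \<Longrightarrow> s < u \<Longrightarrow> u \<le> 1 \<Longrightarrow> \<bar>jump x s\<bar> = \<bar>jump x u\<bar> \<Longrightarrow> jump x s = 0"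
  shows "tie_free x"
  unfolding tie_free_def
proof (intro ballI impI)
  fix s u :: real
  assume su: "s \<in> {0..1}" "u \<in> {0..1}" "s \<noteq> u" "\<bar>jump x s\<bar> = \<bar>jump x u\<bar>"
  consider "s = 0" | "u = 0" | "0 < s" "s < u" | "0 < u" "u < s" using su by fastforce
  then show "jump x s = 0"
  proof cases
    case 3
    then show ?thesis using *[OF 3] su by simp
  next
    case 4
    then have "jump x u = 0" using *[OF 4] su by simp
    then show ?thesis using su(4) by simp
  qed (use su in simp_all)
qed

lemma tie_freeD:
  "tie_free x \<Longrightarrow> 0 \<le> s \<Longrightarrow> s \<le> 1 \<Longrightarrow> 0 \<le> u \<Longrightarrow> u \<le> 1 \<Longrightarrow> s \<noteq> u \<Longrightarrow> \<bar>jump x s\<bar> = \<bar>jump x u\<bar> \<Longrightarrow> jump x s = 0"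
  by (auto simp: tie_free_def)

text \<open>Among finitely many maximisers the infimum in \<open>R1\<close> is a minimum. Without
  upward jumps \<open>R1 x\<close> is \<open>0\<close>, and \<open>Rtrim\<close> subtracts the jump
  at \<open>0\<close>, which is \<open>0\<close> by convention.\<close>

lemma Rtrim_cases:
  assumes x: "cadlag01 x"
  obtains (zero) "S_plus x 1 = 0" "Rtrim x = x"
    | (pos) r where "0 < r" "r \<le> 1" "jump x r = S_plus x 1" "0 < jump x r"
        "\<And>u. 0 \<le> u \<Longrightarrow> u \<le> 1 \<Longrightarrow> jump x u \<le> jump x r"
        "\<And>u. 0 \<le> u \<Longrightarrow> u < r \<Longrightarrow> jump x u < jump x r"
        "\<And>\<tau>. \<tau> \<le> 1 \<Longrightarrow> Rtrim x \<tau> = x \<tau> - (if r \<le> \<tau> then jump x r else 0)"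
proof -
  note j = jump_like_jump[OF x]
  consider "\<forall>u\<in>{0..1}. jump x u \<le> 0"
    | v where "v > 0" "finite {u\<in>{0..1}. jump x u = v}" "{u\<in>{0..1}. jump x u = v} \<noteq> {}" "\<forall>u\<in>{0..1}. jump x u \<le> v"
    using jump_like_argmax[OF j, of "{0..1}"] by blast
  then show ?thesis
  proof cases
    case 1
    then have S: "S_plus x 1 = 0"
      unfolding S_plus_eq_runsup by (intro runsup_eqI[of 0]) auto
    have "R1 x = 0" unfolding R1_def by (rule cInf_eq_minimum) (auto simp: S)
    then have "Rtrim x = x" by (simp add: Rtrim_def)
    with S show ?thesis by (rule zero)
  next
    case (2 v)
    define r where "r = Min {u\<in>{0..1}. jump x u = v}"
    have r: "r \<in> {0..1}" "jump x r = v" using Min_in[OF 2(2,3)] by (auto simp: r_def)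
    have less: "jump x u < v" if "0 \<le> u" "u < r" for u
    proof -
      have "u \<notin> {u\<in>{0..1}. jump x u = v}" using Min_le[OF 2(2), of u] that(2) unfolding r_def by auto
      then show ?thesis using 2(4) that r(1) by (auto simp: less_le)
    qed
    have S: "S_plus x 1 = v"
      unfolding S_plus_eq_runsup by (intro runsup_eqI[of r]) (use r 2(4) in auto)
    have "R1 x = r" unfolding R1_def
    proof (rule cInf_eq_minimum)
      show "r \<in> {s \<in> {0..1}. jump x s = S_plus x 1}" using r S by simp
      show "r \<le> u" if "u \<in> {s \<in> {0..1}. jump x s = S_plus x 1}" for u
        using less[of u] that S by force
    qed
    then have "Rtrim x \<tau> = x \<tau> - (if r \<le> \<tau> then jump x r else 0)" if "\<tau> \<le> 1" for \<tau>
      using that by (simp add: Rtrim_def indicator_def)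
    moreover have "r \<noteq> 0" using r 2(1) by auto
    ultimately show ?thesis using r less S 2 by (intro pos[of r]) auto
  qed
qed

text \<open>The record time has been reached by \<tau> exactly when the running supremum has its
  final value. This trades \<open>R1\<close> for suprema, whose scaling and measurability are
  easier; without upward jumps both branches subtract \<open>0\<close>.\<close>

lemma Rtrim_eq:
  assumes x: "cadlag01 x" and \<tau>: "0 \<le> \<tau>" "\<tau> \<le> 1"
  shows "Rtrim x \<tau> = x \<tau> - (if S_plus x \<tau> = S_plus x 1 then S_plus x 1 else 0)"
proof (cases rule: Rtrim_cases[OF x, case_names zero pos])
  case zero
  then show ?thesis by simp
next
  case (pos r)
  have "S_plus x \<tau> = S_plus x 1 \<longleftrightarrow> r \<le> \<tau>"
  proof
    assume "r \<le> \<tau>"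
    then show "S_plus x \<tau> = S_plus x 1"
      using pos \<tau> unfolding pos(3)[symmetric] S_plus_eq_runsup by (intro runsup_eqI[of r]) auto
  next
    assume eq: "S_plus x \<tau> = S_plus x 1"
    obtain s where "0 \<le> s" "s \<le> \<tau>" "jump x s = S_plus x \<tau>"
      using runsup_attained[OF jump_like_jump[OF x] \<tau>] unfolding S_plus_eq_runsup by metis
    then show "r \<le> \<tau>" using pos(6)[of s] pos(3) eq by force
  qed
  then show ?thesis using pos \<tau> by simp
qed

lemma jump_Rtrim:
  assumes x: "cadlag01 x"
  shows "cadlag01 (Rtrim x)"
    and "0 \<le> s \<Longrightarrow> s \<le> 1 \<Longrightarrow> jump (Rtrim x) s = jump x s \<or> jump (Rtrim x) s = 0"
proof -
  have "cadlag01 (Rtrim x) \<and> (\<forall>s\<in>{0..1}. jump (Rtrim x) s = jump x s \<or> jump (Rtrim x) s = 0)"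
  proof (cases rule: Rtrim_cases[OF x, case_names zero pos])
    case zero
    then show ?thesis using x by simp
  next
    case (pos r)
    have L: "(Rtrim x \<longlongrightarrow> x s - jump x s - (if r < s then jump x r else 0)) (at_left s)" if s: "0 < s" "s \<le> 1" for s
    proof (rule Lim_transform_eventually)
      show "((\<lambda>u. x u - (if r < s then jump x r else 0)) \<longlongrightarrow> x s - jump x s - (if r < s then jump x r else 0)) (at_left s)"
        by (intro tendsto_intros cadlag01_tendsto_left[OF x s])
      have "eventually (\<lambda>u. (if r < s then r else 0) < u \<and> u < s) (at_left s)"
        using s by (auto simp: eventually_at_left_field)
      then show "eventually (\<lambda>u. x u - (if r < s then jump x r else 0) = Rtrim x u) (at_left s)"
        by eventually_elim (use s pos in \<open>auto split: if_splits\<close>)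
    qed
    have R: "(Rtrim x \<longlongrightarrow> Rtrim x s) (at_right s)" if s: "0 \<le> s" "s < 1" for s
    proof (rule Lim_transform_eventually)
      show "((\<lambda>u. x u - (if r \<le> s then jump x r else 0)) \<longlongrightarrow> Rtrim x s) (at_right s)"
        using pos(7)[of s] s by (auto intro!: tendsto_intros cadlag01_tendsto_right[OF x s])
      have "eventually (\<lambda>u. s < u \<and> u < (if r \<le> s then 1 else r)) (at_right s)"
        using s unfolding eventually_at_right_field
        by (intro exI[of _ "if r \<le> s then 1 else r"]) auto
      then show "eventually (\<lambda>u. x u - (if r \<le> s then jump x r else 0) = Rtrim x u) (at_right s)"
        by eventually_elim (use s pos in \<open>auto split: if_splits\<close>)
    qed
    have "jump (Rtrim x) s = jump x s \<or> jump (Rtrim x) s = 0" if s: "0 < s" "s \<le> 1" for s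
      using jump_eqI[OF s(1) L[OF s]] pos(7)[OF s(2)] by (auto split: if_splits)
    then have "jump (Rtrim x) s = jump x s \<or> jump (Rtrim x) s = 0" if "s \<in> {0..1}" for s
      using that by (cases "s = 0") auto
    moreover have "cadlag01 (Rtrim x)" using L R by (force simp: cadlag01_def)
    ultimately show ?thesis by blast
  qed
  then show "cadlag01 (Rtrim x)" "0 \<le> s \<Longrightarrow> s \<le> 1 \<Longrightarrow> jump (Rtrim x) s = jump x s \<or> jump (Rtrim x) s = 0"
    by auto
qed

text \<open>Every jump survives or becomes \<open>0\<close>, and zero jumps may tie.\<close>

lemma tie_free_Rtrim:
  assumes x: "cadlag01 x" "tie_free x"
  shows "tie_free (Rtrim x)"
  unfolding tie_free_def
proof (intro ballI impI)
  fix s u :: real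
  assume *: "s \<in> {0..1}" "u \<in> {0..1}" "s \<noteq> u" "\<bar>jump (Rtrim x) s\<bar> = \<bar>jump (Rtrim x) u\<bar>"
  then show "jump (Rtrim x) s = 0"
    using jump_Rtrim(2)[OF x(1), of s] jump_Rtrim(2)[OF x(1), of u] tie_freeD[OF x(2), of s u] by auto
qed

lemma Rtrim_affine:
  assumes x: "cadlag01 x" and b: "0 < b" and y: "\<And>t. 0 \<le> t \<Longrightarrow> t \<le> 1 \<Longrightarrow> y t = (x t - t * a) / b"
    and \<tau>: "0 \<le> \<tau>" "\<tau> \<le> 1"
  shows "Rtrim y \<tau> = (Rtrim x \<tau> - \<tau> * a) / b"
proof -
  have y': "cadlag01 y" by (rule cadlag01_cong(1)[OF cadlag01_affine(1)[OF x] y])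
  show ?thesis
    unfolding Rtrim_eq[OF x \<tau>] Rtrim_eq[OF y' \<tau>]
    using S_plus_affine[OF x b y \<tau>] S_plus_affine[OF x b y, of 1] y[OF \<tau>] b
    by (simp add: diff_divide_distrib)
qed

text \<open>The largest jump of \<open>x\<close> is isolated by a gap \<open>g\<close>. A path
  within \<open>d\<close> has its jumps within \<open>2 * d\<close> of the matched ones, so its
  record must occur at the image of the record of \<open>x\<close>, and the removed parts switch on
  together.\<close>

lemma J1_near_Rtrim:
  assumes x: "cadlag01 x" "tie_free x" and e: "0 < e"
  shows "\<exists>d>0. \<forall>y. cadlag01 y \<longrightarrow> J1_near d x y \<longrightarrow> J1_near e (Rtrim x) (Rtrim y)"
proof (cases rule: Rtrim_cases[OF x(1), case_names zero pos])
  \<comment> \<open>Without upward jumps in \<open>x\<close>, the record of \<open>y\<close> may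
    occur anywhere, but it is at most \<open>2 * e / 3\<close>, so removing it is harmless.\<close>
  case zero
  show ?thesis
  proof (intro exI[of _ "e / 3"] conjI allI impI)
    fix y assume y: "cadlag01 y" "J1_near (e / 3) x y"
    obtain l where l: "l \<in> time_changes"
        "\<And>t. 0 \<le> t \<Longrightarrow> t \<le> 1 \<Longrightarrow> \<bar>l t - t\<bar> \<le> e / 3 \<and> \<bar>x t - y (l t)\<bar> \<le> e / 3"
      using y(2) by (auto simp: J1_near_def)
    have "l 1 = 1" using l(1) by (simp add: time_changes_def)
    then have "\<bar>S_plus y 1\<bar> \<le> 2 * (e / 3)"
      using S_plus_time_change[OF x(1) y(1) l(1), of "e / 3" 1] l(2) zero(1) by auto
    then have S: "\<bar>S_plus y 1\<bar> \<le> 2 * e / 3" by simp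
    have "\<bar>l t - t\<bar> \<le> e \<and> \<bar>x t - Rtrim y (l t)\<bar> \<le> e" if "0 \<le> t" "t \<le> 1" for t
    proof -
      have "\<bar>l t - t\<bar> \<le> e / 3" "\<bar>x t - y (l t)\<bar> \<le> e / 3" using l(2)[OF that] by auto
      moreover have "\<bar>y (l t) - Rtrim y (l t)\<bar> \<le> 2 * e / 3"
        using S e Rtrim_eq[OF y(1), of "l t"] time_changes_range[OF l(1) that] by simp
      ultimately show ?thesis using e by linarith
    qed
    then show "J1_near e (Rtrim x) (Rtrim y)" unfolding zero(2) J1_near_def
      by (intro bexI[OF _ l(1)]) auto
  qed (use e in auto)
next
  case (pos r)
  \<comment> \<open>\<open>g \<le> jump x r\<close> keeps the matched jump of \<open>y\<close>
    positive, so that \<open>y\<close> falls under the second case of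
    \<open>Rtrim_cases\<close>.\<close>
  have "\<exists>g>0. g \<le> jump x r \<and> (\<forall>s\<in>{0..1} - {r}. jump x s \<le> jump x r - g)"
  proof (cases "\<forall>s\<in>{0..1} - {r}. jump x s \<le> 0")
    case True
    then show ?thesis using pos(4) by (intro exI[of _ "jump x r"]) auto
  next
    case False
    then obtain p where p: "p \<in> {0..1} - {r}" "0 < jump x p" "\<forall>u\<in>{0..1} - {r}. jump x u \<le> jump x p"
      using jump_like_last_argmax[OF jump_like_jump[OF x(1)] Diff_subset[of _ "{r}"]] by blast
    have "jump x p \<noteq> jump x r" using tie_freeD[OF x(2), of p r] p pos by auto
    moreover have "jump x p \<le> jump x r" using pos(5) p by auto
    ultimately show ?thesis using p by (intro exI[of _ "jump x r - jump x p"]) auto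
  qed
  then obtain g where g: "0 < g" "g \<le> jump x r" "\<And>s. 0 \<le> s \<Longrightarrow> s \<le> 1 \<Longrightarrow> s \<noteq> r \<Longrightarrow> jump x s \<le> jump x r - g"
    by auto
  \<comment> \<open>\<open>4 * d < g\<close> forbids another jump of \<open>y\<close> from
    overtaking, as two jumps may each move by \<open>2 * d\<close>; \<open>3 * d \<le> e\<close>
    covers the path and the removed jump.\<close>
  define d where "d = min (e / 3) (g / 5)"
  show ?thesis
  proof (intro exI[of _ d] conjI allI impI)
    fix y assume y: "cadlag01 y" "J1_near d x y"
    obtain l where l: "l \<in> time_changes"
        "\<And>t. 0 \<le> t \<Longrightarrow> t \<le> 1 \<Longrightarrow> \<bar>l t - t\<bar> \<le> d \<and> \<bar>x t - y (l t)\<bar> \<le> d"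
      using y(2) by (auto simp: J1_near_def)
    have J: "\<bar>jump x s - jump y (l s)\<bar> \<le> 2 * d" if "0 \<le> s" "s \<le> 1" for s
      using J1_near_jump[OF x(1) y(1) l(1) _ that] l(2) by blast
    have d: "d \<le> e / 3" "d \<le> g / 5" by (auto simp: d_def)
    have r01: "0 \<le> r" "r \<le> 1" using pos by auto
    have Jr: "0 < jump y (l r)" using J[OF r01] d g(1,2) by linarith
    have lr: "0 \<le> l r" "l r \<le> 1" using time_changes_range[OF l(1) r01] by auto
    show "J1_near e (Rtrim x) (Rtrim y)"
    proof (cases rule: Rtrim_cases[OF y(1), case_names zero pos])
      case zero
      then have False using runsup_upper[OF jump_like_jump[OF y(1)] lr] Jr unfolding S_plus_eq_runsup by simp
      then show ?thesis ..
    next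
      case y_pos: (pos r')
      then obtain q where q: "0 \<le> q" "q \<le> 1" "l q = r'" 
        using time_changes_surj[OF l(1) less_imp_le[OF y_pos(1)] y_pos(2)] by blast
      have "q = r"
      proof (rule ccontr)
        assume "q \<noteq> r"
        then have "jump x q \<le> jump x r - g" using g(3) q by auto
        then show False using J[OF q(1,2)] J[OF r01] y_pos(5)[OF lr] q(3) d g(1) by auto
      qed
      have "\<bar>l t - t\<bar> \<le> e \<and> \<bar>Rtrim x t - Rtrim y (l t)\<bar> \<le> e" if t: "0 \<le> t" "t \<le> 1" for t
      proof -
        have lt: "0 \<le> l t" "l t \<le> 1" using time_changes_range[OF l(1) t] by auto
        have "r' \<le> l t \<longleftrightarrow> r \<le> t"
          using time_changes_less_iff(2)[OF l(1) r01 t] q(3) \<open>q = r\<close> by auto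
        then have "Rtrim y (l t) = y (l t) - (if r \<le> t then jump y (l r) else 0)"
          using y_pos(7)[OF lt(2)] q(3) \<open>q = r\<close> by simp
        then show ?thesis using pos(7)[OF t(2)] J[OF r01] l(2)[OF t] d by auto
      qed
      then show ?thesis unfolding J1_near_def by (intro bexI[OF _ l(1)]) auto
    qed
  qed (use e g in \<open>auto simp: d_def\<close>)
qed

section \<open>Signed modulus trimming\<close>

lemma Ltilde_eqI:
  assumes "0 \<le> p" "p \<le> \<tau>" "\<And>u. 0 \<le> u \<Longrightarrow> u \<le> \<tau> \<Longrightarrow> \<bar>jump x u\<bar> \<le> \<bar>jump x p\<bar>"
    "\<And>u. p < u \<Longrightarrow> u \<le> \<tau> \<Longrightarrow> \<bar>jump x u\<bar> < \<bar>jump x p\<bar>"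
  shows "Ltilde x \<tau> = p"
proof -
  have S: "(SUP u\<in>{0..\<tau>}. \<bar>jump x u\<bar>) = \<bar>jump x p\<bar>"
    using runsup_eqI[of p \<tau> "\<lambda>u. \<bar>jump x u\<bar>" "\<bar>jump x p\<bar>"] assms unfolding runsup_def by simp
  show ?thesis unfolding Ltilde_def S
  proof (rule cSup_eq_maximum)
    show "u \<le> p" if "u \<in> {s \<in> {0..\<tau>}. \<bar>jump x s\<bar> = \<bar>jump x p\<bar>}" for u
      using assms(4)[of u] that by force
  qed (use assms in auto)
qed

lemma Ltilde_cases:
  assumes x: "cadlag01 x" and \<tau>: "0 \<le> \<tau>" "\<tau> \<le> 1"
  obtains (zero) "\<And>u. 0 \<le> u \<Longrightarrow> u \<le> \<tau> \<Longrightarrow> jump x u = 0" "jump x (Ltilde x \<tau>) = 0"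
    | (pos) p where "0 < p" "p \<le> \<tau>" "Ltilde x \<tau> = p" "jump x p \<noteq> 0"
       "\<And>u. 0 \<le> u \<Longrightarrow> u \<le> \<tau> \<Longrightarrow> \<bar>jump x u\<bar> \<le> \<bar>jump x p\<bar>"
       "\<And>u. p < u \<Longrightarrow> u \<le> \<tau> \<Longrightarrow> \<bar>jump x u\<bar> < \<bar>jump x p\<bar>"
proof -
  consider "\<forall>u\<in>{0..\<tau>}. \<bar>jump x u\<bar> \<le> 0"
    | p where "p \<in> {0..\<tau>}" "0 < \<bar>jump x p\<bar>" "\<forall>u\<in>{0..\<tau>}. \<bar>jump x u\<bar> \<le> \<bar>jump x p\<bar>"
       "\<forall>u\<in>{0..\<tau>}. p < u \<longrightarrow> \<bar>jump x u\<bar> < \<bar>jump x p\<bar>"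
    using jump_like_last_argmax[OF jump_like_abs[OF jump_like_jump[OF x]], of "{0..\<tau>}"] \<tau> by auto
  then show ?thesis
  proof cases
    case 1
    then have 0: "jump x u = 0" if "0 \<le> u" "u \<le> \<tau>" for u using that by auto
    have S: "(SUP u\<in>{0..\<tau>}. \<bar>jump x u\<bar>) = 0"
      using runsup_eqI[of 0 \<tau> "\<lambda>u. \<bar>jump x u\<bar>" 0] 0 \<tau> unfolding runsup_def by simp
    \<comment> \<open>With no jump on \<open>[0,\<tau>]\<close>, all times tie at \<open>0\<close>
      and the supremum of the maximisers is \<tau> itself.\<close>
    have "Ltilde x \<tau> = \<tau>" unfolding Ltilde_def S
      by (rule cSup_eq_maximum) (use 0 \<tau> in auto)
    then show ?thesis using 0 \<tau> by (intro zero) auto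
  next
    case (2 p)
    have "p \<noteq> 0" using 2(2) by auto
    then show ?thesis using 2 by (intro pos[of p] Ltilde_eqI) auto
  qed
qed

lemma Ltilde_range:
  assumes x: "cadlag01 x" and \<tau>: "0 \<le> \<tau>" "\<tau> \<le> 1"
  obtains u where "0 \<le> u" "u \<le> \<tau>" "jump x (Ltilde x \<tau>) = jump x u"
proof (cases rule: Ltilde_cases[OF x \<tau>, case_names zero pos])
  case zero
  then show ?thesis using that[of 0] \<tau> by simp
next
  case (pos p)
  then show ?thesis using that[of p] by simp
qed

text \<open>Shortly before \<open>s\<close> the removed jump is constant: it is the latest largest
  one on \<open>[0,s)\<close>, if there is a jump there at all.\<close>

lemma Mtrim_left_limit:
  assumes x: "cadlag01 x" and s: "0 < s" "s \<le> 1"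
  obtains (zero) "\<And>u. 0 \<le> u \<Longrightarrow> u < s \<Longrightarrow> jump x u = 0" "(Mtrim x \<longlongrightarrow> x s - jump x s) (at_left s)"
    | (pos) p where "0 < p" "p < s" "jump x p \<noteq> 0" "\<And>u. 0 \<le> u \<Longrightarrow> u < s \<Longrightarrow> \<bar>jump x u\<bar> \<le> \<bar>jump x p\<bar>"
       "\<And>u. p < u \<Longrightarrow> u < s \<Longrightarrow> \<bar>jump x u\<bar> < \<bar>jump x p\<bar>"
       "(Mtrim x \<longlongrightarrow> x s - jump x s - jump x p) (at_left s)"
proof -
  consider "\<forall>u\<in>{0..<s}. \<bar>jump x u\<bar> \<le> 0"
    | p where "p \<in> {0..<s}" "0 < \<bar>jump x p\<bar>" "\<forall>u\<in>{0..<s}. \<bar>jump x u\<bar> \<le> \<bar>jump x p\<bar>"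
       "\<forall>u\<in>{0..<s}. p < u \<longrightarrow> \<bar>jump x u\<bar> < \<bar>jump x p\<bar>"
  proof -
    have "{0..<s} \<subseteq> {0..1}" using s by auto
    from jump_like_last_argmax[OF jump_like_abs[OF jump_like_jump[OF x]] this] that show ?thesis by blast
  qed
  then show ?thesis
  proof cases
    case 1
    then have 0: "jump x u = 0" if "0 \<le> u" "u < s" for u using that by auto
    have "Mtrim x u = x u" if u: "0 \<le> u" "u < s" for u
    proof -
      obtain v where "0 \<le> v" "v \<le> u" "jump x (Ltilde x u) = jump x v"
        using Ltilde_range[OF x, of u] u s by auto
      then show ?thesis using 0[of v] u by (simp add: Mtrim_def)
    qed
    then have "eventually (\<lambda>u. x u = Mtrim x u) (at_left s)"
      using s by (auto simp: eventually_at_left_field intro!: exI[of _ 0])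
    from Lim_transform_eventually[OF cadlag01_tendsto_left[OF x s] this] 0 zero show ?thesis by blast
  next
    case (2 p)
    have p0: "p \<noteq> 0" using 2(2) by auto
    have "Mtrim x u = x u - jump x p" if u: "p < u" "u < s" for u
      using Ltilde_eqI[of p u x] 2 u by (simp add: Mtrim_def)
    then have "eventually (\<lambda>u. x u - jump x p = Mtrim x u) (at_left s)"
      using 2 by (auto simp: eventually_at_left_field intro!: exI[of _ p])
    from Lim_transform_eventually[OF tendsto_diff[OF cadlag01_tendsto_left[OF x s] tendsto_const] this]
    have "(Mtrim x \<longlongrightarrow> x s - jump x s - jump x p) (at_left s)" .
    then show ?thesis using 2 p0 by (intro pos[of p]) auto
  qed
qed

text \<open>Right continuity of the removed jump: shortly after \<tau> only small jumps occur. They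
  cannot displace a nonzero maximiser, and if there is none the removed jump is itself
  small.\<close>

lemma cadlag01_Mtrim:
  assumes x: "cadlag01 x"
  shows "cadlag01 (Mtrim x)"
proof -
  note j = jump_like_jump[OF x]
  have R: "(Mtrim x \<longlongrightarrow> Mtrim x \<tau>) (at_right \<tau>)" if \<tau>: "0 \<le> \<tau>" "\<tau> < 1" for \<tau>
  proof -
    have \<tau>1: "\<tau> \<le> 1" using \<tau> by simp
    have "((\<lambda>u. jump x (Ltilde x u)) \<longlongrightarrow> jump x (Ltilde x \<tau>)) (at_right \<tau>)"
    proof (cases rule: Ltilde_cases[OF x \<tau>(1) \<tau>1, case_names zero pos])
      case zero
      show ?thesis
      proof (rule tendstoI)
        fix e :: real assume e: "0 < e"
        obtain d where d: "0 < d" "\<And>s. 0 \<le> s \<Longrightarrow> s \<le> 1 \<Longrightarrow> s \<noteq> \<tau> \<Longrightarrow> \<bar>s - \<tau>\<bar> < d \<Longrightarrow> \<bar>jump x s\<bar> \<le> e / 2"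
          using jump_like_locally_small[OF j, of "e / 2" \<tau>] e by auto
        have "dist (jump x (Ltilde x u)) (jump x (Ltilde x \<tau>)) < e" if u: "\<tau> < u" "u < min 1 (\<tau> + d)" for u
        proof -
          obtain v where v: "0 \<le> v" "v \<le> u" "jump x (Ltilde x u) = jump x v"
            using Ltilde_range[OF x, of u] u \<tau> by auto
          have "\<bar>jump x v\<bar> \<le> e / 2"
          proof (cases "v \<le> \<tau>")
            case True
            then show ?thesis using zero(1)[of v] v e by simp
          next
            case False
            then show ?thesis using d(2)[of v] v u by auto
          qed
          then show ?thesis using v(3) zero(2) e by (simp add: dist_real_def)
        qed
        then show "\<forall>\<^sub>F u in at_right \<tau>. dist (jump x (Ltilde x u)) (jump x (Ltilde x \<tau>)) < e"
          using d(1) \<tau> by (auto simp: eventually_at_right_field intro!: exI[of _ "min 1 (\<tau> + d)"])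
      qed
    next
      case (pos p)
      obtain d where d: "0 < d" "\<And>s. 0 \<le> s \<Longrightarrow> s \<le> 1 \<Longrightarrow> s \<noteq> \<tau> \<Longrightarrow> \<bar>s - \<tau>\<bar> < d \<Longrightarrow> \<bar>jump x s\<bar> \<le> \<bar>jump x p\<bar> / 2"
        using jump_like_locally_small[OF j, of "\<bar>jump x p\<bar> / 2" \<tau>] pos(4) by auto
      have "Ltilde x u = p" if u: "\<tau> < u" "u < min 1 (\<tau> + d)" for u
      proof -
        have "\<bar>jump x v\<bar> < \<bar>jump x p\<bar>" if "\<tau> < v" "v \<le> u" for v
          using d(2)[of v] that u \<tau> pos(4) by auto
        then show ?thesis using pos u \<tau>
          by (intro Ltilde_eqI) (auto, (metis less_imp_le not_le)+)
      qed
      then have "eventually (\<lambda>u. jump x (Ltilde x \<tau>) = jump x (Ltilde x u)) (at_right \<tau>)"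
        using d(1) \<tau> pos(3) by (auto simp: eventually_at_right_field intro!: exI[of _ "min 1 (\<tau> + d)"])
      from Lim_transform_eventually[OF tendsto_const this] show ?thesis .
    qed
    then show ?thesis unfolding Mtrim_def by (intro tendsto_diff cadlag01_tendsto_right[OF x \<tau>])
  qed
  moreover have "\<exists>l. (Mtrim x \<longlongrightarrow> l) (at_left s)" if s: "0 < s" "s \<le> 1" for s
    by (cases rule: Mtrim_left_limit[OF x s, case_names zero pos]) auto
  ultimately show ?thesis by (auto simp: cadlag01_def)
qed

text \<open>At \<open>s\<close> the new jump competes with the largest earlier one, at
  \<open>p\<close>. The loser is what the trimmed path shows at \<open>s\<close>: the new jump, or
  the old record that is released when the new one takes over. A draw counts as a takeover, since
  \<open>Ltilde\<close> is the latest maximiser.\<close>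

lemma jump_Mtrim:
  assumes x: "cadlag01 x" and s: "0 < s" "s \<le> 1"
  obtains (zero) "jump (Mtrim x) s = 0"
    | (pos) p where "0 < p" "p < s" "\<And>u. 0 \<le> u \<Longrightarrow> u < s \<Longrightarrow> \<bar>jump x u\<bar> \<le> \<bar>jump x p\<bar>" "jump x p \<noteq> 0"
      "jump (Mtrim x) s = (if \<bar>jump x s\<bar> < \<bar>jump x p\<bar> then jump x s else jump x p)"
proof (cases rule: Mtrim_left_limit[OF x s, case_names zero pos])
  case zero': zero
  have "jump x (Ltilde x s) = jump x s"
  proof (cases "jump x s = 0")
    case True
    obtain v where "0 \<le> v" "v \<le> s" "jump x (Ltilde x s) = jump x v"
      using Ltilde_range[OF x less_imp_le[OF s(1)] s(2)] by blast
    then show ?thesis using zero'(1)[of v] True by (cases "v = s") auto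
  next
    case False
    have "\<bar>jump x u\<bar> \<le> \<bar>jump x s\<bar>" if "0 \<le> u" "u \<le> s" for u
      using zero'(1)[of u] that by (cases "u = s") auto
    then have "Ltilde x s = s" using s by (intro Ltilde_eqI) auto
    then show ?thesis by simp
  qed
  then have "jump (Mtrim x) s = 0" using jump_eqI[OF s(1) zero'(2)] by (simp add: Mtrim_def)
  then show ?thesis by (rule zero)
next
  case pos': (pos p)
  have "jump x (Ltilde x s) = (if \<bar>jump x s\<bar> < \<bar>jump x p\<bar> then jump x p else jump x s)"
  proof (cases "\<bar>jump x s\<bar> < \<bar>jump x p\<bar>")
    case True
    have 1: "\<bar>jump x u\<bar> \<le> \<bar>jump x p\<bar>" if "0 \<le> u" "u \<le> s" for u
      using pos'(4)[of u] True that by (cases "u = s") auto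
    have 2: "\<bar>jump x u\<bar> < \<bar>jump x p\<bar>" if "p < u" "u \<le> s" for u
      using pos'(5)[of u] True that by (cases "u = s") auto
    have "Ltilde x s = p" using pos' 1 2 by (intro Ltilde_eqI) auto
    then show ?thesis using True by simp
  next
    case False
    have "\<bar>jump x u\<bar> \<le> \<bar>jump x s\<bar>" if "0 \<le> u" "u \<le> s" for u
      using pos'(4)[of u] False that by (cases "u = s") auto
    then have "Ltilde x s = s" using s by (intro Ltilde_eqI) auto
    then show ?thesis using False by simp
  qed
  then have "jump (Mtrim x) s = (if \<bar>jump x s\<bar> < \<bar>jump x p\<bar> then jump x s else jump x p)"
    using jump_eqI[OF s(1) pos'(6)] by (simp add: Mtrim_def)
  with pos' show ?thesis by (intro pos[of p]) auto
qed

text \<open>A released record reappears at a later time, so jumps are not just deleted. Still no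
  modulus is shown twice: \<open>p'\<close> dominates both \<open>s\<close> and \<open>p\<close>, so
  a jump shown at \<open>s\<close> as the loser is strictly below the one at \<open>p'\<close>, and
  a record released at \<open>s\<close> is no longer the record at \<open>s'\<close>.\<close>

lemma tie_free_Mtrim:
  assumes x: "cadlag01 x" and tf: "tie_free x"
  shows "tie_free (Mtrim x)"
proof -
  have D: "\<bar>jump x u\<bar> \<noteq> \<bar>jump x v\<bar>" if "jump x u \<noteq> 0" "u \<noteq> v" "0 < u" "u \<le> 1" "0 < v" "v \<le> 1" for u v
    using tie_freeD[OF tf, of u v] that by auto
  have *: "jump (Mtrim x) s = 0"
    if s: "0 < s" "s < s'" "s' \<le> 1" and eq: "\<bar>jump (Mtrim x) s\<bar> = \<bar>jump (Mtrim x) s'\<bar>" for s s'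
  proof (rule ccontr)
    assume nz: "jump (Mtrim x) s \<noteq> 0"
    have s01: "s \<le> 1" "0 < s'" using s by auto
    obtain p where p: "0 < p" "p < s" "\<And>u. 0 \<le> u \<Longrightarrow> u < s \<Longrightarrow> \<bar>jump x u\<bar> \<le> \<bar>jump x p\<bar>" "jump x p \<noteq> 0"
      "jump (Mtrim x) s = (if \<bar>jump x s\<bar> < \<bar>jump x p\<bar> then jump x s else jump x p)"
      using jump_Mtrim[OF x s(1) s01(1)] nz by metis
    obtain p' where p': "0 < p'" "p' < s'" "\<And>u. 0 \<le> u \<Longrightarrow> u < s' \<Longrightarrow> \<bar>jump x u\<bar> \<le> \<bar>jump x p'\<bar>" "jump x p' \<noteq> 0"
      "jump (Mtrim x) s' = (if \<bar>jump x s'\<bar> < \<bar>jump x p'\<bar> then jump x s' else jump x p')"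
      using jump_Mtrim[OF x s01(2) s(3)] nz eq by (metis abs_eq_0)
    have le: "\<bar>jump x s\<bar> \<le> \<bar>jump x p'\<bar>" "\<bar>jump x p\<bar> \<le> \<bar>jump x p'\<bar>"
      using p'(3)[of s] p'(3)[of p] s p by auto
    have ne: "\<bar>jump x p\<bar> \<noteq> \<bar>jump x s\<bar>" "\<bar>jump x p\<bar> \<noteq> \<bar>jump x s'\<bar>" "jump x s \<noteq> 0 \<Longrightarrow> \<bar>jump x s\<bar> \<noteq> \<bar>jump x s'\<bar>"
      using D[of p s] D[of p s'] D[of s s'] p s by auto
    show False using eq nz le ne unfolding p(5) p'(5) by (auto split: if_splits)
  qed
  then show ?thesis by (rule tie_freeI)
qed

text \<open>Expresses the removed jump through the two running suprema. When these differ, they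
  determine its sign; the time \<open>Ltilde\<close> matters only when they are equal.\<close>

lemma jump_Ltilde:
  assumes x: "cadlag01 x" and \<tau>: "0 \<le> \<tau>" "\<tau> \<le> 1"
  shows "\<bar>jump x (Ltilde x \<tau>)\<bar> = max (S_plus x \<tau>) (S_minus x \<tau>)"
    and "jump x (Ltilde x \<tau>) = S_plus x \<tau> \<or> jump x (Ltilde x \<tau>) = - S_minus x \<tau>"
proof -
  let ?J = "jump x (Ltilde x \<tau>)"
  have m: "jump (\<lambda>u. - x u) s = - jump x s" if "0 \<le> s" "s \<le> \<tau>" for s
    using cadlag01_minus(2)[OF x] that \<tau> by auto
  note jp = jump_like_jump[OF x] and jm = jump_like_jump[OF cadlag01_minus(1)[OF x]]
  have "\<bar>?J\<bar> = max (S_plus x \<tau>) (S_minus x \<tau>) \<and> (?J = S_plus x \<tau> \<or> ?J = - S_minus x \<tau>)"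
  proof (cases rule: Ltilde_cases[OF x \<tau>, case_names zero pos])
    case zero
    have "S_plus x \<tau> = 0"
      unfolding S_plus_eq_runsup by (rule runsup_eqI[of 0]) (use zero \<tau> in auto)
    moreover have "S_minus x \<tau> = 0"
      unfolding S_plus_eq_runsup S_minus_eq_S_plus by (rule runsup_eqI[of 0]) (use zero \<tau> m in auto)
    ultimately show ?thesis using zero(2) by simp
  next
    case (pos p)
    have le: "S_plus x \<tau> \<le> \<bar>jump x p\<bar>" "S_minus x \<tau> \<le> \<bar>jump x p\<bar>"
      unfolding S_plus_eq_runsup S_minus_eq_S_plus
      by (intro runsup_least[OF jp \<tau>] runsup_least[OF jm \<tau>]; use pos(5) m in force)+
    show ?thesis
    proof (cases "0 < jump x p")
      case True
      have "jump x p \<le> S_plus x \<tau>"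
        unfolding S_plus_eq_runsup using pos \<tau> by (intro runsup_upper[OF jp]) auto
      then show ?thesis using le pos(3) True by auto
    next
      case False
      have "- jump x p \<le> S_minus x \<tau>"
        unfolding S_plus_eq_runsup S_minus_eq_S_plus
        using runsup_upper[OF jm, of p \<tau>] pos(1,2) m[of p] \<tau> by auto
      then show ?thesis using le pos(3) False by auto
    qed
  qed
  then show "\<bar>?J\<bar> = max (S_plus x \<tau>) (S_minus x \<tau>)" "?J = S_plus x \<tau> \<or> ?J = - S_minus x \<tau>" by auto
qed

lemma Mtrim_affine:
  assumes x: "cadlag01 x" and b: "0 < b" and y: "\<And>t. 0 \<le> t \<Longrightarrow> t \<le> 1 \<Longrightarrow> y t = (x t - t * a) / b"
    and \<tau>: "0 \<le> \<tau>" "\<tau> \<le> 1"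
  shows "Mtrim y \<tau> = (Mtrim x \<tau> - \<tau> * a) / b"
proof -
  have cy: "cadlag01 y" by (rule cadlag01_cong(1)[OF cadlag01_affine(1)[OF x] y])
  have jy: "jump y s = jump x s / b" if "0 \<le> s" "s \<le> 1" for s
    using cadlag01_cong(2)[OF cadlag01_affine(1)[OF x] y that] cadlag01_affine(2)[OF x that] by simp
  have "jump y (Ltilde y \<tau>) = jump x (Ltilde x \<tau>) / b"
  proof (cases rule: Ltilde_cases[OF x \<tau>, case_names zero pos])
    case zero
    obtain v where "0 \<le> v" "v \<le> \<tau>" "jump y (Ltilde y \<tau>) = jump y v"
      using Ltilde_range[OF cy \<tau>] by blast
    then show ?thesis using zero(1)[of v] zero(2) jy[of v] \<tau> by simp
  next
    case (pos p)
    have "Ltilde y \<tau> = p"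
      using pos \<tau> b by (intro Ltilde_eqI) (auto simp: jy abs_divide divide_right_mono divide_strict_right_mono)
    then show ?thesis using pos \<tau> jy[of p] by simp
  qed
  then show ?thesis using y[OF \<tau>] by (simp add: Mtrim_def diff_divide_distrib)
qed

lemma finite_real_gap:
  fixes V :: "real set" assumes "finite V"
  obtains g where "0 < g" "\<And>a b. a \<in> V \<Longrightarrow> b \<in> V \<Longrightarrow> a \<noteq> b \<Longrightarrow> g \<le> \<bar>a - b\<bar>"
proof -
  have "finite ((\<lambda>(a, b). a - b) ` (V \<times> V))" using assms by simp
  then obtain g where g: "g > 0" "\<forall>z\<in>(\<lambda>(a, b). a - b) ` (V \<times> V). z \<noteq> 0 \<longrightarrow> g \<le> dist 0 z"
    using finite_set_avoid by blast
  show ?thesis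
  proof (rule that[OF g(1)])
    fix a b assume "a \<in> V" "b \<in> V" "a \<noteq> b"
    then show "g \<le> \<bar>a - b\<bar>" using bspec[OF g(2), of "a - b"] by (force simp: dist_real_def)
  qed
qed

text \<open>The gap is uniform in \<tau>: suprema above \<open>e / 2\<close> take values in the
  finite set \<open>V\<close> of large moduli and differ by tie-freeness; if one is at most
  \<open>e / 2\<close>, the other is at least \<open>e\<close>.\<close>

lemma tie_free_gap:
  assumes x: "cadlag01 x" and tf: "tie_free x" and e: "0 < e"
  obtains g where "0 < g" "\<And>\<tau>. 0 \<le> \<tau> \<Longrightarrow> \<tau> \<le> 1 \<Longrightarrow> e \<le> max (S_plus x \<tau>) (S_minus x \<tau>) \<Longrightarrow>
    g \<le> \<bar>S_plus x \<tau> - S_minus x \<tau>\<bar>"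
proof -
  define V where "V = (\<lambda>s. \<bar>jump x s\<bar>) ` {s\<in>{0..1}. e / 2 < \<bar>jump x s\<bar>}"
  have "finite V" unfolding V_def using finite_big_jumps[OF x, of "e / 2"] e by auto
  then obtain g where g: "0 < g" "\<And>a b. a \<in> V \<Longrightarrow> b \<in> V \<Longrightarrow> a \<noteq> b \<Longrightarrow> g \<le> \<bar>a - b\<bar>"
    using finite_real_gap by blast
  show ?thesis
  proof (rule that[of "min g (e / 2)"])
    fix \<tau> :: real assume \<tau>: "0 \<le> \<tau>" "\<tau> \<le> 1" and m: "e \<le> max (S_plus x \<tau>) (S_minus x \<tau>)"
    show "min g (e / 2) \<le> \<bar>S_plus x \<tau> - S_minus x \<tau>\<bar>"
    proof (cases "e / 2 < S_plus x \<tau> \<and> e / 2 < S_minus x \<tau>")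
      case True
      obtain s where s: "0 \<le> s" "s \<le> \<tau>" "jump x s = S_plus x \<tau>"
        using runsup_attained[OF jump_like_jump[OF x] \<tau>] unfolding S_plus_eq_runsup by metis
      obtain u where u: "0 \<le> u" "u \<le> \<tau>" "- jump x u = S_minus x \<tau>"
        using runsup_attained[OF jump_like_jump[OF cadlag01_minus(1)[OF x]] \<tau>] cadlag01_minus(2)[OF x] \<tau>
        unfolding S_plus_eq_runsup S_minus_eq_S_plus by (metis order_trans)
      have "s \<noteq> u" using s u True e by auto
      then have "S_plus x \<tau> \<noteq> S_minus x \<tau>"
        using tie_freeD[OF tf, of s u] s u \<tau> True e by auto
      moreover have "S_plus x \<tau> \<in> V"
        unfolding V_def by (rule image_eqI[of _ _ s]) (use s \<tau> True e in auto)
      moreover have "S_minus x \<tau> \<in> V"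
        unfolding V_def by (rule image_eqI[of _ _ u]) (use u \<tau> True e in auto)
      ultimately show ?thesis using g(2) by fastforce
    next
      case False
      then show ?thesis using m e by (auto simp: max_def min_def abs_if split: if_splits)
    qed
  qed (use g e in auto)
qed

text \<open>Where the largest modulus is not small, the gap fixes the sign for both paths and the
  removed jumps are matched suprema. Where it is small, the signs may disagree, but both removed
  jumps are small.\<close>

lemma J1_near_Mtrim:
  assumes x: "cadlag01 x" "tie_free x" and e: "0 < e"
  shows "\<exists>d>0. \<forall>y. cadlag01 y \<longrightarrow> J1_near d x y \<longrightarrow> J1_near e (Mtrim x) (Mtrim y)"
proof -
  obtain g where g: "0 < g" "\<And>\<tau>. 0 \<le> \<tau> \<Longrightarrow> \<tau> \<le> 1 \<Longrightarrow> e / 4 \<le> max (S_plus x \<tau>) (S_minus x \<tau>) \<Longrightarrow>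
      g \<le> \<bar>S_plus x \<tau> - S_minus x \<tau>\<bar>"
    using tie_free_gap[OF x, of "e / 4"] e by auto
  \<comment> \<open>\<open>4 * d < g\<close> preserves the order of the two suprema. Below the
    threshold the removed jumps differ by at most
    \<open>e / 4 + (e / 4 + 2 * e / 6) = 5 * e / 6\<close>, which leaves \<open>e / 6\<close> for
    the paths.\<close>
  define d where "d = min (e / 6) (g / 5)"
  show ?thesis
  proof (intro exI[of _ d] conjI allI impI)
    fix y assume y: "cadlag01 y" "J1_near d x y"
    obtain l where l: "l \<in> time_changes"
        "\<And>t. 0 \<le> t \<Longrightarrow> t \<le> 1 \<Longrightarrow> \<bar>l t - t\<bar> \<le> d \<and> \<bar>x t - y (l t)\<bar> \<le> d"
      using y(2) by (auto simp: J1_near_def)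
    have l2: "\<And>t. 0 \<le> t \<Longrightarrow> t \<le> 1 \<Longrightarrow> \<bar>x t - y (l t)\<bar> \<le> d" using l(2) by blast
    have d: "d \<le> e / 6" "d \<le> g / 5" by (auto simp: d_def)
    have "\<bar>l t - t\<bar> \<le> e \<and> \<bar>Mtrim x t - Mtrim y (l t)\<bar> \<le> e" if t: "0 \<le> t" "t \<le> 1" for t
    proof -
      have lt: "0 \<le> l t" "l t \<le> 1" using time_changes_range[OF l(1) t] by auto
      have P: "\<bar>S_plus x t - S_plus y (l t)\<bar> \<le> 2 * d"
        by (rule S_plus_time_change[OF x(1) y(1) l(1) l2 t])
      have N: "\<bar>S_minus x t - S_minus y (l t)\<bar> \<le> 2 * d"
        by (rule S_minus_time_change[OF x(1) y(1) l(1) l2 t])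
      have nn: "0 \<le> S_plus x t" "0 \<le> S_minus x t" "0 \<le> S_plus y (l t)" "0 \<le> S_minus y (l t)"
        unfolding S_minus_eq_S_plus S_plus_eq_runsup using x y t lt
        by (auto intro!: runsup_nonneg jump_like_jump cadlag01_minus(1))
      have "\<bar>jump x (Ltilde x t) - jump y (Ltilde y (l t))\<bar> \<le> 5 * e / 6"
      proof (cases "e / 4 \<le> max (S_plus x t) (S_minus x t)")
        case True
        then have gap: "g \<le> \<bar>S_plus x t - S_minus x t\<bar>" using g(2) t by blast
        show ?thesis
        proof (cases "S_minus x t < S_plus x t")
          case True
          then have "S_minus y (l t) < S_plus y (l t)" using P N d g(1) gap by linarith
          then have "jump x (Ltilde x t) = S_plus x t" "jump y (Ltilde y (l t)) = S_plus y (l t)"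
            using True jump_Ltilde[OF x(1) t] jump_Ltilde[OF y(1) lt] nn by auto
          then show ?thesis using P d e by linarith
        next
          case False
          then have *: "S_plus x t < S_minus x t" using g(1) gap by linarith
          then have "S_plus y (l t) < S_minus y (l t)" using P N d g(1) gap by linarith
          then have "jump x (Ltilde x t) = - S_minus x t" "jump y (Ltilde y (l t)) = - S_minus y (l t)"
            using * jump_Ltilde[OF x(1) t] jump_Ltilde[OF y(1) lt] nn by auto
          then show ?thesis using N d e by linarith
        qed
      next
        case False
        then show ?thesis
          using jump_Ltilde(1)[OF x(1) t] jump_Ltilde(1)[OF y(1) lt] P N nn d e
          by linarith
      qed
      moreover have "\<bar>l t - t\<bar> \<le> d" "\<bar>x t - y (l t)\<bar> \<le> d" using l(2)[OF t] by auto
      ultimately show ?thesis using d e unfolding Mtrim_def by linarith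
    qed
    then show "J1_near e (Mtrim x) (Mtrim y)" unfolding J1_near_def by (intro bexI[OF _ l(1)]) auto
  qed (use e g in \<open>auto simp: d_def\<close>)
qed

section \<open>Measurability on path space\<close>

definition J1_cont_at :: "((real \<Rightarrow> real) \<Rightarrow> real) \<Rightarrow> (real \<Rightarrow> real) \<Rightarrow> bool" where
  "J1_cont_at G x \<longleftrightarrow> (\<forall>e>0. \<exists>d>0. \<forall>y. cadlag01 y \<longrightarrow> J1_near d x y \<longrightarrow> \<bar>G y - G x\<bar> < e)"

lemma J1_cont_at_iff_dist:
  assumes x: "cadlag01 x"
  shows "J1_cont_at G x \<longleftrightarrow> (\<forall>e>0. \<exists>d>0. \<forall>y. cadlag01 y \<longrightarrow> dist_J1 x y < d \<longrightarrow> \<bar>G y - G x\<bar> < e)"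
proof (intro iffI allI impI)
  fix e :: real assume G: "J1_cont_at G x" and e: "0 < e"
  then obtain d where "d > 0" "\<And>y. cadlag01 y \<Longrightarrow> J1_near d x y \<Longrightarrow> \<bar>G y - G x\<bar> < e"
    by (auto simp: J1_cont_at_def)
  then show "\<exists>d>0. \<forall>y. cadlag01 y \<longrightarrow> dist_J1 x y < d \<longrightarrow> \<bar>G y - G x\<bar> < e"
    using J1_near_of_dist_J1_less[OF x] by blast
next
  assume *: "\<forall>e>0. \<exists>d>0. \<forall>y. cadlag01 y \<longrightarrow> dist_J1 x y < d \<longrightarrow> \<bar>G y - G x\<bar> < e"
  show "J1_cont_at G x" unfolding J1_cont_at_def
  proof (intro allI impI)
    fix e :: real assume "0 < e"
    then obtain d where d: "d > 0" "\<And>y. cadlag01 y \<Longrightarrow> dist_J1 x y < d \<Longrightarrow> \<bar>G y - G x\<bar> < e"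
      using * by blast
    show "\<exists>d>0. \<forall>y. cadlag01 y \<longrightarrow> J1_near d x y \<longrightarrow> \<bar>G y - G x\<bar> < e"
    proof (intro exI[of _ "d / 2"] conjI allI impI)
      fix y assume "cadlag01 y" "J1_near (d / 2) x y"
      then show "\<bar>G y - G x\<bar> < e" using d(1) dist_J1_le_of_J1_near[of "d / 2" x y] by (intro d(2)) auto
    qed (use d in auto)
  qed
qed

section \<open>Grid approximation of paths\<close>

definition step_path :: "nat \<Rightarrow> (nat \<Rightarrow> real) \<Rightarrow> real \<Rightarrow> real" where
  "step_path n v t = v (nat \<lfloor>real n * t\<rfloor>)"

lemma cadlag01_step_path:
  assumes n: "0 < n"
  shows "cadlag01 (step_path n v)"
proof -
  have R: "(step_path n v \<longlongrightarrow> step_path n v t) (at_right t)" for t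
  proof (rule Lim_transform_eventually[OF tendsto_const])
    have fl: "real n * t < real_of_int \<lfloor>real n * t\<rfloor> + 1" "real_of_int \<lfloor>real n * t\<rfloor> \<le> real n * t" by linarith+
    have "step_path n v t = step_path n v u" if u: "t < u" "u < (real_of_int \<lfloor>real n * t\<rfloor> + 1) / real n" for u
    proof -
      have "\<lfloor>real n * u\<rfloor> = \<lfloor>real n * t\<rfloor>"
      proof (rule floor_unique)
        have "real n * t < real n * u" using u n by simp
        then show "real_of_int \<lfloor>real n * t\<rfloor> \<le> real n * u" using fl by linarith
        show "real n * u < real_of_int \<lfloor>real n * t\<rfloor> + 1" using u n by (simp add: field_simps)
      qed
      then show ?thesis by (simp add: step_path_def)
    qed
    moreover have "t < (real_of_int \<lfloor>real n * t\<rfloor> + 1) / real n" using fl n by (simp add: field_simps)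
    ultimately show "\<forall>\<^sub>F u in at_right t. step_path n v t = step_path n v u"
      unfolding eventually_at_right_field by blast
  qed
  have L: "\<exists>l. (step_path n v \<longlongrightarrow> l) (at_left t)" for t
  proof -
    have cl: "real_of_int \<lceil>real n * t\<rceil> - 1 < real n * t" "real n * t \<le> real_of_int \<lceil>real n * t\<rceil>" by linarith+
    have "v (nat (\<lceil>real n * t\<rceil> - 1)) = step_path n v u" if u: "(real_of_int \<lceil>real n * t\<rceil> - 1) / real n < u" "u < t" for u
    proof -
      have "\<lfloor>real n * u\<rfloor> = \<lceil>real n * t\<rceil> - 1"
      proof (rule floor_unique)
        have "real n * u < real n * t" using u n by simp
        then show "real n * u < real_of_int (\<lceil>real n * t\<rceil> - 1) + 1" using cl by linarith
        show "real_of_int (\<lceil>real n * t\<rceil> - 1) \<le> real n * u" using u n by (simp add: field_simps)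
      qed
      then show ?thesis by (simp add: step_path_def)
    qed
    moreover have "(real_of_int \<lceil>real n * t\<rceil> - 1) / real n < t" using cl n by (simp add: field_simps)
    ultimately have "\<forall>\<^sub>F u in at_left t. v (nat (\<lceil>real n * t\<rceil> - 1)) = step_path n v u"
      unfolding eventually_at_left_field by blast
    from Lim_transform_eventually[OF tendsto_const this] show ?thesis by blast
  qed
  show ?thesis using R L by (auto simp: cadlag01_def)
qed

text \<open>The time change moves each partition point to the next grid point by adding small tent functions.\<close>

lemma J1_near_step_path:
  assumes x: "cadlag01 x" and e: "0 < e"
  shows "\<forall>\<^sub>F n in sequentially. J1_near e (step_path n (\<lambda>k. x (min 1 (real k / real n)))) x"
proof -
  obtain P where P: "finite P" "P \<subseteq> {0..1}" "0 \<in> P" "1 \<in> P"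
    "\<And>u v. 0 \<le> u \<Longrightarrow> u \<le> v \<Longrightarrow> v \<le> 1 \<Longrightarrow> P \<inter> {u<..v} = {} \<Longrightarrow> \<bar>x u - x v\<bar> < e"
    using cadlag01_partition[OF x e] by metis
  obtain g0 where g0: "0 < g0" "\<And>a b. a \<in> P \<Longrightarrow> b \<in> P \<Longrightarrow> a \<noteq> b \<Longrightarrow> g0 \<le> \<bar>a - b\<bar>"
    using finite_real_gap[OF P(1)] by blast
  \<comment> \<open>Distinct points of \<open>P\<close> are at least \<open>2 * g\<close> apart, so
    tents of radius \<open>g\<close> still vanish at the other centres after each centre has moved
    up by less than \<open>g\<close>.\<close>
  define g where "g = g0 / 2"
  have g: "0 < g" using g0 by (simp add: g_def)
  define hat :: "real \<Rightarrow> real" where "hat z = max 0 (1 - \<bar>z\<bar>)" for z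
  have hat: "0 \<le> hat z" "hat z \<le> 1" "hat 0 = 1" "1 \<le> \<bar>z\<bar> \<Longrightarrow> hat z = 0" "\<bar>hat z - hat w\<bar> \<le> \<bar>z - w\<bar>" for z w
    by (auto simp: hat_def max_def abs_if)
  have lim: "(\<lambda>n. 1 / real n) \<longlonglongrightarrow> 0" by (rule lim_1_over_n)
  have "(\<lambda>n. real (card P) * (1 / real n)) \<longlonglongrightarrow> real (card P) * 0"
    by (intro tendsto_mult tendsto_const lim)
  then have lim2: "(\<lambda>n. real (card P) * (1 / real n)) \<longlonglongrightarrow> 0" by simp
  have "\<forall>\<^sub>F n in sequentially. 1 / real n < g \<and> real (card P) * (1 / real n) < e \<and>
      real (card P) * (1 / real n) < g \<and> 0 < n"
    using order_tendstoD(2)[OF lim g] order_tendstoD(2)[OF lim2 e] order_tendstoD(2)[OF lim2 g]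
    by (intro eventually_conj) (auto simp: eventually_sequentially intro: exI[of _ 1])
  then show ?thesis
  proof eventually_elim
    case (elim n)
    then have n: "0 < n" by simp
    \<comment> \<open>The step path reads \<open>x\<close> at the grid point below \<open>t\<close>,
      so it notices \<open>p\<close> only from the next grid point on: rounding is upwards.\<close>
    define s where "s p = real_of_int \<lceil>real n * p\<rceil> / real n" for p
    have s: "p \<le> s p" "s p - p \<le> 1 / real n" for p
    proof -
      have "real n * p \<le> real_of_int \<lceil>real n * p\<rceil>" "real_of_int \<lceil>real n * p\<rceil> < real n * p + 1" by linarith+
      moreover have "s p - p = (real_of_int \<lceil>real n * p\<rceil> - real n * p) / real n"
        using n by (simp add: s_def diff_divide_distrib)
      ultimately show "p \<le> s p" "s p - p \<le> 1 / real n"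
        using n divide_right_mono[of "real_of_int \<lceil>real n * p\<rceil> - real n * p" 1 "real n"]
        by (auto simp: s_def field_simps)
    qed
    \<comment> \<open>The step path is the first argument, so \<open>l\<close> carries the grid
      point \<open>s p\<close> back to \<open>p\<close>.\<close>
    define l where "l t = t - (\<Sum>p\<in>P. (s p - p) * hat ((t - s p) / g))" for t
    have l_s: "l (s q) = q" if q: "q \<in> P" for q
    proof -
      have Z: "(s p - p) * hat ((s q - s p) / g) = 0" if p: "p \<in> P - {q}" for p
      proof -
        have "2 * g \<le> \<bar>q - p\<bar>" using g0(2)[of q p] p q by (auto simp: g_def)
        then have "g \<le> \<bar>s q - s p\<bar>" using s[of p] s[of q] elim by linarith
        then have "1 \<le> \<bar>(s q - s p) / g\<bar>" using g by (simp add: abs_divide)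
        then show ?thesis using hat(4) by simp
      qed
      then have "(\<Sum>p\<in>P. (s p - p) * hat ((s q - s p) / g)) = s q - q"
        using sum.remove[OF P(1) q, of "\<lambda>p. (s p - p) * hat ((s q - s p) / g)"] hat(3)
          sum.neutral[of "P - {q}" "\<lambda>p. (s p - p) * hat ((s q - s p) / g)"] Z by auto
      then show ?thesis by (simp add: l_def)
    qed
    have s01: "s 0 = 0" "s 1 = 1" using n by (auto simp: s_def)
    have l01: "l 0 = 0" "l 1 = 1" using l_s[OF P(3)] l_s[OF P(4)] s01 by auto
    have mono: "l t < l u" if "t < u" for t u
    proof -
      \<comment> \<open>The tents together have Lipschitz constant at most
        \<open>card P / (n * g)\<close>, which is below \<open>1\<close>; subtracting them keeps
        \<open>l\<close> strictly increasing.\<close>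
      have "\<bar>(\<Sum>p\<in>P. (s p - p) * hat ((u - s p) / g)) - (\<Sum>p\<in>P. (s p - p) * hat ((t - s p) / g))\<bar>
        \<le> (\<Sum>p\<in>P. 1 / real n * ((u - t) / g))"
        unfolding sum_subtractf[symmetric]
      proof (rule order_trans[OF sum_abs sum_mono])
        fix p assume "p \<in> P"
        have "\<bar>hat ((u - s p) / g) - hat ((t - s p) / g)\<bar> \<le> (u - t) / g"
          using hat(5)[of "(u - s p) / g" "(t - s p) / g"] that g by (simp add: diff_divide_distrib[symmetric] abs_divide)
        moreover have "\<bar>s p - p\<bar> \<le> 1 / real n" using s[of p] by auto
        ultimately have "\<bar>s p - p\<bar> * \<bar>hat ((u - s p) / g) - hat ((t - s p) / g)\<bar> \<le> 1 / real n * ((u - t) / g)"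
          by (intro mult_mono) auto
        then show "\<bar>(s p - p) * hat ((u - s p) / g) - (s p - p) * hat ((t - s p) / g)\<bar> \<le> 1 / real n * ((u - t) / g)"
          by (simp add: right_diff_distrib[symmetric] abs_mult)
      qed
      also have "\<dots> = real (card P) * (1 / real n) * ((u - t) / g)" by simp
      also have "\<dots> < g * ((u - t) / g)" using elim that g by (intro mult_strict_right_mono) auto
      also have "\<dots> = u - t" using g by simp
      finally show ?thesis by (auto simp: l_def)
    qed
    have near: "\<bar>l t - t\<bar> \<le> e" for t
    proof -
      have "\<bar>\<Sum>p\<in>P. (s p - p) * hat ((t - s p) / g)\<bar> \<le> (\<Sum>p\<in>P. 1 / real n * 1)"
      proof (rule order_trans[OF sum_abs sum_mono])
        fix p
        show "\<bar>(s p - p) * hat ((t - s p) / g)\<bar> \<le> 1 / real n * 1"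
          unfolding abs_mult using s[of p] hat(1,2) by (intro mult_mono) auto
      qed
      then show ?thesis using elim by (simp add: l_def)
    qed
    have "continuous_on {0..1} l"
      unfolding l_def hat_def using g by (intro continuous_intros) auto
    then have l: "l \<in> time_changes" using l01 mono by (auto simp: time_changes_def strict_mono_on_def)
    have "\<bar>step_path n (\<lambda>k. x (min 1 (real k / real n))) t - x (l t)\<bar> \<le> e" if t: "0 \<le> t" "t \<le> 1" for t
    proof -
      define u where "u = real_of_int \<lfloor>real n * t\<rfloor> / real n"
      have fl: "0 \<le> \<lfloor>real n * t\<rfloor>" using t by simp
      have "real_of_int \<lfloor>real n * t\<rfloor> \<le> real n * t" by linarith
      then have u_le: "u \<le> t" using n by (simp add: u_def field_simps)
      have u: "0 \<le> u" "u \<le> 1" using fl u_le t by (auto simp: u_def)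
      have step: "step_path n (\<lambda>k. x (min 1 (real k / real n))) t = x u"
        using u fl by (simp add: step_path_def u_def min_def)
      have lt: "0 \<le> l t" "l t \<le> 1" using time_changes_range[OF l t] by auto
      \<comment> \<open>\<open>u\<close> and \<open>l t\<close> have the same points of
        \<open>P\<close> below them, so no partition point separates them and \<open>P(5)\<close>
        applies.\<close>
      have iff: "p \<le> u \<longleftrightarrow> p \<le> l t" if p: "p \<in> P" for p
      proof -
        have "p \<le> u \<longleftrightarrow> real n * p \<le> real_of_int \<lfloor>real n * t\<rfloor>" using n by (simp add: u_def field_simps)
        also have "\<dots> \<longleftrightarrow> \<lceil>real n * p\<rceil> \<le> \<lfloor>real n * t\<rfloor>" by (simp add: ceiling_le_iff)
        also have "\<dots> \<longleftrightarrow> real_of_int \<lceil>real n * p\<rceil> \<le> real n * t" by (simp add: le_floor_iff)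
        also have "\<dots> \<longleftrightarrow> s p \<le> t" using n by (simp add: s_def field_simps)
        also have "\<dots> \<longleftrightarrow> l (s p) \<le> l t" using mono[of "s p" t] mono[of t "s p"] by (cases "s p" t rule: linorder_cases) auto
        finally show ?thesis using l_s[OF p] by simp
      qed
      have "\<bar>x u - x (l t)\<bar> < e"
      proof (cases "u \<le> l t")
        case True
        then show ?thesis using iff u lt by (intro P(5)) (auto simp: not_le[symmetric])
      next
        case False
        then have "\<bar>x (l t) - x u\<bar> < e" using iff u lt by (intro P(5)) (auto simp: not_le[symmetric])
        then show ?thesis by (simp add: abs_minus_commute)
      qed
      then show ?thesis using step by simp
    qed
    then show ?case unfolding J1_near_def using near by (intro bexI[OF _ l]) auto
  qed
qed

text \<open>Generated by the coordinates on cadlag paths rather than by \<open>J1\<close>-open sets,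
  so that a process with cadlag paths is measurable as soon as its coordinates are.\<close>

definition path_space :: "(real \<Rightarrow> real) measure" where
  "path_space = sigma {x. cadlag01 x} {{x. cadlag01 x \<and> x t \<in> B} | t B. t \<in> {0..1} \<and> B \<in> sets borel}"

lemma space_path_space: "space path_space = {x. cadlag01 x}"
  unfolding path_space_def by (rule space_measure_of) auto

lemma measurable_path_spaceI:
  assumes c: "\<And>\<omega>. \<omega> \<in> space M \<Longrightarrow> cadlag01 (Z \<omega>)"
    and m: "\<And>t. 0 \<le> t \<Longrightarrow> t \<le> 1 \<Longrightarrow> (\<lambda>\<omega>. Z \<omega> t) \<in> borel_measurable M"
  shows "Z \<in> measurable M path_space"
  unfolding path_space_def
proof (rule measurable_measure_of)
  fix A assume "A \<in> {{x. cadlag01 x \<and> x t \<in> B} | t B. t \<in> {0..1} \<and> B \<in> sets (borel :: real measure)}"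
  then obtain t B where A: "A = {x. cadlag01 x \<and> x t \<in> B}" "0 \<le> t" "t \<le> 1" "B \<in> sets borel" by auto
  have "Z -` A \<inter> space M = (\<lambda>\<omega>. Z \<omega> t) -` B \<inter> space M" using c by (auto simp: A(1))
  then show "Z -` A \<inter> space M \<in> sets M" using measurable_sets[OF m[OF A(2,3)] A(4)] by simp
qed (use c in auto)

lemma measurable_path_coord:
  assumes t: "0 \<le> t" "t \<le> 1"
  shows "(\<lambda>x. x t) \<in> borel_measurable path_space"
proof (rule measurableI)
  fix B :: "real set" assume B: "B \<in> sets borel"
  have "{x. cadlag01 x \<and> x t \<in> B} \<in> sets path_space"
    unfolding path_space_def
    by (subst sets_measure_of) (use t B in \<open>auto intro!: sigma_sets.Basic\<close>)
  moreover have "(\<lambda>x. x t) -` B \<inter> space path_space = {x. cadlag01 x \<and> x t \<in> B}"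
    by (auto simp: space_path_space)
  ultimately show "(\<lambda>x. x t) -` B \<inter> space path_space \<in> sets path_space" by simp
qed auto

text \<open>\<open>G x\<close> is the limit of \<open>G\<close> along the step paths of
  \<open>x\<close>. Each of these values depends continuously on the sampled values of
  \<open>x\<close>, so \<open>G\<close> is a limit of functions measurable in the
  coordinates.\<close>

lemma J1_cont_borel_measurable:
  assumes G: "\<And>x. cadlag01 x \<Longrightarrow> J1_cont_at G x"
  shows "G \<in> borel_measurable path_space"
proof (rule borel_measurable_LIMSEQ_real)
  \<comment> \<open>The cap at \<open>1\<close> makes every entry of the infinite sequence a
    coordinate on \<open>[0,1]\<close>.\<close>
  let ?v = "\<lambda>n x k. x (min 1 (real k / real (Suc n))) :: real"
  show "(\<lambda>n. G (step_path (Suc n) (?v n x))) \<longlonglongrightarrow> G x" if "x \<in> space path_space" for x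
  proof (rule tendstoI)
    fix e :: real assume e: "0 < e"
    have x: "cadlag01 x" using that by (simp add: space_path_space)
    obtain d where d: "d > 0" "\<And>y. cadlag01 y \<Longrightarrow> J1_near d x y \<Longrightarrow> \<bar>G y - G x\<bar> < e"
      using G[OF x] e by (auto simp: J1_cont_at_def)
    have "\<forall>\<^sub>F n in sequentially. J1_near d (step_path (Suc n) (?v n x)) x"
      using J1_near_step_path[OF x d(1)] by (rule sequentially_offset[where k = 1, unfolded Suc_eq_plus1[symmetric]])
    then show "\<forall>\<^sub>F n in sequentially. dist (G (step_path (Suc n) (?v n x))) (G x) < e"
      by eventually_elim (auto simp: dist_real_def intro!: d(2) cadlag01_step_path J1_near_sym)
  qed
  show "(\<lambda>x. G (step_path (Suc n) (?v n x))) \<in> borel_measurable path_space" for n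
  proof (rule measurable_compose[where g = "\<lambda>v. G (step_path (Suc n) v)" and N = borel])
    show "?v n \<in> measurable path_space borel"
      by (rule measurable_coordinatewise_then_product) (auto intro!: measurable_path_coord)
    show "(\<lambda>v. G (step_path (Suc n) v)) \<in> borel_measurable borel"
    proof (rule borel_measurable_continuous_onI)
      show "continuous_on UNIV (\<lambda>v. G (step_path (Suc n) v))"
        unfolding continuous_on_def
      proof (intro ballI tendstoI)
        fix v :: "nat \<Rightarrow> real" and e :: real assume e: "0 < e"
        obtain d where d: "d > 0" "\<And>y. cadlag01 y \<Longrightarrow> J1_near d (step_path (Suc n) v) y \<Longrightarrow> \<bar>G y - G (step_path (Suc n) v)\<bar> < e"
          using G[OF cadlag01_step_path[of "Suc n" v]] e by (auto simp: J1_cont_at_def)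
        have "\<forall>\<^sub>F w in at v. dist (w k) (v k) < d" for k
        proof -
          have "((\<lambda>w. w k) \<longlongrightarrow> v k) (at v)"
            using continuous_on_product_coordinates[of k] by (auto simp: continuous_on_def)
          then show ?thesis using d(1) by (rule tendstoD)
        qed
        \<comment> \<open>Finitely many coordinates suffice; \<open>Suc n\<close> is among them
          because time \<open>1\<close> reads that entry.\<close>
        then have "\<forall>\<^sub>F w in at v. \<forall>k\<in>{..Suc n}. dist (w k) (v k) < d"
          by (intro eventually_ball_finite) auto
        then show "\<forall>\<^sub>F w in at v within UNIV. dist (G (step_path (Suc n) w)) (G (step_path (Suc n) v)) < e"
        proof eventually_elim
          case (elim w)
          have "J1_near d (step_path (Suc n) v) (step_path (Suc n) w)"
          proof (rule J1_near_uniform)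
            fix t :: real assume t: "0 \<le> t" "t \<le> 1"
            have "real (Suc n) * t \<le> real (Suc n)" using t by (intro mult_left_le) auto
            then have "\<lfloor>real (Suc n) * t\<rfloor> \<le> int (Suc n)" by linarith
            then have "nat \<lfloor>real (Suc n) * t\<rfloor> \<in> {..Suc n}" by auto
            from bspec[OF elim this] show "\<bar>step_path (Suc n) v t - step_path (Suc n) w t\<bar> \<le> d"
              by (simp add: step_path_def dist_real_def abs_minus_commute)
          qed (use d in auto)
          then show ?case using d(2) cadlag01_step_path[of "Suc n" w] by (auto simp: dist_real_def)
        qed
      qed
    qed
  qed
qed

text \<open>Freezing the path outside \<open>(q,\<tau>]\<close> erases all other jumps. The supremum
  over a window thus becomes a supremum up to time \<open>1\<close>, to which
  \<open>measurable_S_plus_1\<close> applies.\<close>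

lemma cadlag01_clamp:
  assumes x: "cadlag01 x" and q: "0 \<le> q" "q \<le> \<tau>" "\<tau> \<le> 1"
  shows "cadlag01 (\<lambda>u. x (max q (min \<tau> u)))"
    and "0 \<le> s \<Longrightarrow> s \<le> 1 \<Longrightarrow> jump (\<lambda>u. x (max q (min \<tau> u))) s = (if q < s \<and> s \<le> \<tau> then jump x s else 0)"
proof -
  let ?y = "\<lambda>u. x (max q (min \<tau> u))"
  have L: "(?y \<longlongrightarrow> ?y s - (if q < s \<and> s \<le> \<tau> then jump x s else 0)) (at_left s)" if s: "0 < s" "s \<le> 1" for s
  proof (cases "q < s \<and> s \<le> \<tau>")
    case True
    then have "\<forall>\<^sub>F u in at_left s. x u = ?y u"
      unfolding eventually_at_left_field by (intro exI[of _ q]) (auto simp: max_def min_def)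
    from Lim_transform_eventually[OF cadlag01_tendsto_left[OF x s] this] show ?thesis
      using True by (auto simp: max_def min_def)
  next
    case False
    have eq: "max q (min \<tau> u) = max q (min \<tau> s)" if "(if s \<le> q then s - 1 else \<tau>) < u" "u < s" for u
      using that False q by (auto simp: max_def min_def split: if_splits)
    have "\<forall>\<^sub>F u in at_left s. (if s \<le> q then s - 1 else \<tau>) < u \<and> u < s"
      unfolding eventually_at_left_field using False
      by (intro exI[of _ "if s \<le> q then s - 1 else \<tau>"]) auto
    then have "\<forall>\<^sub>F u in at_left s. ?y s = ?y u" by eventually_elim (simp only: eq)
    from Lim_transform_eventually[OF tendsto_const this] show ?thesis using False by auto
  qed
  have R: "(?y \<longlongrightarrow> ?y s) (at_right s)" if s: "0 \<le> s" "s < 1" for s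
  proof (cases "q \<le> s \<and> s < \<tau>")
    case True
    then have "\<forall>\<^sub>F u in at_right s. x u = ?y u"
      unfolding eventually_at_right_field by (intro exI[of _ \<tau>]) (auto simp: max_def min_def)
    from Lim_transform_eventually[OF cadlag01_tendsto_right[OF x s] this] show ?thesis
      using True by (auto simp: max_def min_def)
  next
    case False
    have eq: "max q (min \<tau> u) = max q (min \<tau> s)" if "s < u" "u < (if s < q then q else s + 1)" for u
      using that False q by (auto simp: max_def min_def split: if_splits)
    have "\<forall>\<^sub>F u in at_right s. s < u \<and> u < (if s < q then q else s + 1)"
      unfolding eventually_at_right_field by (intro exI[of _ "if s < q then q else s + 1"]) auto
    then have "\<forall>\<^sub>F u in at_right s. ?y s = ?y u" by eventually_elim (simp only: eq)
    from Lim_transform_eventually[OF tendsto_const this] show ?thesis .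
  qed
  have "\<exists>l. (?y \<longlongrightarrow> l) (at_left s)" if "0 < s" "s \<le> 1" for s using L[OF that] ..
  then show "cadlag01 ?y" using R by (simp add: cadlag01_def)
  show "jump ?y s = (if q < s \<and> s \<le> \<tau> then jump x s else 0)" if "0 \<le> s" "s \<le> 1"
  proof (cases "s = 0")
    case False
    then show ?thesis using jump_eqI[OF _ L[of s], of] that by simp
  qed (use q in auto)
qed

text \<open>Time changes fix \<open>1\<close>, so the supremum up to the end of the interval is
  \<open>J1\<close>-continuous, hence measurable. Up to an earlier \<tau>, continuity can fail when
  a jump sits at \<tau>.\<close>

lemma measurable_S_plus_1: "(\<lambda>x. S_plus x 1) \<in> borel_measurable path_space"
proof (rule J1_cont_borel_measurable)
  fix x assume x: "cadlag01 x"
  show "J1_cont_at (\<lambda>x. S_plus x 1) x" unfolding J1_cont_at_def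
  proof (intro allI impI)
    fix e :: real assume e: "0 < e"
    show "\<exists>d>0. \<forall>y. cadlag01 y \<longrightarrow> J1_near d x y \<longrightarrow> \<bar>S_plus y 1 - S_plus x 1\<bar> < e"
    proof (intro exI[of _ "e / 3"] conjI allI impI)
      fix y assume y: "cadlag01 y" "J1_near (e / 3) x y"
      obtain l where l: "l \<in> time_changes" "\<And>t. 0 \<le> t \<Longrightarrow> t \<le> 1 \<Longrightarrow> \<bar>l t - t\<bar> \<le> e / 3 \<and> \<bar>x t - y (l t)\<bar> \<le> e / 3"
        using y(2) by (auto simp: J1_near_def)
      have "l 1 = 1" using l(1) by (simp add: time_changes_def)
      moreover have "\<bar>S_plus x 1 - S_plus y (l 1)\<bar> \<le> 2 * (e / 3)"
        using l(2) by (intro S_plus_time_change[OF x y(1) l(1)]) auto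
      ultimately show "\<bar>S_plus y 1 - S_plus x 1\<bar> < e" using e by (simp add: abs_minus_commute)
    qed (use e in auto)
  qed
qed

lemma measurable_clamp:
  assumes q: "0 \<le> q" "q \<le> \<tau>" "\<tau> \<le> 1"
  shows "(\<lambda>x u. x (max q (min \<tau> u))) \<in> measurable path_space path_space"
  using q by (intro measurable_path_spaceI cadlag01_clamp(1) measurable_path_coord) (auto simp: space_path_space)

lemma measurable_minus_path: "(\<lambda>x u. - x u) \<in> measurable path_space path_space"
  by (intro measurable_path_spaceI cadlag01_minus(1) borel_measurable_uminus measurable_path_coord) (auto simp: space_path_space)

lemma measurable_S_plus:
  assumes \<tau>: "0 \<le> \<tau>" "\<tau> \<le> 1"
  shows "(\<lambda>x. S_plus x \<tau>) \<in> borel_measurable path_space"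
proof -
  have "(\<lambda>x. S_plus (\<lambda>u. x (max 0 (min \<tau> u))) 1) \<in> borel_measurable path_space"
    using measurable_compose[OF measurable_clamp measurable_S_plus_1, of 0 \<tau>] \<tau> by simp
  moreover have "S_plus (\<lambda>u. x (max 0 (min \<tau> u))) 1 = S_plus x \<tau>" if "x \<in> space path_space" for x
  proof -
    have x: "cadlag01 x" using that by (simp add: space_path_space)
    obtain s where s: "0 \<le> s" "s \<le> \<tau>" "jump x s = S_plus x \<tau>" "\<And>u. 0 \<le> u \<Longrightarrow> u \<le> \<tau> \<Longrightarrow> jump x u \<le> jump x s"
      using runsup_attained[OF jump_like_jump[OF x] \<tau>] unfolding S_plus_eq_runsup by metis
    \<comment> \<open>The clamped path has zero jumps after \<tau>; they do not raise a nonnegative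
      supremum.\<close>
    have "0 \<le> S_plus x \<tau>" unfolding S_plus_eq_runsup by (intro runsup_nonneg jump_like_jump x \<tau>)
    then show ?thesis
      unfolding S_plus_eq_runsup[of "\<lambda>u. x (max 0 (min \<tau> u))"]
      by (intro runsup_eqI[of s]) (use s \<tau> cadlag01_clamp(2)[OF x, of 0 \<tau>] in \<open>auto\<close>)
  qed
  ultimately show ?thesis by (simp cong: measurable_cong)
qed

lemma measurable_S_minus:
  assumes \<tau>: "0 \<le> \<tau>" "\<tau> \<le> 1"
  shows "(\<lambda>x. S_minus x \<tau>) \<in> borel_measurable path_space"
  unfolding S_minus_eq_S_plus
  using measurable_compose[OF measurable_minus_path measurable_S_plus[OF \<tau>]] by simp

lemma measurable_Trim_plus: "Trim_plus \<in> measurable path_space path_space"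
  unfolding Trim_plus_def
  by (intro measurable_path_spaceI borel_measurable_diff measurable_S_plus measurable_path_coord)
    (auto simp: space_path_space intro!: cadlag01_S_plus)

lemma measurable_Trim_minus: "Trim_minus \<in> measurable path_space path_space"
proof (rule measurable_path_spaceI)
  show "(\<lambda>x. Trim_minus x t) \<in> borel_measurable path_space" if "0 \<le> t" "t \<le> 1" for t
    unfolding Trim_minus_def using that by (intro borel_measurable_add measurable_S_minus measurable_path_coord)
qed (auto simp: space_path_space intro!: cadlag01_Trim_minus)

lemma measurable_Rtrim: "Rtrim \<in> measurable path_space path_space"
proof (rule measurable_path_spaceI)
  fix t :: real assume t: "0 \<le> t" "t \<le> 1"
  note [measurable] = measurable_S_plus[OF t] measurable_S_plus_1 measurable_path_coord[OF t]
  have "(\<lambda>x. x t - (if S_plus x t = S_plus x 1 then S_plus x 1 else 0)) \<in> borel_measurable path_space"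
    by measurable
  then show "(\<lambda>x. Rtrim x t) \<in> borel_measurable path_space"
    by (subst measurable_cong[OF Rtrim_eq[OF _ t]]) (auto simp: space_path_space)
qed (auto simp: space_path_space intro!: jump_Rtrim(1))

text \<open>When the largest upward and downward jumps on \<open>[0, \<tau>]\<close> tie, the sign of the latest of
  them is detected by some rational \<open>q\<close>: on \<open>(q, \<tau>]\<close> only the upward ones remain.\<close>

lemma jump_Ltilde_rational:
  assumes x: "cadlag01 x" and \<tau>: "0 \<le> \<tau>" "\<tau> \<le> 1"
  defines "m \<equiv> max (S_plus x \<tau>) (S_minus x \<tau>)"
  shows "jump x (Ltilde x \<tau>) = (if \<exists>q::rat. 0 \<le> real_of_rat q \<and> real_of_rat q \<le> \<tau> \<and>
      S_plus (\<lambda>u. x (max (real_of_rat q) (min \<tau> u))) 1 = m \<and>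
      S_minus (\<lambda>u. x (max (real_of_rat q) (min \<tau> u))) 1 < m then m else - m)"
    (is "_ = (if \<exists>q. ?C q then m else - m)")
proof (cases rule: Ltilde_cases[OF x \<tau>, case_names zero pos])
  case zero
  then have "m = 0" using jump_Ltilde(1)[OF x \<tau>] by (simp add: m_def)
  then show ?thesis using zero by simp
next
  case (pos p)
  have m: "\<bar>jump x p\<bar> = m" "0 < m" using jump_Ltilde(1)[OF x \<tau>] pos(3,4) by (auto simp: m_def)
  have P: "\<exists>s. 0 \<le> s \<and> s \<le> 1 \<and> S_plus (\<lambda>u. x (max q (min \<tau> u))) 1 = (if q < s \<and> s \<le> \<tau> then jump x s else 0)"
    if q: "0 \<le> q" "q \<le> \<tau>" for q
    using runsup_attained[OF jump_like_jump[OF cadlag01_clamp(1)[OF x q \<tau>(2)]], of 1]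
      cadlag01_clamp(2)[OF x q \<tau>(2)] unfolding S_plus_eq_runsup by (metis order_refl zero_le_one)
  have Nj: "jump (\<lambda>u. - x (max q (min \<tau> u))) s = (if q < s \<and> s \<le> \<tau> then - jump x s else 0)"
    if q: "0 \<le> q" "q \<le> \<tau>" and s: "0 \<le> s" "s \<le> 1" for q s
    using cadlag01_minus(2)[OF cadlag01_clamp(1)[OF x q \<tau>(2)] s] cadlag01_clamp(2)[OF x q \<tau>(2) s] by simp
  note jm = jump_like_jump[OF cadlag01_minus(1)[OF cadlag01_clamp(1)[OF x _ _ \<tau>(2)]]]
  have N: "\<exists>s. 0 \<le> s \<and> s \<le> 1 \<and> S_minus (\<lambda>u. x (max q (min \<tau> u))) 1 = (if q < s \<and> s \<le> \<tau> then - jump x s else 0)"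
    if q: "0 \<le> q" "q \<le> \<tau>" for q
    using runsup_attained[OF jm[OF q], of 1] Nj[OF q] unfolding S_plus_eq_runsup S_minus_eq_S_plus
    by (metis order_refl zero_le_one)
  show ?thesis
  proof (cases "0 < jump x p")
    case True
    obtain d where d: "0 < d" "\<And>s. 0 \<le> s \<Longrightarrow> s \<le> 1 \<Longrightarrow> s \<noteq> p \<Longrightarrow> \<bar>s - p\<bar> < d \<Longrightarrow> \<bar>jump x s\<bar> \<le> m / 2"
      using jump_like_locally_small[OF jump_like_jump[OF x], of "m / 2" p] m by auto
    \<comment> \<open>\<open>q\<close> is so close to \<open>p\<close> that all jumps in
      \<open>(q,p)\<close> are at most \<open>m / 2\<close> in modulus; those after \<open>p\<close>
      are below \<open>m\<close> because \<open>p\<close> is the latest maximiser.\<close>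
    obtain q where q: "max 0 (p - d) < real_of_rat q" "real_of_rat q < p"
      using of_rat_dense[of "max 0 (p - d)" p] pos(1) d(1) by auto
    have q': "0 \<le> real_of_rat q" "real_of_rat q \<le> \<tau>" using q pos by auto
    have "S_plus (\<lambda>u. x (max (real_of_rat q) (min \<tau> u))) 1 = m"
      unfolding S_plus_eq_runsup
    proof (rule runsup_eqI[of p])
      show "jump (\<lambda>u. x (max (real_of_rat q) (min \<tau> u))) p = m"
        using cadlag01_clamp(2)[OF x q' \<tau>(2), of p] pos q m True \<tau> by auto
      show "jump (\<lambda>u. x (max (real_of_rat q) (min \<tau> u))) s \<le> m" if "0 \<le> s" "s \<le> 1" for s
        using cadlag01_clamp(2)[OF x q' \<tau>(2) that] pos(5)[of s] m that by (auto split: if_splits)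
    qed (use pos \<tau> in auto)
    moreover have "S_minus (\<lambda>u. x (max (real_of_rat q) (min \<tau> u))) 1 < m"
    proof -
      obtain s where s: "0 \<le> s" "s \<le> 1"
        "S_minus (\<lambda>u. x (max (real_of_rat q) (min \<tau> u))) 1 = (if real_of_rat q < s \<and> s \<le> \<tau> then - jump x s else 0)"
        using N[OF q'] by blast
      have "- jump x s < m" if "real_of_rat q < s" "s \<le> \<tau>"
      proof -
        consider "s < p" | "s = p" | "p < s" by linarith
        then show ?thesis
        proof cases
          case 1
          then show ?thesis using d(2)[OF s(1,2)] that q m by auto
        next
          case 2
          then show ?thesis using True m by simp
        next
          case 3
          then show ?thesis using pos(6)[OF 3 that(2)] m by auto
        qed
      qed
      then show ?thesis using s(3) m by auto
    qed
    ultimately have "\<exists>q. ?C q" using q' by blast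
    then show ?thesis using True m pos(3) by simp
  next
    case False
    have "\<not> (\<exists>q. ?C q)"
    proof
      assume "\<exists>q. ?C q"
      then obtain q where q: "?C q" ..
      then have q': "0 \<le> real_of_rat q" "real_of_rat q \<le> \<tau>" by auto
      obtain s where s: "real_of_rat q < s" "s \<le> \<tau>" "jump x s = m"
        using P[OF q'] q m by (auto split: if_splits)
      \<comment> \<open>An upward jump of size \<open>m\<close> cannot come after \<open>p\<close>,
        so every window that contains it contains the downward jump at \<open>p\<close> as
        well.\<close>
      have "s \<le> p"
      proof (rule ccontr)
        assume "\<not> s \<le> p"
        then have "\<bar>jump x s\<bar> < m" using pos(6)[of s] s m by simp
        then show False using s(3) by simp
      qed
      then have "- jump x p \<le> S_minus (\<lambda>u. x (max (real_of_rat q) (min \<tau> u))) 1"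
        using runsup_upper[OF jm[OF q'], of p 1] Nj[OF q', of p] pos(1,2) s \<tau>
        unfolding S_plus_eq_runsup S_minus_eq_S_plus by auto
      then show False using q False m by auto
    qed
    then show ?thesis using False m pos(3) by auto
  qed
qed

lemma measurable_Mtrim: "Mtrim \<in> measurable path_space path_space"
proof (rule measurable_path_spaceI)
  fix t :: real assume t: "0 \<le> t" "t \<le> 1"
  note [measurable] = measurable_S_plus[OF t] measurable_S_minus[OF t] measurable_path_coord[OF t]
  let ?C = "\<lambda>q x. 0 \<le> real_of_rat q \<and> real_of_rat q \<le> t \<and>
      S_plus (\<lambda>u. x (max (real_of_rat q) (min t u))) 1 = max (S_plus x t) (S_minus x t) \<and>
      S_minus (\<lambda>u. x (max (real_of_rat q) (min t u))) 1 < max (S_plus x t) (S_minus x t)"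
  have C: "Measurable.pred path_space (?C q)" for q
  proof (cases "0 \<le> real_of_rat q \<and> real_of_rat q \<le> t")
    case True
    have "Measurable.pred path_space (\<lambda>x. A x = B x \<and> D x < B x)"
      if "A \<in> borel_measurable path_space" "B \<in> borel_measurable path_space"
        "D \<in> borel_measurable path_space" for A B D :: "(real \<Rightarrow> real) \<Rightarrow> real"
      unfolding pred_def using that
      by (intro sets.sets_Collect_conj borel_measurable_eq borel_measurable_less)
    from this[OF measurable_compose[OF measurable_clamp measurable_S_plus_1, of "real_of_rat q" t]
        borel_measurable_max[OF measurable_S_plus[OF t] measurable_S_minus[OF t]]
        measurable_compose[OF measurable_clamp measurable_S_minus[of 1], of "real_of_rat q" t]]
    show ?thesis using True t by (simp add: max.commute)
  next
    case False
    then have "?C q = (\<lambda>x. False)" by auto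
    then show ?thesis by simp
  qed
  \<comment> \<open>A rational left end makes this union of events countable.\<close>
  have "Measurable.pred path_space (\<lambda>x. \<exists>q. ?C q x)"
    using C by (intro pred_intros_countable)
  then have meas: "(\<lambda>x. x t - (if \<exists>q. ?C q x then max (S_plus x t) (S_minus x t) else - max (S_plus x t) (S_minus x t)))
      \<in> borel_measurable path_space"
    by measurable
  have eq: "Mtrim x t = x t - (if \<exists>q. ?C q x then max (S_plus x t) (S_minus x t) else - max (S_plus x t) (S_minus x t))"
    if "x \<in> space path_space" for x
    unfolding Mtrim_def using jump_Ltilde_rational[OF _ t, of x] that by (simp only: space_path_space mem_Collect_eq)
  show "(\<lambda>x. Mtrim x t) \<in> borel_measurable path_space"
    by (rule iffD2[OF measurable_cong[OF eq] meas])
qed (auto simp: space_path_space intro!: cadlag01_Mtrim)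

section \<open>Continuous mapping\<close>

lemma bounded_J1_continuous_iff:
  "bounded_J1_continuous G \<longleftrightarrow>
    (\<exists>B. \<forall>x. cadlag01 x \<longrightarrow> \<bar>G x\<bar> \<le> B) \<and> (\<forall>x. cadlag01 x \<longrightarrow> J1_cont_at G x)"
  unfolding bounded_J1_continuous_def by (simp add: J1_cont_at_iff_dist cong: imp_cong)

text \<open>Paths that agree on \<open>[0,1]\<close> are at distance \<open>0\<close>, so a
  continuous functional ignores the values elsewhere. This matters because the operators are known
  to commute with scaling only on \<open>[0,1]\<close>.\<close>

lemma J1_cont_at_cong:
  assumes G: "J1_cont_at G x" and y: "cadlag01 y" and eq: "\<And>t. 0 \<le> t \<Longrightarrow> t \<le> 1 \<Longrightarrow> y t = x t"
  shows "G y = G x"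
proof -
  have "\<bar>G y - G x\<bar> \<le> e" if "e > 0" for e
  proof -
    obtain d where d: "d > 0" "\<And>y. cadlag01 y \<Longrightarrow> J1_near d x y \<Longrightarrow> \<bar>G y - G x\<bar> < e"
      using G \<open>e > 0\<close> by (auto simp: J1_cont_at_def)
    have "J1_near d x y" by (rule J1_near_uniform) (use d eq in auto)
    then show ?thesis using d(2)[OF y] by simp
  qed
  then show ?thesis using dense_ge[of 0 "\<bar>G y - G x\<bar>"] by auto
qed

text \<open>The Pasch-Hausdorff envelope: for \<open>f\<close> bounded on cadlag paths, its largest
  minorant there that is \<open>k\<close>-Lipschitz for \<open>dist_J1\<close>.\<close>

definition inf_conv :: "((real \<Rightarrow> real) \<Rightarrow> real) \<Rightarrow> nat \<Rightarrow> (real \<Rightarrow> real) \<Rightarrow> real" where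
  "inf_conv f k x = (INF y\<in>{y. cadlag01 y}. f y + real k * dist_J1 x y)"

context
  fixes f :: "(real \<Rightarrow> real) \<Rightarrow> real" and B :: real
  assumes B: "\<And>x. cadlag01 x \<Longrightarrow> \<bar>f x\<bar> \<le> B"
begin

lemma inf_conv_bdd: "cadlag01 y \<Longrightarrow> - B \<le> f y + real k * dist_J1 x y"
  using B[of y] mult_nonneg_nonneg[OF of_nat_0_le_iff[of k] dist_J1_nonneg[of x y]] by linarith

lemma inf_conv_lower: "cadlag01 y \<Longrightarrow> inf_conv f k x \<le> f y + real k * dist_J1 x y"
  unfolding inf_conv_def by (intro cINF_lower bdd_belowI2[of _ "- B"]) (auto intro: inf_conv_bdd)

lemma inf_conv_greatest:
  "cadlag01 z \<Longrightarrow> (\<And>y. cadlag01 y \<Longrightarrow> c \<le> f y + real k * dist_J1 x y) \<Longrightarrow> c \<le> inf_conv f k x"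
  unfolding inf_conv_def by (intro cINF_greatest) auto

lemma inf_conv_le: "cadlag01 x \<Longrightarrow> inf_conv f k x \<le> f x"
  using inf_conv_lower[of x k x] by simp

lemma inf_conv_bounded: "cadlag01 x \<Longrightarrow> \<bar>inf_conv f k x\<bar> \<le> B"
  using inf_conv_le[of x k] B[of x] inf_conv_greatest[of x "- B" k x, OF _ inf_conv_bdd] by linarith

lemma inf_conv_lipschitz:
  assumes x: "cadlag01 x" and z: "cadlag01 z"
  shows "inf_conv f k x \<le> inf_conv f k z + real k * dist_J1 x z"
proof -
  have "inf_conv f k x - real k * dist_J1 x z \<le> inf_conv f k z"
  proof (rule inf_conv_greatest[OF x])
    fix y assume y: "cadlag01 y"
    have "real k * dist_J1 x y \<le> real k * (dist_J1 x z + dist_J1 z y)"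
      by (intro mult_left_mono dist_J1_triangle x y z) auto
    then show "inf_conv f k x - real k * dist_J1 x z \<le> f y + real k * dist_J1 z y"
      using inf_conv_lower[OF y, of k x] by (simp add: distrib_left)
  qed
  then show ?thesis by simp
qed

lemma inf_conv_continuous: "bounded_J1_continuous (inf_conv f k)"
  unfolding bounded_J1_continuous_def
proof (intro conjI allI impI)
  show "\<exists>B. \<forall>x. cadlag01 x \<longrightarrow> \<bar>inf_conv f k x\<bar> \<le> B" using inf_conv_bounded by blast
  fix x and e :: real assume x: "cadlag01 x" and e: "0 < e"
  show "\<exists>d>0. \<forall>y. cadlag01 y \<longrightarrow> dist_J1 x y < d \<longrightarrow> \<bar>inf_conv f k y - inf_conv f k x\<bar> < e"
  proof (intro exI[of _ "e / (real k + 1)"] conjI allI impI)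
    fix y assume y: "cadlag01 y" "dist_J1 x y < e / (real k + 1)"
    then have "(real k + 1) * dist_J1 x y < e" by (simp add: field_simps)
    then have "real k * dist_J1 x y < e" using dist_J1_nonneg[of x y] by (simp add: distrib_right)
    then show "\<bar>inf_conv f k y - inf_conv f k x\<bar> < e"
      using inf_conv_lipschitz[OF x y(1), of k] inf_conv_lipschitz[OF y(1) x, of k] dist_J1_sym[OF x y(1)] by auto
  qed (use e in auto)
qed

text \<open>Far from \<open>x\<close> the penalty \<open>real k * dist_J1 x y\<close> outweighs the
  oscillation \<open>2 * B\<close> of \<open>f\<close>, whence the threshold
  \<open>2 * B / d\<close>; near \<open>x\<close> continuity takes over.\<close>

lemma inf_conv_tendsto:
  assumes x: "cadlag01 x" and c: "J1_cont_at f x"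
  shows "(\<lambda>k. inf_conv f k x) \<longlonglongrightarrow> f x"
proof (rule LIMSEQ_I)
  fix e :: real assume e: "0 < e"
  obtain d where d: "d > 0" "\<And>y. cadlag01 y \<Longrightarrow> dist_J1 x y < d \<Longrightarrow> \<bar>f y - f x\<bar> < e / 2"
    using c e unfolding J1_cont_at_iff_dist[OF x] by (meson half_gt_zero)
  obtain K :: nat where K: "2 * B / d < real K" using reals_Archimedean2 by blast
  show "\<exists>K. \<forall>k\<ge>K. norm (inf_conv f k x - f x) < e"
  proof (intro exI[of _ K] allI impI)
    fix k assume k: "K \<le> k"
    have "f x - e / 2 \<le> inf_conv f k x"
    proof (rule inf_conv_greatest[OF x])
      fix y assume y: "cadlag01 y"
      show "f x - e / 2 \<le> f y + real k * dist_J1 x y"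
      proof (cases "dist_J1 x y < d")
        case True
        then show ?thesis
          using d(2)[OF y True] mult_nonneg_nonneg[OF of_nat_0_le_iff[of k] dist_J1_nonneg[of x y]] e by linarith
      next
        case False
        have "2 * B < real K * d" using K d(1) by (simp add: field_simps)
        also have "\<dots> \<le> real k * dist_J1 x y" using k False d(1) by (intro mult_mono) auto
        finally show ?thesis using B[OF x] B[OF y] e by auto
      qed
    qed
    then show "norm (inf_conv f k x - f x) < e" using inf_conv_le[OF x, of k] e by auto
  qed
qed

text \<open>Half of the portmanteau theorem. By dominated convergence one envelope already has
  integral above \<open>c\<close> under the limit law; being bounded and continuous it is an
  admissible test functional, and it lies below \<open>f\<close>.\<close>

lemma conv_distr_D_lower_bound:
  assumes f: "f \<in> borel_measurable path_space" and M: "prob_space M" and N: "prob_space N"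
    and Z: "eventually (\<lambda>t. Z t \<in> measurable M path_space) F" and W: "W \<in> measurable N path_space"
    and conv: "conv_distr_D F M Z N W" and ae: "AE \<omega> in N. J1_cont_at f (W \<omega>)"
    and c: "c < (\<integral>\<omega>. f (W \<omega>) \<partial>N)"
  shows "eventually (\<lambda>t. c < (\<integral>\<omega>. f (Z t \<omega>) \<partial>M)) F"
proof -
  interpret M: prob_space M by (rule M)
  interpret N: prob_space N by (rule N)
  have cW: "cadlag01 (W \<omega>)" if "\<omega> \<in> space N" for \<omega>
    using measurable_space[OF W that] by (simp add: space_path_space)
  have m: "inf_conv f k \<in> borel_measurable path_space" for k
    using inf_conv_continuous[of k] by (intro J1_cont_borel_measurable) (auto simp: bounded_J1_continuous_iff)
  have "(\<lambda>k. \<integral>\<omega>. inf_conv f k (W \<omega>) \<partial>N) \<longlonglongrightarrow> (\<integral>\<omega>. f (W \<omega>) \<partial>N)"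
  proof (rule integral_dominated_convergence[where w = "\<lambda>_. B"])
    show "AE \<omega> in N. (\<lambda>k. inf_conv f k (W \<omega>)) \<longlonglongrightarrow> f (W \<omega>)"
      using ae AE_space by eventually_elim (use cW inf_conv_tendsto in auto)
    show "AE \<omega> in N. norm (inf_conv f k (W \<omega>)) \<le> B" for k
      using AE_space by eventually_elim (use cW inf_conv_bounded in auto)
  qed (use measurable_compose[OF W] f m in auto)
  from order_tendstoD(1)[OF this c] obtain k where k: "c < (\<integral>\<omega>. inf_conv f k (W \<omega>) \<partial>N)"
    by (auto simp: eventually_sequentially)
  have "((\<lambda>t. \<integral>\<omega>. inf_conv f k (Z t \<omega>) \<partial>M) \<longlongrightarrow> (\<integral>\<omega>. inf_conv f k (W \<omega>) \<partial>N)) F"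
    using conv inf_conv_continuous by (auto simp: conv_distr_D_def)
  from order_tendstoD(1)[OF this k] Z show ?thesis
  proof eventually_elim
    case (elim t)
    have cZ: "cadlag01 (Z t \<omega>)" if "\<omega> \<in> space M" for \<omega>
      using measurable_space[OF elim(2) that] by (simp add: space_path_space)
    have "(\<integral>\<omega>. inf_conv f k (Z t \<omega>) \<partial>M) \<le> (\<integral>\<omega>. f (Z t \<omega>) \<partial>M)"
    proof (rule integral_mono)
      show "integrable M (\<lambda>\<omega>. inf_conv f k (Z t \<omega>))"
        by (rule M.integrable_const_bound[of _ B])
          (use measurable_compose[OF elim(2) m] cZ inf_conv_bounded in auto)
      show "integrable M (\<lambda>\<omega>. f (Z t \<omega>))"
        by (rule M.integrable_const_bound[of _ B])
          (use measurable_compose[OF elim(2) f] cZ B in auto)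
    qed (use cZ inf_conv_le in auto)
    with elim(1) show ?case by linarith
  qed
qed

end

text \<open>The inf-convolutions of \<open>f\<close> and \<open>- f\<close> are Lipschitz and sandwich \<open>f\<close> tightly at its continuity points.\<close>

lemma conv_distr_D_continuous_mapping:
  assumes B: "\<And>x. cadlag01 x \<Longrightarrow> \<bar>f x\<bar> \<le> B"
    and f: "f \<in> borel_measurable path_space" and M: "prob_space M" and N: "prob_space N"
    and Z: "eventually (\<lambda>t. Z t \<in> measurable M path_space) F" and W: "W \<in> measurable N path_space"
    and conv: "conv_distr_D F M Z N W" and ae: "AE \<omega> in N. J1_cont_at f (W \<omega>)"
  shows "((\<lambda>t. \<integral>\<omega>. f (Z t \<omega>) \<partial>M) \<longlongrightarrow> (\<integral>\<omega>. f (W \<omega>) \<partial>N)) F"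
proof (rule order_tendstoI)
  fix c assume "c < (\<integral>\<omega>. f (W \<omega>) \<partial>N)"
  then show "eventually (\<lambda>t. c < (\<integral>\<omega>. f (Z t \<omega>) \<partial>M)) F"
    using conv_distr_D_lower_bound[OF B f M N Z W conv ae] by blast
next
  fix c assume c: "(\<integral>\<omega>. f (W \<omega>) \<partial>N) < c"
  have "eventually (\<lambda>t. - c < (\<integral>\<omega>. - f (Z t \<omega>) \<partial>M)) F"
  proof (rule conv_distr_D_lower_bound[OF _ _ M N Z W conv])
    show "AE \<omega> in N. J1_cont_at (\<lambda>x. - f x) (W \<omega>)"
      using ae by eventually_elim (auto simp: J1_cont_at_def abs_minus_commute)
  qed (use B f c in auto)
  then show "eventually (\<lambda>t. (\<integral>\<omega>. f (Z t \<omega>) \<partial>M) < c) F" by simp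
qed

text \<open>The properties that the transfer of convergence uses, in a form closed under
  composition. For this \<open>C\<close> has to be preserved by \<open>T\<close>, and the modulus
  \<open>d\<close> may depend on the path \<open>x\<close>.\<close>

definition J1_operator :: "((real \<Rightarrow> real) \<Rightarrow> bool) \<Rightarrow> ((real \<Rightarrow> real) \<Rightarrow> real \<Rightarrow> real) \<Rightarrow> bool" where
  "J1_operator C T \<longleftrightarrow> T \<in> measurable path_space path_space \<and>
    (\<forall>x. cadlag01 x \<longrightarrow> C x \<longrightarrow> C (T x) \<and>
      (\<forall>e>0. \<exists>d>0. \<forall>y. cadlag01 y \<longrightarrow> J1_near d x y \<longrightarrow> J1_near e (T x) (T y))) \<and>
    (\<forall>x y a b. cadlag01 x \<longrightarrow> 0 < b \<longrightarrow> (\<forall>t. 0 \<le> t \<longrightarrow> t \<le> 1 \<longrightarrow> y t = (x t - t * a) / b) \<longrightarrow>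
      (\<forall>t. 0 \<le> t \<longrightarrow> t \<le> 1 \<longrightarrow> T y t = (T x t - t * a) / b))"

lemma J1_operator_cadlag: "J1_operator C T \<Longrightarrow> cadlag01 x \<Longrightarrow> cadlag01 (T x)"
  using measurable_space[of T path_space path_space x] by (auto simp: J1_operator_def space_path_space)

lemma J1_operator_affine:
  assumes T: "J1_operator C T" and x: "cadlag01 x" and b: "0 < b"
    and y: "\<And>t. 0 \<le> t \<Longrightarrow> t \<le> 1 \<Longrightarrow> y t = (x t - t * a) / b" and t: "0 \<le> t" "t \<le> 1"
  shows "T y t = (T x t - t * a) / b"
proof -
  have "\<forall>x y a b. cadlag01 x \<longrightarrow> 0 < b \<longrightarrow> (\<forall>t. 0 \<le> t \<longrightarrow> t \<le> 1 \<longrightarrow> y t = (x t - t * a) / b) \<longrightarrow>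
      (\<forall>t. 0 \<le> t \<longrightarrow> t \<le> 1 \<longrightarrow> T y t = (T x t - t * a) / b)"
    using T by (simp add: J1_operator_def)
  from this[rule_format, of x b y a t] x b y t show ?thesis by simp
qed

lemma J1_operator_id: "J1_operator C id"
  unfolding J1_operator_def by (auto simp: id_def)

lemma J1_operator_comp:
  assumes S: "J1_operator C S" and T: "J1_operator C T"
  shows "J1_operator C (S \<circ> T)"
  unfolding J1_operator_def
proof (intro conjI allI impI)
  show "S \<circ> T \<in> measurable path_space path_space"
    using S T by (auto simp: J1_operator_def intro: measurable_comp)
next
  fix x assume x: "cadlag01 x" "C x"
  then show "C ((S \<circ> T) x)" using S T J1_operator_cadlag[OF T x(1)] by (auto simp: J1_operator_def)
next
  fix x and e :: real assume x: "cadlag01 x" "C x" and e: "0 < e"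
  have Tx: "cadlag01 (T x)" "C (T x)" using x T J1_operator_cadlag[OF T x(1)] by (auto simp: J1_operator_def)
  obtain d where d: "d > 0" "\<And>y. cadlag01 y \<Longrightarrow> J1_near d (T x) y \<Longrightarrow> J1_near e (S (T x)) (S y)"
    using S Tx e unfolding J1_operator_def by blast
  obtain d' where d': "d' > 0" "\<And>y. cadlag01 y \<Longrightarrow> J1_near d' x y \<Longrightarrow> J1_near d (T x) (T y)"
    using T x d(1) unfolding J1_operator_def by blast
  show "\<exists>d>0. \<forall>y. cadlag01 y \<longrightarrow> J1_near d x y \<longrightarrow> J1_near e ((S \<circ> T) x) ((S \<circ> T) y)"
    using d d' J1_operator_cadlag[OF T] by auto
next
  fix x y :: "real \<Rightarrow> real" and a b t :: real
  assume *: "cadlag01 x" "0 < b" "\<forall>t. 0 \<le> t \<longrightarrow> t \<le> 1 \<longrightarrow> y t = (x t - t * a) / b" "0 \<le> t" "t \<le> 1"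
  have "T y t = (T x t - t * a) / b" if "0 \<le> t" "t \<le> 1" for t
    using J1_operator_affine[OF T *(1,2), of y a t] *(3) that by simp
  then show "(S \<circ> T) y t = ((S \<circ> T) x t - t * a) / b"
    using J1_operator_affine[OF S J1_operator_cadlag[OF T *(1)] *(2) _ *(4,5), of "T y" a] by simp
qed

lemma J1_operator_funpow: "J1_operator C T \<Longrightarrow> J1_operator C (T ^^ n)"
proof (induction n)
  case 0
  show ?case using J1_operator_id by (simp add: id_def)
next
  case (Suc n)
  then show ?case by (simp only: funpow.simps J1_operator_comp)
qed

lemma J1_operator_Trim_plus: "J1_operator (\<lambda>_. True) Trim_plus"
  unfolding J1_operator_def
proof (intro conjI allI impI)
  fix x and e :: real assume x: "cadlag01 x" and e: "0 < e"
  show "\<exists>d>0. \<forall>y. cadlag01 y \<longrightarrow> J1_near d x y \<longrightarrow> J1_near e (Trim_plus x) (Trim_plus y)"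
    using J1_near_Trim_plus[OF x, of _ "e / 3"] e by (intro exI[of _ "e / 3"]) auto
qed (auto simp: measurable_Trim_plus intro!: Trim_plus_affine)

lemma J1_operator_Trim_minus: "J1_operator (\<lambda>_. True) Trim_minus"
  unfolding J1_operator_def
proof (intro conjI allI impI)
  fix x and e :: real assume x: "cadlag01 x" and e: "0 < e"
  show "\<exists>d>0. \<forall>y. cadlag01 y \<longrightarrow> J1_near d x y \<longrightarrow> J1_near e (Trim_minus x) (Trim_minus y)"
    using J1_near_Trim_minus[OF x, of _ "e / 3"] e by (intro exI[of _ "e / 3"]) auto
qed (auto simp: measurable_Trim_minus intro!: Trim_minus_affine)

lemma J1_operator_Rtrim: "J1_operator tie_free Rtrim"
  unfolding J1_operator_def
  by (intro conjI allI impI measurable_Rtrim tie_free_Rtrim J1_near_Rtrim Rtrim_affine) auto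

lemma J1_operator_Mtrim: "J1_operator tie_free Mtrim"
  unfolding J1_operator_def
  by (intro conjI allI impI measurable_Mtrim tie_free_Mtrim J1_near_Mtrim Mtrim_affine) auto

lemma conv_distr_D_J1_operator:
  assumes T: "J1_operator C T" and M: "prob_space M" and N: "prob_space N"
    and F: "eventually (\<lambda>t. 0 < t) F" and b: "\<forall>t>0. 0 < b t"
    and X: "\<And>t. 0 < t \<Longrightarrow> (\<lambda>\<omega> \<tau>. X (\<tau> * t) \<omega>) \<in> measurable M path_space"
    and Y: "(\<lambda>\<omega> \<tau>. Y \<tau> \<omega>) \<in> measurable N path_space"
    and ae: "AE \<omega> in N. C (\<lambda>\<tau>. Y \<tau> \<omega>)"
    and conv: "conv_distr_D F M (\<lambda>t \<omega> \<tau>. (X (\<tau> * t) \<omega> - \<tau> * a t) / b t) N (\<lambda>\<omega> \<tau>. Y \<tau> \<omega>)"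
  shows "conv_distr_D F M (\<lambda>t \<omega> \<tau>. (T (\<lambda>\<sigma>. X (\<sigma> * t) \<omega>) \<tau> - \<tau> * a t) / b t)
    N (\<lambda>\<omega>. T (\<lambda>\<tau>. Y \<tau> \<omega>))"
  unfolding conv_distr_D_def
proof (intro allI impI)
  fix G assume "bounded_J1_continuous G"
  then obtain B where B: "\<And>x. cadlag01 x \<Longrightarrow> \<bar>G x\<bar> \<le> B" and G: "\<And>x. cadlag01 x \<Longrightarrow> J1_cont_at G x"
    by (auto simp: bounded_J1_continuous_iff)
  define Z where "Z t \<omega> \<tau> = (X (\<tau> * t) \<omega> - \<tau> * a t) / b t" for t \<omega> \<tau>
  have cX: "cadlag01 (\<lambda>\<tau>. X (\<tau> * t) \<omega>)" if "0 < t" "\<omega> \<in> space M" for t \<omega>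
    using measurable_space[OF X[OF that(1)] that(2)] by (simp add: space_path_space)
  have Z: "Z t \<in> measurable M path_space" if t: "0 < t" for t
    unfolding Z_def
  proof (rule measurable_path_spaceI)
    show "(\<lambda>\<omega>. (X (\<tau> * t) \<omega> - \<tau> * a t) / b t) \<in> borel_measurable M" if "0 \<le> \<tau>" "\<tau> \<le> 1" for \<tau>
      using measurable_compose[OF X[OF t] measurable_path_coord[OF that]] by measurable
  qed (use cX[OF t] cadlag01_affine(1) in blast)
  have Tm: "T \<in> measurable path_space path_space" using T by (simp add: J1_operator_def)
  have "((\<lambda>t. \<integral>\<omega>. G (T (Z t \<omega>)) \<partial>M) \<longlongrightarrow> (\<integral>\<omega>. G (T (\<lambda>\<tau>. Y \<tau> \<omega>)) \<partial>N)) F"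
  proof (rule conv_distr_D_continuous_mapping[where f = "\<lambda>x. G (T x)", OF _ _ M N _ Y])
    show "\<bar>G (T x)\<bar> \<le> B" if "cadlag01 x" for x using B J1_operator_cadlag[OF T that] by blast
    show "(\<lambda>x. G (T x)) \<in> borel_measurable path_space"
      using measurable_compose[OF Tm J1_cont_borel_measurable[OF G]] .
    show "eventually (\<lambda>t. Z t \<in> measurable M path_space) F"
      using F by eventually_elim (rule Z)
    show "conv_distr_D F M Z N (\<lambda>\<omega> \<tau>. Y \<tau> \<omega>)" using conv by (simp add: Z_def[abs_def])
    show "AE \<omega> in N. J1_cont_at (\<lambda>x. G (T x)) (\<lambda>\<tau>. Y \<tau> \<omega>)"
      using ae AE_space
    proof eventually_elim
      case (elim \<omega>)
      let ?y = "\<lambda>\<tau>. Y \<tau> \<omega>"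
      have y: "cadlag01 ?y" using measurable_space[OF Y elim(2)] by (simp add: space_path_space)
      show ?case unfolding J1_cont_at_def
      proof (intro allI impI)
        fix e :: real assume e: "0 < e"
        obtain d where d: "d > 0" "\<And>z. cadlag01 z \<Longrightarrow> J1_near d (T ?y) z \<Longrightarrow> \<bar>G z - G (T ?y)\<bar> < e"
          using G[OF J1_operator_cadlag[OF T y]] e by (auto simp: J1_cont_at_def)
        obtain d' where d': "d' > 0" "\<And>z. cadlag01 z \<Longrightarrow> J1_near d' ?y z \<Longrightarrow> J1_near d (T ?y) (T z)"
          using T y elim(1) d(1) unfolding J1_operator_def by blast
        show "\<exists>d>0. \<forall>z. cadlag01 z \<longrightarrow> J1_near d ?y z \<longrightarrow> \<bar>G (T z) - G (T ?y)\<bar> < e"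
          using d d' J1_operator_cadlag[OF T] by blast
      qed
    qed
  qed
  \<comment> \<open>Centring and norming move outside \<open>T\<close> for \<open>t > 0\<close>,
    where \<open>b t\<close> is positive; the two paths agree on \<open>[0,1]\<close>, which is all
    that \<open>G\<close> sees.\<close>
  moreover have "eventually (\<lambda>t. (\<integral>\<omega>. G (T (Z t \<omega>)) \<partial>M) =
      (\<integral>\<omega>. G (\<lambda>\<tau>. (T (\<lambda>\<sigma>. X (\<sigma> * t) \<omega>) \<tau> - \<tau> * a t) / b t) \<partial>M)) F"
    using F
  proof eventually_elim
    case (elim t)
    show ?case
    proof (rule Bochner_Integration.integral_cong[OF refl])
      fix \<omega> assume \<omega>: "\<omega> \<in> space M"
      have TX: "cadlag01 (T (\<lambda>\<sigma>. X (\<sigma> * t) \<omega>))" using J1_operator_cadlag[OF T cX[OF elim \<omega>]] .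
      have cZ: "cadlag01 (T (Z t \<omega>))"
        using J1_operator_cadlag[OF T] measurable_space[OF Z[OF elim] \<omega>] by (simp add: space_path_space)
      have "T (Z t \<omega>) \<tau> = (T (\<lambda>\<sigma>. X (\<sigma> * t) \<omega>) \<tau> - \<tau> * a t) / b t" if "0 \<le> \<tau>" "\<tau> \<le> 1" for \<tau>
        using b elim by (intro J1_operator_affine[OF T cX[OF elim \<omega>] _ _ that]) (auto simp: Z_def)
      then show "G (T (Z t \<omega>)) = G (\<lambda>\<tau>. (T (\<lambda>\<sigma>. X (\<sigma> * t) \<omega>) \<tau> - \<tau> * a t) / b t)"
        by (intro J1_cont_at_cong[OF G cZ] cadlag01_affine(1) TX) auto
    qed
  qed
  ultimately show "((\<lambda>t. \<integral>\<omega>. G (\<lambda>\<tau>. (T (\<lambda>\<sigma>. X (\<sigma> * t) \<omega>) \<tau> - \<tau> * a t) / b t) \<partial>M) \<longlongrightarrow>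
      (\<integral>\<omega>. G (T (\<lambda>\<tau>. Y \<tau> \<omega>)) \<partial>N)) F"
    by (rule Lim_transform_eventually)
qed

section \<open>Ties and the Gaussian kernel\<close>

lemma fubini_bounded:
  fixes f :: "real \<Rightarrow> real \<Rightarrow> real"
  assumes A: "finite_measure A" "sets A = sets borel" and B: "finite_measure B" "sets B = sets borel"
    and f: "case_prod f \<in> borel_measurable (borel \<Otimes>\<^sub>M borel)" and bd: "\<And>x y. \<bar>f x y\<bar> \<le> C"
  shows "(\<integral>x. (\<integral>y. f x y \<partial>B) \<partial>A) = (\<integral>y. (\<integral>x. f x y \<partial>A) \<partial>B)"
    and "(\<integral>x. (\<integral>y. f x y \<partial>B) \<partial>A) = (\<integral>z. case_prod f z \<partial>(A \<Otimes>\<^sub>M B))"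
proof -
  interpret A: finite_measure A by (rule A(1))
  interpret B: finite_measure B by (rule B(1))
  interpret AB: pair_sigma_finite A B ..
  interpret P: finite_measure "A \<Otimes>\<^sub>M B" by (rule finite_measure_pair_measure[OF B(1) A(1)])
  have "case_prod f \<in> borel_measurable (A \<Otimes>\<^sub>M B)"
    using f by (simp cong: measurable_cong_sets add: sets_pair_measure_cong[OF A(2) B(2)])
  then have int: "integrable (A \<Otimes>\<^sub>M B) (case_prod f)"
    by (intro P.integrable_const_bound[of _ C]) (auto simp: bd)
  show "(\<integral>x. (\<integral>y. f x y \<partial>B) \<partial>A) = (\<integral>y. (\<integral>x. f x y \<partial>A) \<partial>B)"
    by (rule AB.Fubini_integral[OF int, symmetric])
  show "(\<integral>x. (\<integral>y. f x y \<partial>B) \<partial>A) = (\<integral>z. case_prod f z \<partial>(A \<Otimes>\<^sub>M B))"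
    by (rule AB.integral_fst[OF int])
qed

lemma integral_cos_std_normal: "(\<integral>\<xi>. cos (u * \<xi>) \<partial>std_normal_distribution) = exp (- (u\<^sup>2) / 2)"
proof -
  interpret G: real_distribution std_normal_distribution by (rule real_dist_normal_dist)
  have int: "integrable std_normal_distribution (\<lambda>\<xi>. iexp (u * \<xi>))"
    by (rule G.integrable_const_bound[of _ 1]) auto
  have "(\<integral>\<xi>. cos (u * \<xi>) \<partial>std_normal_distribution) = Re (char std_normal_distribution u)"
    unfolding char_def using integral_Re[OF int] by (simp add: Re_exp)
  then show ?thesis by (simp add: char_std_normal_distribution)
qed

text \<open>A Gaussian ridge along each of the lines \<open>y = z\<close> and
  \<open>y = - z\<close>: at least \<open>1 / 2\<close> on them, and tending to \<open>0\<close>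
  elsewhere as \<open>a\<close> grows.\<close>

definition tie_kernel :: "real \<Rightarrow> real \<Rightarrow> real \<Rightarrow> real" where
  "tie_kernel a y z = (exp (- ((a * (y - z))\<^sup>2) / 2) + exp (- ((a * (y + z))\<^sup>2) / 2)) / 2"

lemma tie_kernel_bounds: "0 \<le> tie_kernel a y z" "tie_kernel a y z \<le> 1"
proof -
  have "exp (- ((a * (y - z))\<^sup>2) / 2) \<le> 1" "exp (- ((a * (y + z))\<^sup>2) / 2) \<le> 1" by auto
  moreover have "(p + q) / 2 \<le> 1" if "p \<le> 1" "q \<le> 1" for p q :: real using that by simp
  ultimately show "tie_kernel a y z \<le> 1" unfolding tie_kernel_def by blast
  show "0 \<le> tie_kernel a y z" by (simp add: tie_kernel_def)
qed

lemma tie_kernel_eq_integral: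
  "tie_kernel a y z = (\<integral>\<xi>. cos (a * \<xi> * y) * cos (a * \<xi> * z) \<partial>std_normal_distribution)"
proof -
  interpret G: real_distribution std_normal_distribution by (rule real_dist_normal_dist)
  have int: "integrable std_normal_distribution (\<lambda>\<xi>. cos (u * \<xi>) / 2)" for u
    by (rule G.integrable_const_bound[of _ 1]) (auto intro!: AE_I2 order_trans[OF abs_cos_le_one])
  have "(\<integral>\<xi>. cos (a * \<xi> * y) * cos (a * \<xi> * z) \<partial>std_normal_distribution) =
    (\<integral>\<xi>. cos (a * (y - z) * \<xi>) / 2 + cos (a * (y + z) * \<xi>) / 2 \<partial>std_normal_distribution)"
    by (simp add: cos_times_cos algebra_simps add_divide_distrib)
  also have "\<dots> = (\<integral>\<xi>. cos (a * (y - z) * \<xi>) / 2 \<partial>std_normal_distribution) +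
      (\<integral>\<xi>. cos (a * (y + z) * \<xi>) / 2 \<partial>std_normal_distribution)"
    by (rule Bochner_Integration.integral_add[OF int int])
  finally show ?thesis by (simp add: integral_cos_std_normal tie_kernel_def add_divide_distrib)
qed

lemma tie_kernel_measurable [measurable]: "case_prod (tie_kernel a) \<in> borel_measurable (borel \<Otimes>\<^sub>M borel)"
  unfolding tie_kernel_def by measurable

lemma cos_integral_bound:
  assumes \<nu>: "finite_measure \<nu>"
  shows "\<bar>\<integral>y. cos (u * y) \<partial>\<nu>\<bar> \<le> measure \<nu> (space \<nu>)"
proof (cases "integrable \<nu> (\<lambda>y. cos (u * y))")
  case True
  interpret finite_measure \<nu> by (rule \<nu>)
  have "\<bar>\<integral>y. cos (u * y) \<partial>\<nu>\<bar> \<le> (\<integral>y. \<bar>cos (u * y)\<bar> \<partial>\<nu>)" by (rule integral_abs_bound)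
  also have "\<dots> \<le> (\<integral>y. 1 \<partial>\<nu>)" using True by (intro integral_mono) auto
  finally show ?thesis by simp
qed (simp add: not_integrable_integral_eq)

text \<open>The cosine product separates \<open>y\<close> from \<open>z\<close>, so after exchanging
  the integrals both variables give the same cosine transform. The double integral thus depends on
  \<nu> only through that transform.\<close>

lemma integral_tie_kernel:
  assumes \<nu>: "finite_measure \<nu>" and s: "sets \<nu> = sets borel"
  shows "(\<integral>y. (\<integral>z. tie_kernel a y z \<partial>\<nu>) \<partial>\<nu>) =
    (\<integral>\<xi>. (\<integral>y. cos (a * \<xi> * y) \<partial>\<nu>)\<^sup>2 \<partial>std_normal_distribution)"
proof -
  let ?G = "std_normal_distribution"
  interpret G: real_distribution ?G by (rule real_dist_normal_dist)
  interpret finite_measure \<nu> by (rule \<nu>)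
  have G: "finite_measure ?G" "sets ?G = sets borel" by (auto intro: G.finite_measure_axioms)
  note [measurable_cong] = s
  define F where "F \<xi> = (\<integral>z. cos (a * \<xi> * z) \<partial>\<nu>)" for \<xi>
  have F_m [measurable]: "F \<in> borel_measurable borel" unfolding F_def by measurable
  have F_b: "\<bar>F \<xi>\<bar> \<le> measure \<nu> (space \<nu>)" for \<xi> unfolding F_def by (rule cos_integral_bound[OF \<nu>])
  have "(\<integral>y. (\<integral>z. tie_kernel a y z \<partial>\<nu>) \<partial>\<nu>) = (\<integral>y. (\<integral>\<xi>. cos (a * \<xi> * y) * F \<xi> \<partial>?G) \<partial>\<nu>)"
  proof (rule Bochner_Integration.integral_cong[OF refl])
    fix y
    have "(\<integral>z. tie_kernel a y z \<partial>\<nu>) = (\<integral>\<xi>. (\<integral>z. cos (a * \<xi> * y) * cos (a * \<xi> * z) \<partial>\<nu>) \<partial>?G)"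
      unfolding tie_kernel_eq_integral
      by (rule fubini_bounded(1)[OF \<nu> s G, where C = 1])
        (measurable, simp add: abs_mult mult_le_one)
    then show "(\<integral>z. tie_kernel a y z \<partial>\<nu>) = (\<integral>\<xi>. cos (a * \<xi> * y) * F \<xi> \<partial>?G)" by (simp add: F_def)
  qed
  also have "\<dots> = (\<integral>\<xi>. (\<integral>y. cos (a * \<xi> * y) * F \<xi> \<partial>\<nu>) \<partial>?G)"
  proof (rule fubini_bounded(1)[OF \<nu> s G, where C = "measure \<nu> (space \<nu>)"])
    show "\<bar>cos (a * \<xi> * y) * F \<xi>\<bar> \<le> measure \<nu> (space \<nu>)" for y \<xi>
      unfolding abs_mult using mult_mono[OF abs_cos_le_one F_b] by simp
  qed measurable
  also have "\<dots> = (\<integral>\<xi>. (F \<xi>)\<^sup>2 \<partial>?G)" by (simp add: F_def power2_eq_square)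
  finally show ?thesis by (simp add: F_def)
qed

lemma tie_kernel_tendsto_0:
  assumes "\<bar>y\<bar> \<noteq> \<bar>z\<bar>"
  shows "(\<lambda>j. tie_kernel (real j) y z) \<longlonglongrightarrow> 0"
proof -
  have *: "(\<lambda>j. exp (- ((real j * d)\<^sup>2) / 2)) \<longlonglongrightarrow> 0" if "d \<noteq> 0" for d :: real
  proof (rule tendsto_sandwich[OF _ _ tendsto_const])
    show "(\<lambda>j. exp (- (d\<^sup>2) / 2) ^ j) \<longlonglongrightarrow> 0"
      using that by (intro LIMSEQ_realpow_zero) auto
    \<comment> \<open>\<open>j \<le> j * j\<close> replaces the Gaussian decay by a geometric
      sequence.\<close>
    have "exp (- ((real j * d)\<^sup>2) / 2) \<le> exp (- (d\<^sup>2) / 2) ^ j" for j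
    proof -
      have "real j \<le> (real j)\<^sup>2" by (cases j) (auto simp: power2_eq_square)
      then have "real j * d\<^sup>2 \<le> (real j * d)\<^sup>2" by (simp add: power_mult_distrib mult_right_mono)
      then show ?thesis by (simp add: exp_of_nat_mult[symmetric])
    qed
    then show "\<forall>\<^sub>F j in sequentially. exp (- ((real j * d)\<^sup>2) / 2) \<le> exp (- (d\<^sup>2) / 2) ^ j" by simp
  qed auto
  have "y - z \<noteq> 0" "y + z \<noteq> 0" using assms by auto
  from tendsto_divide[OF tendsto_add[OF *[OF this(1)] *[OF this(2)]] tendsto_const[of 2]]
  show ?thesis unfolding tie_kernel_def by simp
qed

lemma integral_tie_kernel_tendsto_0:
  assumes \<nu>: "finite_measure \<nu>" and s: "sets \<nu> = sets borel"
    and at: "AE y in \<nu>. AE z in \<nu>. \<bar>y\<bar> \<noteq> \<bar>z\<bar>"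
  shows "(\<lambda>j. \<integral>y. (\<integral>z. tie_kernel (real j) y z \<partial>\<nu>) \<partial>\<nu>) \<longlonglongrightarrow> 0"
proof -
  interpret finite_measure \<nu> by (rule \<nu>)
  note [measurable_cong] = s
  have "(\<lambda>j. \<integral>y. (\<integral>z. tie_kernel (real j) y z \<partial>\<nu>) \<partial>\<nu>) \<longlonglongrightarrow> (\<integral>y. 0 \<partial>\<nu>)"
  proof (rule integral_dominated_convergence[where w = "\<lambda>_. measure \<nu> (space \<nu>)"])
    show "AE y in \<nu>. (\<lambda>j. \<integral>z. tie_kernel (real j) y z \<partial>\<nu>) \<longlonglongrightarrow> 0"
      using at
    proof eventually_elim
      case (elim y)
      have "(\<lambda>j. \<integral>z. tie_kernel (real j) y z \<partial>\<nu>) \<longlonglongrightarrow> (\<integral>z. 0 \<partial>\<nu>)"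
      proof (rule integral_dominated_convergence[where w = "\<lambda>_. 1"])
        show "AE z in \<nu>. (\<lambda>j. tie_kernel (real j) y z) \<longlonglongrightarrow> 0"
          using elim by eventually_elim (rule tie_kernel_tendsto_0)
      qed (use tie_kernel_bounds in auto)
      then show ?case by simp
    qed
    show "AE y in \<nu>. norm (\<integral>z. tie_kernel (real j) y z \<partial>\<nu>) \<le> measure \<nu> (space \<nu>)" for j
    proof (rule AE_I2)
      fix y
      have int: "integrable \<nu> (tie_kernel (real j) y)"
        by (rule integrable_const_bound[of _ 1]) (use tie_kernel_bounds in auto)
      have "\<bar>\<integral>z. tie_kernel (real j) y z \<partial>\<nu>\<bar> \<le> (\<integral>z. 1 \<partial>\<nu>)"
        using integral_mono[OF int, of "\<lambda>_. 1"] Bochner_Integration.integral_nonneg[of \<nu> "tie_kernel (real j) y"] tie_kernel_bounds by simp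
      then show "norm (\<integral>z. tie_kernel (real j) y z \<partial>\<nu>) \<le> measure \<nu> (space \<nu>)" by simp
    qed
  qed auto
  then show ?thesis by simp
qed

text \<open>The derivative of \<open>exp (h * z)\<close> at \<open>h = 0\<close> along
  \<open>h = 1 / n\<close>. It extracts the Levy exponent from the characteristic function at time
  \<open>1 / n\<close>.\<close>

lemma tendsto_scaled_exp_minus_1:
  fixes z :: complex
  shows "(\<lambda>n. of_nat n * (exp (z / of_nat n) - 1)) \<longlonglongrightarrow> z"
proof -
  have "((\<lambda>h. exp (h * z)) has_field_derivative z) (at 0)"
    by (auto intro!: derivative_eq_intros)
  then have D: "((\<lambda>h. (exp (h * z) - 1) / h) \<longlongrightarrow> z) (at 0)"
    by (simp add: has_field_derivative_iff)
  have "filterlim (\<lambda>n. 1 / of_nat n :: complex) (at 0) sequentially"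
    unfolding filterlim_at using lim_1_over_n[where 'a = complex]
    by (auto simp: eventually_sequentially intro: exI[of _ 1])
  from filterlim_compose[OF D this] show ?thesis by (simp add: field_simps)
qed

text \<open>Pointwise convergence of the cosine transforms passes through the Gaussian mean by
  dominated convergence. At frequency \<open>0\<close> it is convergence of the total masses, which
  supplies the bound \<open>K\<close>.\<close>

lemma integral_tie_kernel_tendsto:
  assumes \<nu>n: "\<And>n. finite_measure (\<nu>n n)" "\<And>n. sets (\<nu>n n) = sets borel"
    and \<nu>: "finite_measure \<nu>" "sets \<nu> = sets borel"
    and conv: "\<And>\<theta>. (\<lambda>n. \<integral>y. cos (\<theta> * y) \<partial>\<nu>n n) \<longlonglongrightarrow> (\<integral>y. cos (\<theta> * y) \<partial>\<nu>)"
  shows "(\<lambda>n. \<integral>y. (\<integral>z. tie_kernel a y z \<partial>\<nu>n n) \<partial>\<nu>n n) \<longlonglongrightarrow> (\<integral>y. (\<integral>z. tie_kernel a y z \<partial>\<nu>) \<partial>\<nu>)"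
proof -
  interpret G: real_distribution std_normal_distribution by (rule real_dist_normal_dist)
  have "(\<lambda>n. measure (\<nu>n n) (space (\<nu>n n))) \<longlonglongrightarrow> measure \<nu> (space \<nu>)" using conv[of 0] by simp
  then have "Bseq (\<lambda>n. measure (\<nu>n n) (space (\<nu>n n)))" by (intro convergent_imp_Bseq) (auto simp: convergent_def)
  then obtain K where K: "\<And>n. \<bar>measure (\<nu>n n) (space (\<nu>n n))\<bar> \<le> K" by (auto simp: Bseq_def)
  have b: "\<bar>\<integral>y. cos (\<theta> * y) \<partial>\<nu>n n\<bar> \<le> K" for \<theta> n
    using cos_integral_bound[OF \<nu>n(1)[of n], where u = \<theta>] K[of n] by linarith
  have m [measurable]: "(\<lambda>\<xi>. \<integral>y. cos (a * \<xi> * y) \<partial>\<mu>) \<in> borel_measurable borel"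
    if \<mu>: "finite_measure \<mu>" and s [measurable_cong]: "sets \<mu> = sets borel" for \<mu> :: "real measure"
  proof -
    interpret finite_measure \<mu> by (rule \<mu>)
    show ?thesis by measurable
  qed
  have "(\<lambda>n. \<integral>\<xi>. (\<integral>y. cos (a * \<xi> * y) \<partial>\<nu>n n)\<^sup>2 \<partial>std_normal_distribution) \<longlonglongrightarrow>
      (\<integral>\<xi>. (\<integral>y. cos (a * \<xi> * y) \<partial>\<nu>)\<^sup>2 \<partial>std_normal_distribution)"
  proof (rule integral_dominated_convergence[where w = "\<lambda>_. K\<^sup>2"])
    show "AE \<xi> in std_normal_distribution. norm ((\<integral>y. cos (a * \<xi> * y) \<partial>\<nu>n n)\<^sup>2) \<le> K\<^sup>2" for n
      using b by (intro AE_I2) (simp add: abs_le_square_iff[symmetric] order_trans[OF b])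
    show "AE \<xi> in std_normal_distribution. (\<lambda>n. (\<integral>y. cos (a * \<xi> * y) \<partial>\<nu>n n)\<^sup>2) \<longlonglongrightarrow> (\<integral>y. cos (a * \<xi> * y) \<partial>\<nu>)\<^sup>2"
      using conv by (intro AE_I2 tendsto_power) auto
  qed (use m \<nu> \<nu>n in auto)
  then show ?thesis by (simp only: integral_tie_kernel \<nu> \<nu>n)
qed

section \<open>Cosine transforms at small times\<close>

lemma finite_measure_density:
  fixes w :: "'a \<Rightarrow> real"
  assumes w: "integrable M w" and nn: "\<And>x. 0 \<le> w x"
  shows "finite_measure (density M w)"
proof (rule finite_measureI)
  have "emeasure (density M w) (space (density M w)) = (\<integral>\<^sup>+x. ennreal (w x) \<partial>M)"
    using w by (simp add: emeasure_density borel_measurable_integrable cong: nn_integral_cong)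
  also have "\<dots> = ennreal (\<integral>x. w x \<partial>M)" by (rule nn_integral_eq_integral[OF w]) (simp add: nn)
  finally show "emeasure (density M w) (space (density M w)) \<noteq> \<infinity>" by simp
qed

lemma one_minus_cos_le: "1 - cos (u::real) \<le> u\<^sup>2 / 2"
proof -
  have "cos u = 1 - 2 * (sin (u / 2))\<^sup>2" using cos_double_sin[of "u / 2"] by simp
  moreover have "(sin (u / 2))\<^sup>2 \<le> (u / 2)\<^sup>2" 
    by (rule abs_le_square_iff[THEN iffD1, OF abs_sin_x_le_abs_x])
  ultimately show ?thesis by (simp add: power_divide)
qed

context
  fixes M :: "'a measure" and X :: "real \<Rightarrow> 'a \<Rightarrow> real" and \<gamma> :: real and L :: "real measure"
  assumes levy: "levy_process M X" and trip: "levy_triplet M X \<gamma> 0 L"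
begin

lemma sets_levy_measure: "sets L = sets borel"
  using trip by (simp add: levy_triplet_def)

text \<open>Quadratic near \<open>0\<close> and at most \<open>2\<close> elsewhere;
  \<open>2 + \<theta>\<^sup>2\<close> covers both regimes.\<close>

lemma integrable_one_minus_cos: "integrable L (\<lambda>x. 1 - cos (\<theta> * x))"
proof (rule Bochner_Integration.integrable_bound)
  show "integrable L (\<lambda>x. (2 + \<theta>\<^sup>2) * min 1 (x\<^sup>2))" using trip by (simp add: levy_triplet_def)
  have "\<bar>1 - cos (\<theta> * x)\<bar> \<le> (2 + \<theta>\<^sup>2) * min 1 (x\<^sup>2)" for x
  proof (cases "x\<^sup>2 \<le> 1")
    case True
    have "0 \<le> \<theta>\<^sup>2 * x\<^sup>2" "0 \<le> x\<^sup>2" by auto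
    then have "\<theta>\<^sup>2 * x\<^sup>2 / 2 \<le> (2 + \<theta>\<^sup>2) * x\<^sup>2" by (simp add: distrib_right)
    then show ?thesis using one_minus_cos_le[of "\<theta> * x"] True by (simp add: power_mult_distrib)
  next
    case False
    have "\<bar>1 - cos (\<theta> * x)\<bar> \<le> 2 + \<theta>\<^sup>2"
      using cos_ge_minus_one[of "\<theta> * x"] cos_le_one[of "\<theta> * x"] zero_le_power2[of \<theta>] by linarith
    then show ?thesis using False by (simp add: min_def)
  qed
  then show "AE x in L. norm (1 - cos (\<theta> * x)) \<le> norm ((2 + \<theta>\<^sup>2) * min 1 (x\<^sup>2))"
    by (intro AE_I2) (simp add: abs_mult)
qed (subst measurable_cong_sets[OF sets_levy_measure refl], measurable)

text \<open>Needed to take the real part inside the Levy-Khintchine integral. The compensator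
  cancels the linear term where \<open>\<bar>x\<bar> \<le> 1\<close>.\<close>

lemma integrable_levy_khintchine:
  "complex_integrable L (\<lambda>x. iexp (\<theta> * x) - 1 - \<i> * complex_of_real (\<theta> * x * indicator {-1..1} x))"
proof (rule Bochner_Integration.integrable_bound)
  show "integrable L (\<lambda>x. (2 + \<theta>\<^sup>2) * min 1 (x\<^sup>2))" using trip by (simp add: levy_triplet_def)
  have "norm (iexp (\<theta> * x) - 1 - \<i> * complex_of_real (\<theta> * x * indicator {-1..1} x)) \<le> (2 + \<theta>\<^sup>2) * min 1 (x\<^sup>2)" for x
  proof (cases "\<bar>x\<bar> \<le> 1")
    case True
    then have x: "x \<in> {-1..1}" "x\<^sup>2 \<le> 1" by (auto simp: abs_square_le_1)
    have "norm (iexp (\<theta> * x) - 1 - \<i> * complex_of_real (\<theta> * x)) \<le> (\<theta> * x)\<^sup>2 / 2"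
      using iexp_approx1[of "\<theta> * x" 1] by (simp add: eval_nat_numeral algebra_simps abs_mult)
    also have "\<dots> \<le> (2 + \<theta>\<^sup>2) * x\<^sup>2"
    proof -
      have "0 \<le> \<theta>\<^sup>2 * x\<^sup>2" "0 \<le> x\<^sup>2" by auto
      then show ?thesis by (simp add: distrib_right power_mult_distrib)
    qed
    finally show ?thesis using x by simp
  next
    case False
    then have x: "x \<notin> {-1..1}" "\<not> x\<^sup>2 \<le> 1" by (auto simp: abs_square_le_1)
    have "norm (iexp (\<theta> * x) - 1) \<le> 2" using norm_triangle_ineq4[of "iexp (\<theta> * x)" 1] by simp
    then have "norm (iexp (\<theta> * x) - 1) \<le> 2 + \<theta>\<^sup>2" using zero_le_power2[of \<theta>] by linarith
    then show ?thesis using x by (simp add: min_def)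
  qed
  then show "AE x in L. norm (iexp (\<theta> * x) - 1 - \<i> * complex_of_real (\<theta> * x * indicator {-1..1} x)) \<le> norm ((2 + \<theta>\<^sup>2) * min 1 (x\<^sup>2))"
    by (intro AE_I2) (simp add: abs_mult)
qed (subst measurable_cong_sets[OF sets_levy_measure refl], measurable)

text \<open>The Levy exponent is the limit of \<open>n\<close> times the characteristic function at
  time \<open>1 / n\<close> minus one. In its real part the drift and the compensator disappear and,
  without a Gaussian part, only the integral of \<open>cos (\<theta> * x) - 1\<close> is
  left.\<close>

lemma scaled_cos_tendsto:
  "(\<lambda>n. real n * ((\<integral>y. cos (\<theta> * y) \<partial>distr M borel (X (1 / real n))) - 1)) \<longlonglongrightarrow> - (\<integral>x. 1 - cos (\<theta> * x) \<partial>L)"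
proof -
  define \<psi> where "\<psi> = \<i> * complex_of_real (\<gamma> * \<theta>) - complex_of_real (0 * \<theta>\<^sup>2 / 2) +
           (CLINT x|L. iexp (\<theta> * x) - 1 - \<i> * complex_of_real (\<theta> * x * indicator {-1..1} x))"
  have "Re \<psi> = (\<integral>x. Re (iexp (\<theta> * x) - 1 - \<i> * complex_of_real (\<theta> * x * indicator {-1..1} x)) \<partial>L)"
    unfolding \<psi>_def using integral_Re[OF integrable_levy_khintchine] by simp
  also have "\<dots> = (\<integral>x. - (1 - cos (\<theta> * x)) \<partial>L)" by (simp add: Re_exp)
  also have "\<dots> = - (\<integral>x. 1 - cos (\<theta> * x) \<partial>L)" by (rule Bochner_Integration.integral_minus)
  finally have Re: "Re \<psi> = - (\<integral>x. 1 - cos (\<theta> * x) \<partial>L)" .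
  have "(\<integral>y. cos (\<theta> * y) \<partial>distr M borel (X (1 / real n))) = Re (exp (\<psi> / of_nat n))" for n
  proof -
    interpret M: prob_space M using levy by (simp add: levy_process_def)
    have "X (1 / real n) \<in> borel_measurable M" using levy by (simp add: levy_process_def)
    then interpret \<mu>: prob_space "distr M borel (X (1 / real n))" by (rule M.prob_space_distr)
    have int: "integrable (distr M borel (X (1 / real n))) (\<lambda>\<xi>. iexp (\<theta> * \<xi>))"
      by (rule \<mu>.integrable_const_bound[of _ 1]) auto
    have "(\<integral>y. cos (\<theta> * y) \<partial>distr M borel (X (1 / real n))) = Re (char (distr M borel (X (1 / real n))) \<theta>)"
      unfolding char_def using integral_Re[OF int] by (simp add: Re_exp)
    also have "char (distr M borel (X (1 / real n))) \<theta> = exp (complex_of_real (1 / real n) * \<psi>)"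
      using trip unfolding levy_triplet_def \<psi>_def by simp
    finally show ?thesis by simp
  qed
  moreover have "(\<lambda>n. Re (of_nat n * (exp (\<psi> / of_nat n) - 1))) \<longlonglongrightarrow> Re \<psi>"
    by (intro tendsto_Re tendsto_scaled_exp_minus_1)
  ultimately show ?thesis using Re by simp
qed

text \<open>By the product formula the integrand combines cosines with coefficients
  \<open>1\<close>, \<open>-1/2\<close>, \<open>-1/2\<close>. These sum to \<open>0\<close>, so the
  constants subtracted in \<open>scaled_cos_tendsto\<close> cancel, on the grid side and under
  \<open>L\<close>.\<close>

lemma scaled_weighted_cos_tendsto:
  "(\<lambda>n. real n * (\<integral>y. cos (\<theta> * y) * (1 - cos (s * y)) \<partial>distr M borel (X (1 / real n)))) \<longlonglongrightarrow>
    (\<integral>x. cos (\<theta> * x) * (1 - cos (s * x)) \<partial>L)"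
proof -
  let ?\<mu> = "\<lambda>n. distr M borel (X (1 / real n))"
  let ?c = "\<lambda>\<theta>. \<integral>x. 1 - cos (\<theta> * x) \<partial>L"
  let ?f = "\<lambda>n \<theta>. real n * ((\<integral>y. cos (\<theta> * y) \<partial>?\<mu> n) - 1)"
  have trig: "cos (\<theta> * y) * (1 - cos (s * y)) = cos (\<theta> * y) - (cos ((\<theta> + s) * y) + cos ((\<theta> - s) * y)) / 2" for y
    by (simp add: cos_times_cos algebra_simps)
  have "real n * (\<integral>y. cos (\<theta> * y) * (1 - cos (s * y)) \<partial>?\<mu> n) = ?f n \<theta> - (?f n (\<theta> + s) + ?f n (\<theta> - s)) / 2" for n
  proof -
    interpret M: prob_space M using levy by (simp add: levy_process_def)
    have "X (1 / real n) \<in> borel_measurable M" using levy by (simp add: levy_process_def)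
    then interpret \<mu>: prob_space "?\<mu> n" by (rule M.prob_space_distr)
    have int: "integrable (?\<mu> n) (\<lambda>y. cos (\<theta> * y))" for \<theta>
      by (rule \<mu>.integrable_const_bound[of _ 1]) auto
    define I where "I \<theta> = (\<integral>y. cos (\<theta> * y) \<partial>?\<mu> n)" for \<theta>
    have E: "(\<integral>y. cos (\<theta> * y) * (1 - cos (s * y)) \<partial>?\<mu> n) = I \<theta> - (I (\<theta> + s) + I (\<theta> - s)) / 2"
      unfolding trig I_def by (simp add: int)
    show ?thesis unfolding I_def[symmetric] E by (simp add: field_simps)
  qed
  moreover have "(\<integral>x. cos (\<theta> * x) * (1 - cos (s * x)) \<partial>L) = - ?c \<theta> - (- ?c (\<theta> + s) + - ?c (\<theta> - s)) / 2"
  proof -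
    define g where "g \<theta> x = 1 - cos (\<theta> * x)" for \<theta> x :: real
    have int: "integrable L (g \<theta>)" for \<theta> unfolding g_def by (rule integrable_one_minus_cos)
    have "cos (\<theta> * y) * (1 - cos (s * y)) = - g \<theta> y + (g (\<theta> + s) y + g (\<theta> - s) y) / 2" for y
      unfolding trig g_def by (simp add: field_simps)
    then have "(\<integral>x. cos (\<theta> * x) * (1 - cos (s * x)) \<partial>L) =
        (\<integral>x. - g \<theta> x + (g (\<theta> + s) x + g (\<theta> - s) x) / 2 \<partial>L)" by simp
    also have "\<dots> = - (\<integral>x. g \<theta> x \<partial>L) + ((\<integral>x. g (\<theta> + s) x \<partial>L) + (\<integral>x. g (\<theta> - s) x \<partial>L)) / 2"
      by (simp add: int)
    also have "\<dots> = - (\<integral>x. g \<theta> x \<partial>L) - (- (\<integral>x. g (\<theta> + s) x \<partial>L) + - (\<integral>x. g (\<theta> - s) x \<partial>L)) / 2"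
      by (simp add: field_simps)
    finally show ?thesis unfolding g_def .
  qed
  ultimately show ?thesis
    by (simp only:) (intro tendsto_intros scaled_cos_tendsto, simp)
qed

end

section \<open>Jumps of a Levy process on a grid\<close>

lemma levy_process_measurable_path:
  assumes X: "levy_process M X" and t: "0 < t"
  shows "(\<lambda>\<omega> \<tau>. X (\<tau> * t) \<omega>) \<in> measurable M path_space"
proof (rule measurable_path_spaceI)
  fix \<omega> assume \<omega>: "\<omega> \<in> space M"
  show "cadlag01 (\<lambda>\<tau>. X (\<tau> * t) \<omega>)" unfolding cadlag01_def
  proof (intro conjI ballI)
    fix \<tau> :: real assume "\<tau> \<in> {0..<1}"
    then have "((\<lambda>s. X s \<omega>) \<longlongrightarrow> X (\<tau> * t) \<omega>) (at_right (\<tau> * t))"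
      using X \<omega> t by (simp add: levy_process_def)
    moreover have "filterlim (\<lambda>s. s * t) (at_right (\<tau> * t)) (at_right \<tau>)"
      unfolding filterlim_at using t
      by (auto intro!: tendsto_intros simp: eventually_at_right_field intro: exI[of _ "\<tau> + 1"])
    ultimately show "((\<lambda>\<tau>. X (\<tau> * t) \<omega>) \<longlongrightarrow> X (\<tau> * t) \<omega>) (at_right \<tau>)"
      by (rule filterlim_compose)
  next
    fix \<tau> :: real assume "\<tau> \<in> {0<..1}"
    then have "0 < \<tau> * t" using t by simp
    then obtain l where "((\<lambda>s. X s \<omega>) \<longlongrightarrow> l) (at_left (\<tau> * t))"
      using X \<omega> unfolding levy_process_def by blast
    moreover have "filterlim (\<lambda>s. s * t) (at_left (\<tau> * t)) (at_left \<tau>)"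
      unfolding filterlim_at using t
      by (auto intro!: tendsto_intros simp: eventually_at_left_field intro: exI[of _ "\<tau> - 1"])
    ultimately show "\<exists>l. ((\<lambda>\<tau>. X (\<tau> * t) \<omega>) \<longlongrightarrow> l) (at_left \<tau>)"
      using filterlim_compose by blast
  qed
next
  show "(\<lambda>\<omega>. X (\<tau> * t) \<omega>) \<in> borel_measurable M" if "0 \<le> \<tau>" for \<tau>
    using X t that by (simp add: levy_process_def)
qed

definition grid_increment :: "(real \<Rightarrow> 'a \<Rightarrow> real) \<Rightarrow> nat \<Rightarrow> nat \<Rightarrow> 'a \<Rightarrow> real" where
  "grid_increment X n k \<omega> = X (real (Suc k) / real n) \<omega> - X (real k / real n) \<omega>"

text \<open>The index picks the cell whose left end is strictly below \<open>s\<close> and whose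
  right end is at least \<open>s\<close>. Both ends converge to \<open>s\<close>, so the increment
  tends to the value minus the left limit.\<close>

lemma grid_increment_tendsto_jump:
  assumes X: "levy_process M X" and \<omega>: "\<omega> \<in> space M" and s: "0 < s"
  shows "(\<lambda>n. grid_increment X n (nat \<lceil>real n * s\<rceil> - 1) \<omega>) \<longlonglongrightarrow> jump (\<lambda>u. X u \<omega>) s"
proof -
  let ?h = "\<lambda>u. X u \<omega>"
  have R: "(?h \<longlongrightarrow> ?h s) (at_right s)" using X \<omega> s by (simp add: levy_process_def)
  obtain l where L: "(?h \<longlongrightarrow> l) (at_left s)" using X \<omega> s unfolding levy_process_def by blast
  have lim: "(\<lambda>n. 1 / real n) \<longlonglongrightarrow> 0" by (rule lim_1_over_n)
  have c: "real n * s \<le> real_of_int \<lceil>real n * s\<rceil>" "real_of_int \<lceil>real n * s\<rceil> < real n * s + 1" for n by linarith+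
  define k where "k n = nat \<lceil>real n * s\<rceil> - 1" for n
  have k: "real (Suc (k n)) = real_of_int \<lceil>real n * s\<rceil>" "real (k n) = real_of_int \<lceil>real n * s\<rceil> - 1" if n: "0 < n" for n
  proof -
    have "0 < \<lceil>real n * s\<rceil>" using n s by simp
    then show "real (Suc (k n)) = real_of_int \<lceil>real n * s\<rceil>" "real (k n) = real_of_int \<lceil>real n * s\<rceil> - 1"
      unfolding k_def by linarith+
  qed
  have up: "s \<le> real (Suc (k n)) / real n" "real (Suc (k n)) / real n < s + 1 / real n" if n: "0 < n" for n
    unfolding k(1)[OF n] using c[of n] n by (simp_all add: field_simps)
  have lo: "s - 1 / real n \<le> real (k n) / real n" "real (k n) / real n < s" if n: "0 < n" for n
    unfolding k(2)[OF n] using c[of n] n by (simp_all add: field_simps)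
  have "(\<lambda>n. ?h (real (Suc (k n)) / real n)) \<longlonglongrightarrow> ?h s"
  proof (rule tendstoI)
    fix e :: real assume e: "0 < e"
    obtain b where b: "b > s" "\<And>u. s < u \<Longrightarrow> u < b \<Longrightarrow> dist (?h u) (?h s) < e"
      using tendstoD[OF R e] unfolding eventually_at_right_field by blast
    have "eventually (\<lambda>n. 1 / real n < b - s) sequentially" using order_tendstoD(2)[OF lim] b(1) by simp
    then show "eventually (\<lambda>n. dist (?h (real (Suc (k n)) / real n)) (?h s) < e) sequentially"
      using eventually_gt_at_top[of 0]
    proof eventually_elim
      case (elim n)
      \<comment> \<open>The right end may hit \<open>s\<close> exactly, which the right limit does
        not cover.\<close>
      show ?case
      proof (cases "real (Suc (k n)) / real n = s")
        case False
        then show ?thesis using up[OF elim(2)] elim(1) by (intro b(2)) linarith+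
      qed (use e in simp)
    qed
  qed
  moreover have "(\<lambda>n. ?h (real (k n) / real n)) \<longlonglongrightarrow> l"
  proof (rule tendstoI)
    fix e :: real assume e: "0 < e"
    obtain b where b: "b < s" "\<And>u. b < u \<Longrightarrow> u < s \<Longrightarrow> dist (?h u) l < e"
      using tendstoD[OF L e] unfolding eventually_at_left_field by blast
    have "eventually (\<lambda>n. 1 / real n < s - b) sequentially" using order_tendstoD(2)[OF lim] b(1) by simp
    then show "eventually (\<lambda>n. dist (?h (real (k n) / real n)) l < e) sequentially"
      using eventually_gt_at_top[of 0]
    proof eventually_elim
      case (elim n)
      show ?case using lo[OF elim(2)] elim(1) by (intro b(2)) linarith+
    qed
  qed
  ultimately have "(\<lambda>n. ?h (real (Suc (k n)) / real n) - ?h (real (k n) / real n)) \<longlonglongrightarrow> ?h s - l"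
    by (rule tendsto_diff)
  then show ?thesis unfolding jump_eqI[OF s L] grid_increment_def k_def .
qed

lemma grid_increment_measurable:
  assumes X: "levy_process M X"
  shows "grid_increment X n k \<in> borel_measurable M"
proof -
  have "X (real j / real n) \<in> borel_measurable M" for j using X by (simp add: levy_process_def)
  from borel_measurable_diff[OF this this] show ?thesis unfolding grid_increment_def[abs_def] .
qed

text \<open>Increments over distinct cells are independent with common law \<mu>, so their joint law
  is the product measure.\<close>

lemma expectation_grid_increments:
  fixes h :: "real \<Rightarrow> real \<Rightarrow> real"
  assumes X: "levy_process M X" and kl: "k < n" "l < n" "k \<noteq> l"
    and h: "case_prod h \<in> borel_measurable (borel \<Otimes>\<^sub>M borel)" and bd: "\<And>y z. \<bar>h y z\<bar> \<le> C"
  defines "\<mu> \<equiv> distr M borel (X (1 / real n))"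
  shows "(\<integral>\<omega>. h (grid_increment X n k \<omega>) (grid_increment X n l \<omega>) \<partial>M) = (\<integral>y. (\<integral>z. h y z \<partial>\<mu>) \<partial>\<mu>)"
proof -
  interpret M: prob_space M using X by (simp add: levy_process_def)
  have Xm: "X t \<in> borel_measurable M" if "0 \<le> t" for t using X that by (simp add: levy_process_def)
  note Zm [measurable] = grid_increment_measurable[OF X, of n]
  have dist: "distr M borel (grid_increment X n j) = \<mu>" for j
  proof -
    have st: "\<forall>s\<ge>0. \<forall>t\<ge>0. distr M borel (\<lambda>\<omega>. X (t + s) \<omega> - X s \<omega>) = distr M borel (X t)"
      using X by (simp add: levy_process_def)
    have "distr M borel (\<lambda>\<omega>. X (1 / real n + real j / real n) \<omega> - X (real j / real n) \<omega>) = \<mu>"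
      unfolding \<mu>_def using st by simp
    then show ?thesis by (simp add: grid_increment_def[abs_def] add_divide_distrib add.commute)
  qed
  have "\<forall>(n::nat) ts. 0 \<le> ts 0 \<and> (\<forall>i<n. ts i \<le> ts (Suc i)) \<longrightarrow>
      M.indep_vars (\<lambda>_. borel) (\<lambda>i \<omega>. X (ts (Suc i)) \<omega> - X (ts i) \<omega>) {..<n}"
    using X by (simp add: levy_process_def)
  from this[rule_format, of "\<lambda>i. real i / real n" n]
  have "M.indep_vars (\<lambda>_. borel) (\<lambda>i. grid_increment X n i) {..<n}"
    unfolding grid_increment_def[abs_def] by (simp add: divide_right_mono)
  from M.indep_var_restrict[OF this, of "{k}" "{l}"] kl
  have "M.indep_var (PiM {k} (\<lambda>_. borel)) (\<lambda>\<omega>. \<lambda>i\<in>{k}. grid_increment X n i \<omega>)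
      (PiM {l} (\<lambda>_. borel)) (\<lambda>\<omega>. \<lambda>i\<in>{l}. grid_increment X n i \<omega>)" by auto
  from M.indep_var_compose[OF this measurable_component_singleton measurable_component_singleton, of k l]
  have "M.indep_var borel (grid_increment X n k) borel (grid_increment X n l)" by (simp add: comp_def)
  then have J: "\<mu> \<Otimes>\<^sub>M \<mu> = distr M (borel \<Otimes>\<^sub>M borel) (\<lambda>\<omega>. (grid_increment X n k \<omega>, grid_increment X n l \<omega>))"
    unfolding M.indep_var_distribution_eq dist by simp
  interpret \<mu>: prob_space \<mu> unfolding \<mu>_def by (rule M.prob_space_distr) (rule Xm, simp)
  have \<mu>: "finite_measure \<mu>" "sets \<mu> = sets borel" by (auto simp: \<mu>_def intro: \<mu>.finite_measure_axioms[unfolded \<mu>_def])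
  have "(\<integral>y. (\<integral>z. h y z \<partial>\<mu>) \<partial>\<mu>) = (\<integral>z. case_prod h z \<partial>(\<mu> \<Otimes>\<^sub>M \<mu>))"
    by (rule fubini_bounded(2)[OF \<mu> \<mu> h bd])
  also have "\<dots> = (\<integral>\<omega>. h (grid_increment X n k \<omega>) (grid_increment X n l \<omega>) \<partial>M)"
    unfolding J by (subst integral_distr) (use h in auto)
  finally show ?thesis ..
qed

text \<open>Diagonal pairs are left out, as every increment ties with itself. The weights are
  quadratic in small increments, which keeps the mean bounded although the number of pairs grows
  like the square of \<open>n\<close>.\<close>

definition tie_statistic :: "(real \<Rightarrow> 'a \<Rightarrow> real) \<Rightarrow> real \<Rightarrow> real \<Rightarrow> nat \<Rightarrow> 'a \<Rightarrow> real" where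
  "tie_statistic X s a n \<omega> = (\<Sum>k<n. \<Sum>l\<in>{..<n} - {k}.
    (1 - cos (s * grid_increment X n k \<omega>)) * (1 - cos (s * grid_increment X n l \<omega>)) *
    tie_kernel a (grid_increment X n k \<omega>) (grid_increment X n l \<omega>))"

lemma one_minus_cos_bounds: "0 \<le> 1 - cos (u::real)" "1 - cos (u::real) \<le> 2"
  using cos_ge_minus_one[of u] by auto

lemma tie_weight_bounds:
  "0 \<le> (1 - cos (s * y)) * (1 - cos (s * z)) * tie_kernel a y z"
  "\<bar>(1 - cos (s * y)) * (1 - cos (s * z)) * tie_kernel a y z\<bar> \<le> 4"
proof -
  show nn: "0 \<le> (1 - cos (s * y)) * (1 - cos (s * z)) * tie_kernel a y z"
    using one_minus_cos_bounds tie_kernel_bounds by (intro mult_nonneg_nonneg) auto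
  have "(1 - cos (s * y)) * (1 - cos (s * z)) * tie_kernel a y z \<le> 2 * 2 * 1"
    using one_minus_cos_bounds tie_kernel_bounds by (intro mult_mono) auto
  with nn show "\<bar>(1 - cos (s * y)) * (1 - cos (s * z)) * tie_kernel a y z\<bar> \<le> 4" by simp
qed

lemma tie_statistic_nonneg: "0 \<le> tie_statistic X s a n \<omega>"
  unfolding tie_statistic_def by (intro sum_nonneg tie_weight_bounds)

lemma tie_statistic_measurable:
  assumes X: "levy_process M X"
  shows "tie_statistic X s a n \<in> borel_measurable M"
proof -
  note [measurable] = grid_increment_measurable[OF X]
  show ?thesis unfolding tie_statistic_def[abs_def] by measurable
qed

text \<open>All pairs have the same expectation \<open>q\<close>, and at most \<open>n * n\<close>
  of them occur; the two factors \<open>n\<close> are absorbed into the densities of the two copies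
  of \<nu>.\<close>

lemma nn_integral_tie_statistic_le:
  fixes s a :: real
  assumes X: "levy_process M X" and n: "0 < n"
  defines "\<nu> \<equiv> density (distr M borel (X (1 / real n))) (\<lambda>y. real n * (1 - cos (s * y)))"
  shows "(\<integral>\<^sup>+\<omega>. ennreal (tie_statistic X s a n \<omega>) \<partial>M) \<le> ennreal (\<integral>y. (\<integral>z. tie_kernel a y z \<partial>\<nu>) \<partial>\<nu>)"
proof -
  interpret M: prob_space M using X by (simp add: levy_process_def)
  define \<mu> where "\<mu> = distr M borel (X (1 / real n))"
  have [measurable_cong]: "sets \<mu> = sets borel" by (simp add: \<mu>_def)
  have Xm: "X (1 / real n) \<in> borel_measurable M" using X by (simp add: levy_process_def)
  interpret \<mu>: prob_space \<mu> unfolding \<mu>_def by (rule M.prob_space_distr[OF Xm])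
  note [measurable] = grid_increment_measurable[OF X]
  let ?w = "\<lambda>y. 1 - cos (s * y)"
  let ?h = "\<lambda>y z. ?w y * ?w z * tie_kernel a y z"
  define q where "q = (\<integral>y. (\<integral>z. ?h y z \<partial>\<mu>) \<partial>\<mu>)"
  have int: "integrable M (\<lambda>\<omega>. ?h (grid_increment X n k \<omega>) (grid_increment X n l \<omega>))" for k l
    by (rule M.integrable_const_bound[of _ 4]) (use tie_weight_bounds in auto)
  have q0: "0 \<le> q" unfolding q_def by (intro Bochner_Integration.integral_nonneg tie_weight_bounds)
  have "(\<integral>\<^sup>+\<omega>. ennreal (tie_statistic X s a n \<omega>) \<partial>M) = ennreal (\<integral>\<omega>. tie_statistic X s a n \<omega> \<partial>M)"
  proof (rule nn_integral_eq_integral)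
    show "integrable M (tie_statistic X s a n)"
      unfolding tie_statistic_def[abs_def] by (intro Bochner_Integration.integrable_sum int)
  qed (simp add: tie_statistic_nonneg)
  also have "(\<integral>\<omega>. tie_statistic X s a n \<omega> \<partial>M) = (\<Sum>k<n. \<Sum>l\<in>{..<n} - {k}. q)"
    unfolding tie_statistic_def
    by (subst Bochner_Integration.integral_sum, intro Bochner_Integration.integrable_sum int, rule sum.cong[OF refl],
        subst Bochner_Integration.integral_sum, rule int, rule sum.cong[OF refl])
      (auto simp: q_def \<mu>_def intro!: expectation_grid_increments[OF X, of _ n _ ?h 4] tie_weight_bounds(2))
  \<comment> \<open>Putting diagonal terms back only increases the sum, as \<open>q\<close> is
    nonnegative, and yields a full square.\<close>
  also have "\<dots> \<le> (\<Sum>k<n. \<Sum>l<n. q)"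
    using q0 by (intro sum_mono sum_mono2) auto
  also have "\<dots> = (real n)\<^sup>2 * q" by (simp add: power2_eq_square)
  also have "\<dots> = (\<integral>y. (\<integral>z. tie_kernel a y z \<partial>\<nu>) \<partial>\<nu>)"
  proof -
    have wn: "AE y in \<mu>. 0 \<le> real n * ?w y" using one_minus_cos_bounds by (intro AE_I2) simp
    have wm: "(\<lambda>y. real n * ?w y) \<in> borel_measurable \<mu>" by (simp add: \<mu>_def)
    have km: "tie_kernel a y \<in> borel_measurable \<mu>" for y
      unfolding \<mu>_def measurable_distr_eq1 tie_kernel_def[abs_def] by measurable
    have inner: "(\<integral>z. tie_kernel a y z \<partial>\<nu>) = real n * (\<integral>z. ?w z * tie_kernel a y z \<partial>\<mu>)" for y
      unfolding \<nu>_def \<mu>_def[symmetric]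
      by (subst integral_density[OF km wm wn]) (simp add: mult.assoc)
    have im: "(\<lambda>y. real n * (\<integral>z. ?w z * tie_kernel a y z \<partial>\<mu>)) \<in> borel_measurable \<mu>"
      by measurable
    have "(\<integral>y. (\<integral>z. tie_kernel a y z \<partial>\<nu>) \<partial>\<nu>) =
        (\<integral>y. (real n * ?w y) * (real n * (\<integral>z. ?w z * tie_kernel a y z \<partial>\<mu>)) \<partial>\<mu>)"
      unfolding inner unfolding \<nu>_def \<mu>_def[symmetric]
      by (subst integral_density[OF im wm wn]) simp
    also have "\<dots> = (\<integral>y. (real n)\<^sup>2 * (\<integral>z. ?h y z \<partial>\<mu>) \<partial>\<mu>)"
    proof (intro Bochner_Integration.integral_cong refl)
      fix y
      have "(\<integral>z. ?h y z \<partial>\<mu>) = ?w y * (\<integral>z. ?w z * tie_kernel a y z \<partial>\<mu>)"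
        by (simp only: mult.assoc integral_mult_right_zero)
      then show "(real n * ?w y) * (real n * (\<integral>z. ?w z * tie_kernel a y z \<partial>\<mu>)) = (real n)\<^sup>2 * (\<integral>z. ?h y z \<partial>\<mu>)"
        by (simp only: power2_eq_square mult_ac)
    qed
    finally show ?thesis by (simp add: q_def)
  qed
  finally show ?thesis by (simp add: ennreal_leI)
qed

text \<open>Two tied jumps eventually fall into distinct cells, and all summands are nonnegative, so
  their pair alone bounds the sum. Its term tends to the squared weight times a kernel value of at
  least \<open>1 / 2\<close>; the factor \<open>1 / 4\<close> leaves room for the limit. The bound
  is independent of \<open>a\<close>.\<close>

lemma tie_statistic_bounded_below:
  assumes X: "levy_process M X" and \<omega>: "\<omega> \<in> space M" and u: "0 < u" "u < t" "t \<le> 1"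
    and tie: "\<bar>jump (\<lambda>r. X r \<omega>) u\<bar> = \<bar>jump (\<lambda>r. X r \<omega>) t\<bar>"
    and c: "cos (s * jump (\<lambda>r. X r \<omega>) u) \<noteq> 1"
  shows "eventually (\<lambda>n. (1 - cos (s * jump (\<lambda>r. X r \<omega>) u))\<^sup>2 / 4 \<le> tie_statistic X s a n \<omega>) sequentially"
proof -
  define y z where "y = jump (\<lambda>r. X r \<omega>) u" and "z = jump (\<lambda>r. X r \<omega>) t"
  define k where "k r n = nat \<lceil>real n * r\<rceil> - 1" for r n
  let ?h = "\<lambda>y z. (1 - cos (s * y)) * (1 - cos (s * z)) * tie_kernel a y z"
  have "(\<lambda>n. ?h (grid_increment X n (k u n) \<omega>) (grid_increment X n (k t n) \<omega>)) \<longlonglongrightarrow> ?h y z"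
    unfolding tie_kernel_def k_def y_def z_def
    by (intro tendsto_intros grid_increment_tendsto_jump[OF X \<omega>]) (use u in auto)
  moreover have "(1 - cos (s * y))\<^sup>2 / 4 < ?h y z"
  proof -
    have yz: "\<bar>y\<bar> = \<bar>z\<bar>" using tie by (simp add: y_def z_def)
    then have "cos (s * z) = cos (s * y)" by (metis abs_mult cos_abs_real)
    moreover have "1 / 2 \<le> tie_kernel a y z"
    proof -
      have "y - z = 0 \<or> y + z = 0" using yz by (auto simp: abs_if split: if_splits)
      then show ?thesis by (auto simp: tie_kernel_def add_divide_distrib)
    qed
    moreover have p: "0 < (1 - cos (s * y))\<^sup>2" using c by (simp add: y_def)
    ultimately have "(1 - cos (s * y))\<^sup>2 * (1 / 2) \<le> ?h y z"
      by (simp only: power2_eq_square) (intro mult_left_mono, auto)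
    with p show ?thesis by linarith
  qed
  ultimately have 1: "eventually (\<lambda>n. (1 - cos (s * y))\<^sup>2 / 4 <
      ?h (grid_increment X n (k u n) \<omega>) (grid_increment X n (k t n) \<omega>)) sequentially"
    by (rule order_tendstoD(1))
  have "eventually (\<lambda>n. 1 / real n < t - u) sequentially"
    using order_tendstoD(2)[OF lim_1_over_n[where 'a = real]] u by simp
  with 1 show ?thesis using eventually_gt_at_top[of 0]
  proof eventually_elim
    case (elim n)
    \<comment> \<open>Once the mesh is below \<open>t - u\<close> the two ceilings differ;
      \<open>t \<le> 1\<close> will keep the indices below \<open>n\<close>.\<close>
    have "real n * u + 1 < real n * t" using elim(2,3) by (simp add: field_simps)
    then have lt: "\<lceil>real n * u\<rceil> < \<lceil>real n * t\<rceil>" by linarith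
    have "0 < real n * u" using elim(3) u by simp
    then have pos: "0 < \<lceil>real n * u\<rceil>" by linarith
    have "real n * t \<le> real n" using u by (intro mult_left_le) auto
    then have "\<lceil>real n * t\<rceil> \<le> int n" by linarith
    moreover have "nat p - 1 < n \<and> nat q - 1 < n \<and> nat p - 1 \<noteq> nat q - 1"
      if "0 < p" "p < q" "q \<le> int n" for p q :: int using that by arith
    ultimately have kn: "k u n < n" "k t n < n" "k u n \<noteq> k t n" unfolding k_def using lt pos by blast+
    have "?h (grid_increment X n (k u n) \<omega>) (grid_increment X n (k t n) \<omega>) \<le>
        (\<Sum>l\<in>{..<n} - {k u n}. ?h (grid_increment X n (k u n) \<omega>) (grid_increment X n l \<omega>))"
      by (rule member_le_sum) (use kn tie_weight_bounds in auto)
    also have "\<dots> \<le> tie_statistic X s a n \<omega>"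
      unfolding tie_statistic_def
      by (rule member_le_sum[of "k u n" "{..<n}" "\<lambda>k. \<Sum>l\<in>{..<n} - {k}. ?h (grid_increment X n k \<omega>) (grid_increment X n l \<omega>)"])
        (use kn tie_weight_bounds in \<open>auto intro!: sum_nonneg\<close>)
    finally show ?case using elim(1) by (simp add: y_def)
  qed
qed

text \<open>Fatou is applied twice, to the grid limit at a fixed kernel width and then to the width.
  The iterated lower limit has mean \<open>0\<close>, yet on a tie with nonvanishing weight it is
  bounded below. Uncountably many pairs of times could carry a tie, and the statistic treats them
  all in one event.\<close>

lemma AE_no_tie:
  assumes X: "levy_process M X" and trip: "levy_triplet M X \<gamma> 0 L"
    and at: "\<And>y. AE z in L. \<bar>y\<bar> \<noteq> \<bar>z\<bar>"
  shows "AE \<omega> in M. \<forall>u t. 0 < u \<longrightarrow> u < t \<longrightarrow> t \<le> 1 \<longrightarrow>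
    \<bar>jump (\<lambda>r. X r \<omega>) u\<bar> = \<bar>jump (\<lambda>r. X r \<omega>) t\<bar> \<longrightarrow> cos (s * jump (\<lambda>r. X r \<omega>) u) = 1"
proof -
  interpret M: prob_space M using X by (simp add: levy_process_def)
  note sL [measurable_cong] = sets_levy_measure[OF X trip]
  define \<mu> where "\<mu> n = distr M borel (X (1 / real n))" for n
  have s\<mu> [measurable_cong]: "sets (\<mu> n) = sets borel" for n by (simp add: \<mu>_def)
  have P\<mu>: "prob_space (\<mu> n)" for n
    unfolding \<mu>_def using X by (intro M.prob_space_distr) (simp add: levy_process_def)
  \<comment> \<open>\<open>n\<close> times the law of one increment approximates the Levy measure
    away from \<open>0\<close>; the weight makes both sides finite measures.\<close>
  define \<nu>n where "\<nu>n n = density (\<mu> n) (\<lambda>y. real n * (1 - cos (s * y)))" for n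
  define \<nu> where "\<nu> = density L (\<lambda>y. 1 - cos (s * y))"
  have \<nu>n: "finite_measure (\<nu>n n)" "sets (\<nu>n n) = sets borel" for n
  proof -
    interpret \<mu>: prob_space "\<mu> n" by (rule P\<mu>)
    show "finite_measure (\<nu>n n)" unfolding \<nu>n_def
    proof (rule finite_measure_density)
      show "integrable (\<mu> n) (\<lambda>y. real n * (1 - cos (s * y)))"
      proof (rule \<mu>.integrable_const_bound[of _ "real n * 2"])
        show "AE y in \<mu> n. norm (real n * (1 - cos (s * y))) \<le> real n * 2"
          using one_minus_cos_bounds by (intro AE_I2) (simp add: abs_mult mult_left_mono)
      qed (simp add: \<mu>_def)
    qed (use one_minus_cos_bounds in auto)
  qed (simp add: \<nu>n_def s\<mu>)
  have \<nu>: "finite_measure \<nu>" "sets \<nu> = sets borel"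
    unfolding \<nu>_def using integrable_one_minus_cos[OF X trip] one_minus_cos_bounds
    by (auto intro!: finite_measure_density simp: sL)
  have conv: "(\<lambda>n. \<integral>y. cos (\<theta> * y) \<partial>\<nu>n n) \<longlonglongrightarrow> (\<integral>y. cos (\<theta> * y) \<partial>\<nu>)" for \<theta>
  proof -
    have "(\<integral>y. cos (\<theta> * y) \<partial>\<nu>n n) = real n * (\<integral>y. cos (\<theta> * y) * (1 - cos (s * y)) \<partial>\<mu> n)" for n
    proof -
      have wm: "(\<lambda>y. real n * (1 - cos (s * y))) \<in> borel_measurable (\<mu> n)"
        and cm: "(\<lambda>y. cos (\<theta> * y)) \<in> borel_measurable (\<mu> n)" by (auto simp: \<mu>_def)
      have wn: "AE y in \<mu> n. 0 \<le> real n * (1 - cos (s * y))"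
        using one_minus_cos_bounds by (intro AE_I2) simp
      show ?thesis
        unfolding \<nu>n_def by (subst integral_density[OF cm wm wn]) (simp add: mult.assoc mult.commute[of "cos (\<theta> * _)"])
    qed
    moreover have "(\<integral>y. cos (\<theta> * y) \<partial>\<nu>) = (\<integral>y. cos (\<theta> * y) * (1 - cos (s * y)) \<partial>L)"
    proof -
      have wm: "(\<lambda>y. 1 - cos (s * y)) \<in> borel_measurable L" and cm: "(\<lambda>y. cos (\<theta> * y)) \<in> borel_measurable L"
        by measurable
      show ?thesis
        unfolding \<nu>_def using one_minus_cos_bounds
        by (subst integral_density[OF cm wm]) (simp_all add: mult.commute[of "cos (\<theta> * _)"])
    qed
    ultimately show ?thesis using scaled_weighted_cos_tendsto[OF X trip, of \<theta> s] by (simp add: \<mu>_def)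
  qed
  have at\<nu>: "AE y in \<nu>. AE z in \<nu>. \<bar>y\<bar> \<noteq> \<bar>z\<bar>"
  proof (rule AE_I2)
    fix y
    show "AE z in \<nu>. \<bar>y\<bar> \<noteq> \<bar>z\<bar>" unfolding \<nu>_def
      by (subst AE_density) (use at[of y] in auto)
  qed
  \<comment> \<open>Lower limits suffice: an upper bound on the mean meets a pathwise lower
    bound.\<close>
  define V where "V j \<omega> = liminf (\<lambda>n. ennreal (tie_statistic X s (real j) n \<omega>))" for j \<omega>
  note [measurable] = tie_statistic_measurable[OF X]
  have Vm [measurable]: "V j \<in> borel_measurable M" for j unfolding V_def by measurable
  have V: "(\<integral>\<^sup>+\<omega>. V j \<omega> \<partial>M) \<le> ennreal (\<integral>y. (\<integral>z. tie_kernel (real j) y z \<partial>\<nu>) \<partial>\<nu>)" for j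
  proof -
    have "(\<integral>\<^sup>+\<omega>. V j \<omega> \<partial>M) \<le> liminf (\<lambda>n. \<integral>\<^sup>+\<omega>. ennreal (tie_statistic X s (real j) n \<omega>) \<partial>M)"
      unfolding V_def by (rule nn_integral_liminf) measurable
    also have "\<dots> \<le> liminf (\<lambda>n. ennreal (\<integral>y. (\<integral>z. tie_kernel (real j) y z \<partial>\<nu>n n) \<partial>\<nu>n n))"
      using nn_integral_tie_statistic_le[OF X, of _ s "real j"]
      by (intro Liminf_mono) (auto simp: eventually_sequentially \<nu>n_def \<mu>_def intro!: exI[of _ 1])
    also have "\<dots> = ennreal (\<integral>y. (\<integral>z. tie_kernel (real j) y z \<partial>\<nu>) \<partial>\<nu>)"
      by (intro lim_imp_Liminf tendsto_ennrealI integral_tie_kernel_tendsto \<nu>n \<nu> conv) simp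
    finally show ?thesis .
  qed
  have "(\<integral>\<^sup>+\<omega>. liminf (\<lambda>j. V j \<omega>) \<partial>M) \<le> liminf (\<lambda>j. \<integral>\<^sup>+\<omega>. V j \<omega> \<partial>M)"
    by (rule nn_integral_liminf) measurable
  also have "\<dots> \<le> liminf (\<lambda>j. ennreal (\<integral>y. (\<integral>z. tie_kernel (real j) y z \<partial>\<nu>) \<partial>\<nu>))"
    by (intro Liminf_mono) (simp add: V)
  also have "\<dots> = ennreal 0"
    by (intro lim_imp_Liminf tendsto_ennrealI integral_tie_kernel_tendsto_0 \<nu> at\<nu>) simp
  finally have "(\<integral>\<^sup>+\<omega>. liminf (\<lambda>j. V j \<omega>) \<partial>M) = 0" by simp
  then have "AE \<omega> in M. liminf (\<lambda>j. V j \<omega>) = 0"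
    by (subst (asm) nn_integral_0_iff_AE) measurable
  then show ?thesis using AE_space
  proof eventually_elim
    case (elim \<omega>)
    show ?case
    proof (intro allI impI, rule ccontr)
      fix u t :: real
      assume *: "0 < u" "u < t" "t \<le> 1" "\<bar>jump (\<lambda>r. X r \<omega>) u\<bar> = \<bar>jump (\<lambda>r. X r \<omega>) t\<bar>"
        "cos (s * jump (\<lambda>r. X r \<omega>) u) \<noteq> 1"
      let ?c = "ennreal ((1 - cos (s * jump (\<lambda>r. X r \<omega>) u))\<^sup>2 / 4)"
      \<comment> \<open>The constant \<open>?c\<close> does not involve \<open>j\<close>, so it
        passes to the lower limit over \<open>j\<close>.\<close>
      have "?c \<le> V j \<omega>" for j
        unfolding V_def
        by (rule Liminf_bounded)
          (use tie_statistic_bounded_below[OF X elim(2) *, of "real j"] in \<open>auto elim!: eventually_mono intro: ennreal_leI\<close>)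
      then have "?c \<le> liminf (\<lambda>j. V j \<omega>)" by (intro Liminf_bounded) simp
      then show False using elim(1) *(5) by (simp add: ennreal_eq_0_iff)
    qed
  qed
qed

text \<open>A single frequency \<open>s\<close> is blind to jumps in the multiples of
  \<open>2 * pi / s\<close>. The countably many frequencies \<open>1 / (m + 1)\<close> together
  detect every nonzero jump, since \<open>v / (m + 1)\<close> finally lies within distance
  \<open>1\<close> of \<open>0\<close>, where the cosine equals \<open>1\<close> only at
  \<open>0\<close>.\<close>

lemma exists_cos_divide_ne_1:
  fixes v :: real
  assumes "v \<noteq> 0"
  obtains m :: nat where "cos (v / real (Suc m)) \<noteq> 1"
proof -
  obtain m :: nat where m: "\<bar>v\<bar> < real m" using reals_Archimedean2 by blast
  define u where "u = \<bar>v\<bar> / real (Suc m)"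
  have u: "0 < u" "u < 1" using assms m by (auto simp: u_def)
  have "cos u < cos 0" using u pi_gt3 by (intro cos_monotone_0_pi) auto
  moreover have "cos u = cos (v / real (Suc m))" unfolding u_def by (metis abs_divide abs_of_nat cos_abs_real)
  ultimately show ?thesis using that[of m] by simp
qed

lemma AE_tie_free:
  assumes X: "levy_process M X" and trip: "levy_triplet M X \<gamma> 0 L"
    and at: "\<And>y. AE z in L. \<bar>y\<bar> \<noteq> \<bar>z\<bar>"
  shows "AE \<omega> in M. tie_free (\<lambda>\<tau>. X \<tau> \<omega>)"
proof -
  have "AE \<omega> in M. \<forall>m::nat. \<forall>u t. 0 < u \<longrightarrow> u < t \<longrightarrow> t \<le> 1 \<longrightarrow>
    \<bar>jump (\<lambda>r. X r \<omega>) u\<bar> = \<bar>jump (\<lambda>r. X r \<omega>) t\<bar> \<longrightarrow> cos (1 / real (Suc m) * jump (\<lambda>r. X r \<omega>) u) = 1"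
    unfolding AE_all_countable using AE_no_tie[OF X trip at] by blast
  then show ?thesis
  proof eventually_elim
    case (elim \<omega>)
    let ?x = "\<lambda>r. X r \<omega>"
    have *: "jump ?x u = 0" if "0 < u" "u < t" "t \<le> 1" "\<bar>jump ?x u\<bar> = \<bar>jump ?x t\<bar>" for u t
    proof (rule ccontr)
      assume "jump ?x u \<noteq> 0"
      then obtain m :: nat where "cos (jump ?x u / real (Suc m)) \<noteq> 1" using exists_cos_divide_ne_1 by blast
      then show False using elim that by (metis mult_1 times_divide_eq_left)
    qed
    then show ?case by (rule tie_freeI)
  qed
qed

text \<open>The two points carry no more mass than the tail loses between \<open>x\<close> and
  \<open>v\<close>, that is \<open>g x - g v\<close>, and this tends to \<open>0\<close> as
  \<open>x\<close> increases to \<open>v\<close>. The case \<open>v = 0\<close> is the assumption on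
  \<open>{0}\<close>.\<close>

lemma AE_abs_ne_of_continuous_tail:
  fixes L :: "real measure"
  assumes s: "sets L = sets borel" and 0: "emeasure L {0} = 0"
    and tail: "\<And>x. 0 < x \<Longrightarrow> emeasure L (UNIV - {-x..x}) = ennreal (g x)"
    and g: "\<And>x. 0 < x \<Longrightarrow> isCont g x" "\<And>x. 0 < x \<Longrightarrow> 0 \<le> g x"
  shows "AE z in L. \<bar>y\<bar> \<noteq> \<bar>z\<bar>"
proof -
  have [measurable_cong]: "sets L = sets borel" by (rule s)
  define v where "v = \<bar>y\<bar>"
  have "emeasure L {v, - v} = 0"
  proof (cases "v = 0")
    case True
    then show ?thesis using 0 by simp
  next
    case False
    then have v: "0 < v" by (simp add: v_def)
    have le: "emeasure L {v, - v} \<le> ennreal (g x - g v)" if x: "0 < x" "x < v" for x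
    proof -
      have "emeasure L {v, - v} + ennreal (g v) = emeasure L ({v, - v} \<union> (UNIV - {-v..v}))"
        unfolding tail[OF v, symmetric] using v by (intro plus_emeasure) (auto simp: s)
      also have "\<dots> \<le> emeasure L (UNIV - {-x..x})"
        using x v by (intro emeasure_mono) (auto simp: s)
      finally have "emeasure L {v, - v} + ennreal (g v) \<le> ennreal (g x)" by (simp add: tail[OF x(1)])
      then show ?thesis using g(2)[OF v] by (simp add: ennreal_minus[symmetric] ennreal_le_minus_iff)
    qed
    \<comment> \<open>The offset \<open>2\<close> keeps \<open>x n\<close> positive from
      \<open>n = 0\<close> on.\<close>
    define x where "x n = v - v / real (n + 2)" for n :: nat
    have x: "0 < x n" "x n < v" for n
      using v by (auto simp: x_def field_simps intro!: add_pos_nonneg)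
    have "x \<longlonglongrightarrow> v - 0"
      unfolding x_def by (intro tendsto_diff tendsto_const LIMSEQ_ignore_initial_segment lim_const_over_n)
    then have "(\<lambda>n. ennreal (g (x n) - g v)) \<longlonglongrightarrow> ennreal (g v - g v)"
      by (intro tendsto_ennrealI tendsto_diff tendsto_const isCont_tendsto_compose[OF g(1)[OF v]]) simp
    then have "emeasure L {v, - v} \<le> ennreal (g v - g v)"
      by (rule tendsto_lowerbound) (use le x in auto)
    then show ?thesis by simp
  qed
  then have "{v, - v} \<in> null_sets L" by (auto simp: null_sets_def s)
  from AE_not_in[OF this] show ?thesis
    by eventually_elim (auto simp: v_def)
qed

theorem theorem3p1:
  fixes M :: "'a measure" and X :: "real \<Rightarrow> 'a \<Rightarrow> real"
    and N :: "'b measure" and Y :: "real \<Rightarrow> 'b \<Rightarrow> real"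
    and \<gamma> :: real and PiX PiY :: "real measure"
    and a b :: "real \<Rightarrow> real" and \<alpha> c :: real and F :: "real filter"
  assumes F: "F = at_right 0 \<or> F = at_top"
    and X_levy: "levy_process M X" and X_trip: "levy_triplet M X \<gamma> 0 PiX"
    and b_pos: "\<forall>t>0. b t > 0"
    and Y_levy: "levy_process N Y" and Y_trip: "levy_triplet N Y 0 0 PiY"
    and alpha: "0 < \<alpha>" "\<alpha> < 2" and c_pos: "c > 0"
    and Y_stable: "stable_levy_measure \<alpha> PiY"
    and Y_tail: "\<forall>x>0. emeasure PiY (UNIV - {-x..x}) = ennreal (c * x powr (-\<alpha>))"
    and Y_nondeg: "\<not> (\<exists>k. AE \<omega> in N. Y 1 \<omega> = k)"
    and Y_nonnormal: "\<not> (\<exists>\<mu> \<sigma>. \<sigma> > 0 \<and> distributed N lborel (Y 1) (normal_density \<mu> \<sigma>))"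
    and DoA: "conv_distr_R F M (\<lambda>t \<omega>. (X t \<omega> - a t) / b t) N (Y 1)"
    and FCLT: "conv_distr_D F M (\<lambda>t \<omega> \<tau>. (X (\<tau> * t) \<omega> - \<tau> * a t) / b t) N (\<lambda>\<omega> \<tau>. Y \<tau> \<omega>)"
  shows
    "(((\<lambda>x. emeasure PiX {x<..}) \<longlongrightarrow> \<infinity>) (at_right 0) \<longrightarrow>
        (\<forall>r\<ge>1. conv_distr_D F M
           (\<lambda>t \<omega> \<tau>. ((Rtrim ^^ r) (\<lambda>\<sigma>. X (\<sigma> * t) \<omega>) \<tau> - \<tau> * a t) / b t)
           N (\<lambda>\<omega>. (Rtrim ^^ r) (\<lambda>\<tau>. Y \<tau> \<omega>)))) \<and>
     (((\<lambda>x. emeasure PiX {x<..}) \<longlongrightarrow> \<infinity>) (at_right 0) \<and>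
      ((\<lambda>x. emeasure PiX {..<-x}) \<longlongrightarrow> \<infinity>) (at_right 0) \<longrightarrow>
        (\<forall>r s. conv_distr_D F M
           (\<lambda>t \<omega> \<tau>. (Trim_rs r s (\<lambda>\<sigma>. X (\<sigma> * t) \<omega>) \<tau> - \<tau> * a t) / b t)
           N (\<lambda>\<omega>. Trim_rs r s (\<lambda>\<tau>. Y \<tau> \<omega>)))) \<and>
     (((\<lambda>x. emeasure PiX {x<..} + emeasure PiX {..<-x}) \<longlongrightarrow> \<infinity>) (at_right 0) \<longrightarrow>
        (\<forall>r\<ge>1. conv_distr_D F M
           (\<lambda>t \<omega> \<tau>. ((Mtrim ^^ r) (\<lambda>\<sigma>. X (\<sigma> * t) \<omega>) \<tau> - \<tau> * a t) / b t)
           N (\<lambda>\<omega>. (Mtrim ^^ r) (\<lambda>\<tau>. Y \<tau> \<omega>))))"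
proof -
  have Fpos: "eventually (\<lambda>t. 0 < t) F"
    using F eventually_gt_at_top[of "0::real"] by (auto simp: eventually_at_right_less)
  have M: "prob_space M" and N: "prob_space N" using X_levy Y_levy by (auto simp: levy_process_def)
  have Ym: "(\<lambda>\<omega> \<tau>. Y \<tau> \<omega>) \<in> measurable N path_space"
    using levy_process_measurable_path[OF Y_levy zero_less_one] by simp
  \<comment> \<open>The tail of the stable Levy measure is a continuous power, so no pair of
    opposite points has mass.\<close>
  have "AE z in PiY. \<bar>y\<bar> \<noteq> \<bar>z\<bar>" for y
  proof (rule AE_abs_ne_of_continuous_tail[where g = "\<lambda>x. c * x powr (-\<alpha>)"])
    show "sets PiY = sets borel" "emeasure PiY {0} = 0" using Y_trip by (auto simp: levy_triplet_def)
    show "isCont (\<lambda>x. c * x powr (-\<alpha>)) x" if "0 < x" for x :: real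
      using that by (intro continuous_intros) auto
  qed (use Y_tail c_pos in auto)
  then have tf: "AE \<omega> in N. tie_free (\<lambda>\<tau>. Y \<tau> \<omega>)" by (rule AE_tie_free[OF Y_levy Y_trip])
  have conv: "conv_distr_D F M (\<lambda>t \<omega> \<tau>. (T (\<lambda>\<sigma>. X (\<sigma> * t) \<omega>) \<tau> - \<tau> * a t) / b t) N (\<lambda>\<omega>. T (\<lambda>\<tau>. Y \<tau> \<omega>))"
    if "J1_operator C T" "AE \<omega> in N. C (\<lambda>\<tau>. Y \<tau> \<omega>)" for C T
    by (rule conv_distr_D_J1_operator[OF that(1) M N Fpos b_pos _ Ym that(2) FCLT])
      (rule levy_process_measurable_path[OF X_levy])
  have "J1_operator (\<lambda>_. True) (Trim_rs r s)" for r s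
    unfolding Trim_rs_def
    by (intro J1_operator_comp J1_operator_funpow J1_operator_Trim_plus J1_operator_Trim_minus)
  \<comment> \<open>\<open>C\<close> is constantly true for the compositions of one-sided trimmings
    and \<open>tie_free\<close> for record and modulus trimming.\<close>
  then show ?thesis
    using conv[OF J1_operator_funpow[OF J1_operator_Rtrim] tf]
      conv[OF J1_operator_funpow[OF J1_operator_Mtrim] tf] conv[OF _ AE_I2[OF TrueI]]
    by blast
qed

end
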